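(* Let $E=\mathbb C/\Lambda$, let $p_1,\dots,p_N\in E$ be distinct, let $\ell_1,\dots,\ell_N\in\mathbb N$, and suppose $\ell:=\sum_{i=1}^N\ell_i$ is odd. Consider the polynomial system $F_0=F_1=\dots=F_N=0$ in the unknowns $(A_1,\dots,A_N,B)\in\mathbb C^{N+1}$ (see context), whose zeros are exactly the parameters for which the generalized Lamé equation has only logarithm-free solutions at every $p_i$. Then this zero set is a finite set, and the number of its points counted with (intersection) multiplicity equals $$a_L=\tfrac12\prod_{i=1}^N(\ell_i+1),$$ i.e. half of the Bézout number $\prod_{i=1}^N(\ell_i+1)$ of the system.
   Context: Notation: $\wp,\zeta$ are the Weierstrass functions of $\Lambda$; $\eta_i=\ell_i/2$. The generalized Lamé equation is $w''=I(z)w$ with $$I(z)=\sum_{j=1}^N\eta_j(\eta_j+1)\wp(z-p_j)+\sum_{j=1}^NA_j\zeta(z-p_j)+B,\qquad \sum_j A_j=0 .$$ For each $i$, expand near $z=p_i$: $I(z)=\frac{\eta_i(\eta_i+1)}{(z-p_i)^2}+\frac{A_i}{z-p_i}+B+\sum_{k\ge0}L^{(i)}_k(z-p_i)^k$, so each $L^{(i)}_k$ is a linear form in $A_1,\dots,A_N$ plus a constant (coefficients are Taylor coefficients of $\zeta(z-p_j)$, $\wp(z-p_j)$ at $p_i$, using the regular parts of $\zeta(z)-1/z$ and $\wp(z)-1/z^2$ at $0$ when $j=i$). Define $\tilde e_0=A_i/\ell_i$ and recursively, for $0\le k\le\ell_i-2$, $$(\ell_i-(k+1))\tilde e_{k+1}=-\sum_{t=0}^k\tilde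 e_t\tilde e_{k-t}+B\,\delta_{k,0}+L^{(i)}_k ,$$ and set $F_i:=-\sum_{t=0}^{\ell_i-1}\tilde e_t\tilde e_{\ell_i-1-t}+B\,\delta_{\ell_i-1,0}+L^{(i)}_{\ell_i-1}$ (a polynomial in $A_1,\dots,A_N,B$ of degree $\ell_i+1$); finally $F_0:=\sum_{i=1}^NA_i$. The vanishing of $F_i$ is equivalent to the absence of logarithmic solutions at $p_i$. *)

theory Defs
  imports "HOL-Analysis.Analysis"
begin

definition lattice :: "complex \<Rightarrow> complex \<Rightarrow> complex set" where
  "lattice \<omega>1 \<omega>2 = {of_int m * \<omega>1 + of_int n * \<omega>2 | m n. True}"

definition wp_reg :: "complex \<Rightarrow> complex \<Rightarrow> complex \<Rightarrow> complex" where
  "wp_reg \<omega>1 \<omega>2 z = (\<Sum>\<^sub>\<infinity>\<omega>\<in>lattice \<omega>1 \<omega>2 - {0}. 1 / (z - \<omega>)^2 - 1 / \<omega>^2)"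

definition zeta_reg :: "complex \<Rightarrow> complex \<Rightarrow> complex \<Rightarrow> complex" where
  "zeta_reg \<omega>1 \<omega>2 z = (\<Sum>\<^sub>\<infinity>\<omega>\<in>lattice \<omega>1 \<omega>2 - {0}. 1 / (z - \<omega>) + 1 / \<omega> + z / \<omega>^2)"

definition wp :: "complex \<Rightarrow> complex \<Rightarrow> complex \<Rightarrow> complex" where
  "wp \<omega>1 \<omega>2 z = 1 / z^2 + wp_reg \<omega>1 \<omega>2 z"

definition wzeta :: "complex \<Rightarrow> complex \<Rightarrow> complex \<Rightarrow> complex" where
  "wzeta \<omega>1 \<omega>2 z = 1 / z + zeta_reg \<omega>1 \<omega>2 z"

definition taylor_coeff :: "(complex \<Rightarrow> complex) \<Rightarrow> complex \<Rightarrow> nat \<Rightarrow> complex" where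
  "taylor_coeff f x k = (deriv ^^ k) f x / of_nat (fact k)"

definition cwp :: "complex \<Rightarrow> complex \<Rightarrow> ('n \<Rightarrow> complex) \<Rightarrow> 'n \<Rightarrow> 'n \<Rightarrow> nat \<Rightarrow> complex" where
  "cwp \<omega>1 \<omega>2 p i j k =
     (if j = i then taylor_coeff (\<lambda>z. wp_reg \<omega>1 \<omega>2 (z - p j)) (p i) k
      else taylor_coeff (\<lambda>z. wp \<omega>1 \<omega>2 (z - p j)) (p i) k)"

definition czeta :: "complex \<Rightarrow> complex \<Rightarrow> ('n \<Rightarrow> complex) \<Rightarrow> 'n \<Rightarrow> 'n \<Rightarrow> nat \<Rightarrow> complex" where
  "czeta \<omega>1 \<omega>2 p i j k =
     (if j = i then taylor_coeff (\<lambda>z. zeta_reg \<omega>1 \<omega>2 (z - p j)) (p i) k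
      else taylor_coeff (\<lambda>z. wzeta \<omega>1 \<omega>2 (z - p j)) (p i) k)"

definition eta :: "nat \<Rightarrow> complex" where
  "eta l = of_nat l / 2"

definition Lcoef :: "complex \<Rightarrow> complex \<Rightarrow> ('n::finite \<Rightarrow> complex) \<Rightarrow> ('n \<Rightarrow> nat) \<Rightarrow> 'n
     \<Rightarrow> nat \<Rightarrow> complex^'n \<Rightarrow> complex" where
  "Lcoef \<omega>1 \<omega>2 p ls i k A =
     (\<Sum>j\<in>UNIV. eta (ls j) * (eta (ls j) + 1) * cwp \<omega>1 \<omega>2 p i j k
               + A $ j * czeta \<omega>1 \<omega>2 p i j k)"

text \<open>etl l a b Lk k = [e~_0, ..., e~_k], where a = A_i, l = ls_i, Lk k = L^{(i)}_k.\<close>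
primrec etl :: "nat \<Rightarrow> complex \<Rightarrow> complex \<Rightarrow> (nat \<Rightarrow> complex) \<Rightarrow> nat \<Rightarrow> complex list" where
  "etl l a b Lk 0 = [a / of_nat l]"
| "etl l a b Lk (Suc k) =
     (let e = etl l a b Lk k in
      e @ [(- (\<Sum>t\<le>k. e ! t * e ! (k - t)) + (if k = 0 then b else 0) + Lk k)
           / of_nat (l - Suc k)])"

definition Fpoly :: "nat \<Rightarrow> complex \<Rightarrow> complex \<Rightarrow> (nat \<Rightarrow> complex) \<Rightarrow> complex" where
  "Fpoly l a b Lk =
     (let e = etl l a b Lk (l - 1) in
      - (\<Sum>t\<le>l - 1. e ! t * e ! (l - 1 - t)) + (if l - 1 = 0 then b else 0) + Lk (l - 1))"

definition lame_system :: "complex \<Rightarrow> complex \<Rightarrow> ('n::finite \<Rightarrow> complex) \<Rightarrow> ('n \<Rightarrow> nat)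
     \<Rightarrow> (complex^'n) \<times> complex \<Rightarrow> complex \<times> (complex^'n)" where
  "lame_system \<omega>1 \<omega>2 p ls AB =
     (let A = fst AB; B = snd AB in
      ((\<Sum>i\<in>UNIV. A $ i),
       (\<chi> i. Fpoly (ls i) (A $ i) B (\<lambda>k. Lcoef \<omega>1 \<omega>2 p ls i k A))))"

text \<open>Geometric (local-degree) multiplicity: the number of preimages, near x, of a
  generic value w near 0; it is at most m for all small w and equal to m for a dense set of w.\<close>
definition zero_mult :: "('a::metric_space \<Rightarrow> 'b::real_normed_vector) \<Rightarrow> 'a \<Rightarrow> nat" where
  "zero_mult f x = (THE m. \<exists>r>0. \<exists>\<delta>>0.
       {z \<in> cball x r. f z = 0} = {x} \<and>
       (\<forall>w\<in>ball 0 \<delta>. finite {z \<in> ball x r. f z = w} \<and> card {z \<in> ball x r. f z = w} \<le> m) \<and>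
       ball 0 \<delta> \<subseteq> closure {w \<in> ball 0 \<delta>. card {z \<in> ball x r. f z = w} = m})"

end

theory Submission
  imports "Jordan_Normal_Form.Char_Poly" "HOL-Computational_Algebra.Formal_Power_Series" Defs
begin

text \<open>Put \<open>B = \<mu>\<^sup>2\<close> and give all \<open>A\<^sub>i\<close> and \<open>\<mu>\<close> degree 1.  The leading form of \<open>F\<^sub>i\<close> is, up to a constant, the
  product of the linear forms \<open>A\<^sub>i + (l\<^sub>i - 2j)\<mu>\<close> with \<open>0 \<le> j \<le> l\<^sub>i\<close>, and since \<open>\<Sum> l\<^sub>i\<close> is odd, one
  factor from each \<open>F\<^sub>i\<close> together with \<open>F\<^sub>0\<close> always forms a coordinate system.  Newton-type division then
  shows that the polynomials in \<open>(A, \<mu>)\<close> are spanned, over the polynomials in the \<open>F\<^sub>i\<close>, by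
  \<open>m = \<Prod> (l\<^sub>i + 1)\<close> products of linear forms.  So multiplication by \<open>g\<close> on a fibre is given by an \<open>m \<times> m\<close>
  matrix depending polynomially on the value \<open>w\<close> of the system.  These matrices bound the fibres, and
  deforming the system to its leading forms, where the zeros are explicit, shows that a generic fibre has
  exactly \<open>m\<close> points, that is \<open>m / 2\<close> points \<open>(A, B)\<close>.  Over generic \<open>w\<close> the determinant is the product of \<open>g\<close>
  over the fibre; its continuity at \<open>w = 0\<close> makes the number of fibre points near a zero constant,
  which is the multiplicity of that zero.\<close>

text \<open>With ordinary degrees the top form of \<open>F_i\<close> is a multiple of
  \<open>A_i^(l_i + 1)\<close>, and all of these vanish at the point A = 0 at infinity, so Bezout's
  count loses solutions there. With weight 1 for the \<open>A_i\<close> and 2 for B nothing is left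
  at infinity, and the weighted Bezout number is the product of the \<open>l_i + 1\<close> divided
  by 2. Setting B = \<mu>^2 turns weights into degrees, at the price that each (A, B) with B
  \<noteq> 0 is met twice. If some sum of numbers \<open>l_i - 2j\<close> were zero, a whole line
  would solve the leading equations; parity forbids this. Two obstacles shape the proof. The leading
  forms share only the origin, a highly degenerate zero, so the deformation ends at
  \<open>F_0 = 1\<close> instead, where all zeros are simple. And multiplicity is defined by
  counting preimages of values w near 0, where points collide and cannot be followed one by one;
  norms of functions, that is determinants, stay continuous through the collisions.\<close>

section \<open>Polynomials with parameter-dependent coefficients\<close>

text \<open>In \<open>pdeg R X D f\<close>, \<open>f \<theta>\<close> is a polynomial of total degree at most \<open>D\<close> in the coordinates \<open>X\<close>, and its
  coefficients are functions of the parameter \<open>\<theta>\<close> that lie in \<open>R\<close>.\<close>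

inductive pdeg :: "('p \<Rightarrow> complex) set \<Rightarrow> ('c \<Rightarrow> 'v \<Rightarrow> complex) \<Rightarrow> nat \<Rightarrow> ('p \<Rightarrow> 'v \<Rightarrow> complex) \<Rightarrow> bool"
  for R X where
  coeff: "c \<in> R \<Longrightarrow> pdeg R X D (\<lambda>\<theta> x. c \<theta>)"
| coord: "1 \<le> D \<Longrightarrow> pdeg R X D (\<lambda>\<theta> x. X c x)"
| add: "pdeg R X D f \<Longrightarrow> pdeg R X D g \<Longrightarrow> pdeg R X D (\<lambda>\<theta> x. f \<theta> x + g \<theta> x)"
| mult: "pdeg R X D f \<Longrightarrow> pdeg R X E g \<Longrightarrow> D + E \<le> F \<Longrightarrow> pdeg R X F (\<lambda>\<theta> x. f \<theta> x * g \<theta> x)"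

lemma pdeg_mono: "pdeg R X D f \<Longrightarrow> D \<le> E \<Longrightarrow> pdeg R X E f"
proof (induction arbitrary: E rule: pdeg.induct)
  case (mult D f E g F)
  show ?case by (rule pdeg.mult[OF mult.hyps(1,2)]) (use mult in linarith)
qed (auto intro: pdeg.intros)

text \<open>Two rings occur: polynomial functions of the deformation parameter, for the sake of
  finite root sets, and continuous functions of the value w.\<close>

locale coeff_ring =
  fixes R :: "('p \<Rightarrow> complex) set" and X :: "'c \<Rightarrow> 'v \<Rightarrow> complex"
  assumes const_R: "(\<lambda>_. a) \<in> R"
    and add_R: "c \<in> R \<Longrightarrow> c' \<in> R \<Longrightarrow> (\<lambda>\<theta>. c \<theta> + c' \<theta>) \<in> R"
    and mult_R: "c \<in> R \<Longrightarrow> c' \<in> R \<Longrightarrow> (\<lambda>\<theta>. c \<theta> * c' \<theta>) \<in> R"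
begin

lemma pdeg_const: "pdeg R X D (\<lambda>_ _. a)"
  using coeff[OF const_R] .

lemma pdeg_cmult: "pdeg R X D f \<Longrightarrow> pdeg R X D (\<lambda>\<theta> x. a * f \<theta> x)"
  using mult[OF pdeg_const[of 0 a]] by simp

lemma pdeg_uminus: "pdeg R X D f \<Longrightarrow> pdeg R X D (\<lambda>\<theta> x. - f \<theta> x)"
  using pdeg_cmult[of D f "-1"] by simp

lemma pdeg_diff: "pdeg R X D f \<Longrightarrow> pdeg R X D g \<Longrightarrow> pdeg R X D (\<lambda>\<theta> x. f \<theta> x - g \<theta> x)"
  using add[OF _ pdeg_uminus] by fastforce

lemma pdeg_divide: "pdeg R X D f \<Longrightarrow> pdeg R X D (\<lambda>\<theta> x. f \<theta> x / a)"
  using pdeg_cmult[of D f "1 / a"] by simp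

lemma pdeg_sum: "(\<And>i. i \<in> S \<Longrightarrow> pdeg R X D (f i)) \<Longrightarrow> pdeg R X D (\<lambda>\<theta> x. \<Sum>i\<in>S. f i \<theta> x)"
  by (induction S rule: infinite_finite_induct) (auto intro: pdeg_const add)

lemma pdeg_prod: "(\<And>i. i \<in> S \<Longrightarrow> pdeg R X (D i) (f i)) \<Longrightarrow> pdeg R X (sum D S) (\<lambda>\<theta> x. \<Prod>i\<in>S. f i \<theta> x)"
  by (induction S rule: infinite_finite_induct) (auto intro: pdeg_const mult[OF _ _ order.refl])

text \<open>Expansion about the common zero of the coordinates \<open>\<mu>\<close>. For products, f
  g = c c' + c (g - c') + (f - c) g. The clause for D = 0 repairs the truncated
  \<open>D - 1\<close>: without it a constant f times g would get no drop in degree.\<close>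

lemma pdeg_decompose:
  fixes \<mu> :: "'i::finite \<Rightarrow> 'v \<Rightarrow> complex"
  assumes coords: "\<And>c x. X c x = a0 c + (\<Sum>i\<in>UNIV. a c i * \<mu> i x)"
  shows "pdeg R X D f \<Longrightarrow> \<exists>c\<in>R. \<exists>h. (\<forall>\<theta> x. f \<theta> x = c \<theta> + (\<Sum>i\<in>UNIV. \<mu> i x * h i \<theta> x)) \<and>
      (\<forall>i. pdeg R X (D - 1) (h i)) \<and> (D = 0 \<longrightarrow> (\<forall>i \<theta> x. h i \<theta> x = 0))"
proof (induction rule: pdeg.induct)
  case (coeff c D)
  show ?case by (rule bexI[OF _ coeff], rule exI[of _ "\<lambda>_ _ _. 0"]) (simp add: pdeg_const)
next
  case (coord D c)
  show ?case
  proof (intro bexI[OF _ const_R[of "a0 c"]] exI[of _ "\<lambda>i _ _. a c i"] conjI allI)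
    show "X c x = a0 c + (\<Sum>i\<in>UNIV. \<mu> i x * a c i)" for x
      by (simp add: coords mult.commute)
  qed (use coord in \<open>simp_all add: pdeg_const\<close>)
next
  case (add D f g)
  from add.IH(1) obtain c h where 1: "c \<in> R" "\<forall>\<theta> x. f \<theta> x = c \<theta> + (\<Sum>i\<in>UNIV. \<mu> i x * h i \<theta> x)"
    "\<forall>i. pdeg R X (D - 1) (h i)" "D = 0 \<longrightarrow> (\<forall>i \<theta> x. h i \<theta> x = 0)"
    by (elim bexE exE conjE) (rule that)
  from add.IH(2) obtain c' h' where 2: "c' \<in> R" "\<forall>\<theta> x. g \<theta> x = c' \<theta> + (\<Sum>i\<in>UNIV. \<mu> i x * h' i \<theta> x)"
    "\<forall>i. pdeg R X (D - 1) (h' i)" "D = 0 \<longrightarrow> (\<forall>i \<theta> x. h' i \<theta> x = 0)"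
    by (elim bexE exE conjE) (rule that)
  show ?case
  proof (intro bexI[OF _ add_R[OF 1(1) 2(1)]] exI[of _ "\<lambda>i \<theta> x. h i \<theta> x + h' i \<theta> x"] conjI allI)
    show "pdeg R X (D - 1) (\<lambda>\<theta> x. h i \<theta> x + h' i \<theta> x)" for i
      by (rule pdeg.add[OF 1(3)[rule_format] 2(3)[rule_format]])
  qed (use 1(4) 2(4) in \<open>simp_all add: 1(2) 2(2) ring_distribs sum.distrib\<close>)
next
  case (mult D f E g F)
  from mult.IH(1) obtain c h where 1: "c \<in> R" "\<forall>\<theta> x. f \<theta> x = c \<theta> + (\<Sum>i\<in>UNIV. \<mu> i x * h i \<theta> x)"
    "\<forall>i. pdeg R X (D - 1) (h i)" "D = 0 \<longrightarrow> (\<forall>i \<theta> x. h i \<theta> x = 0)"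
    by (elim bexE exE conjE) (rule that)
  from mult.IH(2) obtain c' h' where 2: "c' \<in> R" "\<forall>\<theta> x. g \<theta> x = c' \<theta> + (\<Sum>i\<in>UNIV. \<mu> i x * h' i \<theta> x)"
    "\<forall>i. pdeg R X (E - 1) (h' i)" "E = 0 \<longrightarrow> (\<forall>i \<theta> x. h' i \<theta> x = 0)"
    by (elim bexE exE conjE) (rule that)
  let ?h = "\<lambda>i \<theta> x. c \<theta> * h' i \<theta> x + h i \<theta> x * g \<theta> x"
  have c_h': "pdeg R X (F - 1) (\<lambda>\<theta> x. c \<theta> * h' i \<theta> x)" for i
    by (rule pdeg.mult[OF coeff[OF 1(1), where D=0] 2(3)[rule_format]]) (use mult.hyps(3) in linarith)
  have h_g: "pdeg R X (F - 1) (\<lambda>\<theta> x. h i \<theta> x * g \<theta> x)" for i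
  proof (cases "D = 0")
    case True
    then have "h i \<theta> x = 0" for \<theta> x using 1(4) by simp
    then show ?thesis using pdeg_const[of "F - 1" 0] by (simp only: mult_zero_left)
  next
    case False
    show ?thesis by (rule pdeg.mult[OF 1(3)[rule_format] mult.hyps(2)]) (use mult.hyps(3) False in linarith)
  qed
  show ?case
  proof (intro bexI[OF _ mult_R[OF 1(1) 2(1)]] exI[of _ ?h] conjI allI)
    fix \<theta> x
    have "(\<Sum>i\<in>UNIV. \<mu> i x * ?h i \<theta> x) = c \<theta> * (\<Sum>i\<in>UNIV. \<mu> i x * h' i \<theta> x) + (\<Sum>i\<in>UNIV. \<mu> i x * h i \<theta> x) * g \<theta> x"
      by (simp add: sum_distrib_left sum_distrib_right sum.distrib algebra_simps)
    also have "c \<theta> * (\<Sum>i\<in>UNIV. \<mu> i x * h' i \<theta> x) = c \<theta> * (g \<theta> x - c' \<theta>)"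
      by (simp add: 2(2))
    finally show "f \<theta> x * g \<theta> x = c \<theta> * c' \<theta> + (\<Sum>i\<in>UNIV. \<mu> i x * ?h i \<theta> x)"
      by (simp add: 1(2)) (simp add: algebra_simps)
  next
    show "pdeg R X (F - 1) (?h i)" for i
      by (rule pdeg.add[OF c_h' h_g])
  next
    show "F = 0 \<longrightarrow> (\<forall>i \<theta> x. ?h i \<theta> x = 0)"
      using 1(4) 2(4) mult.hyps(3) by simp
  qed
qed

end

section \<open>Perturbed products of linear forms\<close>

text \<open>By \<open>coords\<close>, any choice of one factor per equation is a system of affine
  coordinates; by \<open>lower\<close>, a completed product can be traded for terms of smaller
  degree.\<close>

locale product_system = coeff_ring R X
  for R :: "('p \<Rightarrow> complex) set" and X :: "'c::finite \<Rightarrow> 'v \<Rightarrow> complex" +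
  fixes d :: "'i::finite \<Rightarrow> nat" and lam :: "'i \<Rightarrow> nat \<Rightarrow> 'v \<Rightarrow> complex"
    and q :: "'i \<Rightarrow> 'p \<Rightarrow> 'v \<Rightarrow> complex"
  assumes d_pos: "0 < d i"
    and coords: "(\<And>i. k i < d i) \<Longrightarrow> \<exists>a0 a. \<forall>c x. X c x = a0 c + (\<Sum>i\<in>UNIV. a c i * lam i (k i) x)"
    and lower: "pdeg R X (d i - 1) (q i)"
    and lam_linear: "pdeg R X 1 (\<lambda>\<theta>. lam i j)"
    and inj_X: "inj (\<lambda>x c. X c x)" and surj_X: "surj (\<lambda>x c. X c x)"
begin

definition zeros :: "'p \<Rightarrow> 'v set" where
  "zeros \<theta> = {x. \<forall>i. (\<Prod>j<d i. lam i j x) + q i \<theta> x = 0}"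

definition idx :: "('i \<Rightarrow> nat) set" where
  "idx = {k. \<forall>i. k i < d i}"

text \<open>The analogue of the Newton basis 1, x - a, (x - a)(x - b), ... in one variable.\<close>

definition bas :: "('i \<Rightarrow> nat) \<Rightarrow> 'v \<Rightarrow> complex" where
  "bas k x = (\<Prod>i\<in>UNIV. \<Prod>j<k i. lam i j x)"

definition spanned :: "('p \<Rightarrow> 'v \<Rightarrow> complex) \<Rightarrow> bool" where
  "spanned f \<longleftrightarrow> (\<exists>C. (\<forall>l\<in>idx. C l \<in> R) \<and> (\<forall>\<theta>. \<forall>x\<in>zeros \<theta>. f \<theta> x = (\<Sum>l\<in>idx. C l \<theta> * bas l x)))"

lemma idx_PiE: "idx = (\<Pi>\<^sub>E i\<in>UNIV. {..<d i})"
  by (auto simp: idx_def PiE_def Pi_def)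

lemma finite_idx: "finite idx"
  unfolding idx_PiE by (intro finite_PiE) auto

lemma card_idx: "card idx = (\<Prod>i\<in>UNIV. d i)"
  unfolding idx_PiE by (subst card_PiE) auto

lemma zero_idx: "(\<lambda>_. 0) \<in> idx"
  by (simp add: idx_def d_pos)

lemma bas_0: "bas (\<lambda>_. 0) x = 1"
  by (simp add: bas_def)

lemma bas_upd: "bas (k(i := n)) x = (\<Prod>j<n. lam i j x) * (\<Prod>i'\<in>UNIV - {i}. \<Prod>j<k i'. lam i' j x)"
proof -
  have "bas (k(i := n)) x = (\<Prod>i'\<in>insert i (UNIV - {i}). \<Prod>j<(k(i := n)) i'. lam i' j x)"
    unfolding bas_def by (rule prod.cong) auto
  also have "\<dots> = (\<Prod>j<n. lam i j x) * (\<Prod>i'\<in>UNIV - {i}. \<Prod>j<(k(i := n)) i'. lam i' j x)"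
    by (subst prod.insert) auto
  finally show ?thesis by simp
qed

lemma sum_upd: "sum (k(i := n)) UNIV + k i = sum k UNIV + n" for k :: "'i \<Rightarrow> nat"
proof -
  have "sum (k(i := n)) UNIV = n + sum k (UNIV - {i})"
    by (subst sum.remove[of UNIV i]) (auto intro!: sum.cong)
  then show ?thesis using sum.remove[of UNIV i k] by simp
qed

lemma spanned_add: "spanned f \<Longrightarrow> spanned g \<Longrightarrow> spanned (\<lambda>\<theta> x. f \<theta> x + g \<theta> x)"
  unfolding spanned_def
proof (elim exE conjE)
  fix C C'
  assume "\<forall>l\<in>idx. C l \<in> R" "\<forall>l\<in>idx. C' l \<in> R"
    "\<forall>\<theta>. \<forall>x\<in>zeros \<theta>. f \<theta> x = (\<Sum>l\<in>idx. C l \<theta> * bas l x)"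
    "\<forall>\<theta>. \<forall>x\<in>zeros \<theta>. g \<theta> x = (\<Sum>l\<in>idx. C' l \<theta> * bas l x)"
  then show "\<exists>C. (\<forall>l\<in>idx. C l \<in> R) \<and> (\<forall>\<theta>. \<forall>x\<in>zeros \<theta>. f \<theta> x + g \<theta> x = (\<Sum>l\<in>idx. C l \<theta> * bas l x))"
    by (intro exI[of _ "\<lambda>l \<theta>. C l \<theta> + C' l \<theta>"]) (auto intro: add_R simp: ring_distribs sum.distrib)
qed

lemma spanned_bas_coeff: "c \<in> R \<Longrightarrow> k \<in> idx \<Longrightarrow> spanned (\<lambda>\<theta> x. bas k x * c \<theta>)"
  unfolding spanned_def
proof (intro exI[of _ "\<lambda>l. if l = k then c else (\<lambda>_. 0)"] conjI allI ballI)
  fix \<theta> x assume k: "k \<in> idx"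
  have "(\<Sum>l\<in>idx. (if l = k then c else (\<lambda>_. 0)) \<theta> * bas l x) = (\<Sum>l\<in>idx. if l = k then c \<theta> * bas k x else 0)"
    by (intro sum.cong) auto
  then show "bas k x * c \<theta> = (\<Sum>l\<in>idx. (if l = k then c else (\<lambda>_. 0)) \<theta> * bas l x)"
    using k by (simp add: finite_idx mult.commute)
qed (auto intro: const_R)

lemma spanned_sum: "(\<And>i. i \<in> S \<Longrightarrow> spanned (f i)) \<Longrightarrow> spanned (\<lambda>\<theta> x. \<Sum>i\<in>S. f i \<theta> x)"
proof (induction S rule: infinite_finite_induct)
  case (insert i S)
  then show ?case using spanned_add[of "f i"] by simp
qed (use spanned_bas_coeff[OF const_R[of 0] zero_idx] in auto)

lemma spanned_cong:
  "spanned f \<Longrightarrow> (\<And>\<theta> x. x \<in> zeros \<theta> \<Longrightarrow> f \<theta> x = g \<theta> x) \<Longrightarrow> spanned g"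
  unfolding spanned_def by auto

text \<open>The forms \<open>lam i (k i)\<close> are affine coordinates, so \<open>g\<close> is a constant plus a combination of them.
  Multiplying \<open>bas k\<close> by \<open>lam i (k i)\<close> either advances the index \<open>k\<close> or completes the product for \<open>i\<close>,
  which equals \<open>- q i\<close> on the zero set and thus lowers the total degree.\<close>
theorem spanned_bas_mult:
  "k \<in> idx \<Longrightarrow> pdeg R X D g \<Longrightarrow> spanned (\<lambda>\<theta> x. bas k x * g \<theta> x)"
proof (induction "sum k UNIV + D" arbitrary: k D g rule: less_induct)
  case outer: less
  from outer.hyps outer.prems show ?case
  \<comment> \<open>Advancing an index keeps \<open>sum k UNIV + D\<close> fixed, so it needs this
    inner induction on the degree; only a completed product lowers the sum and uses the outer
    hypothesis.\<close>
  proof (induction D arbitrary: k g)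
    case 0
    obtain a0 a where a: "\<And>c x. X c x = a0 c + (\<Sum>i\<in>UNIV. a c i * lam i (k i) x)"
      using coords[of k] 0(2) unfolding idx_def by blast
    obtain c where "c \<in> R" "\<And>\<theta> x. g \<theta> x = c \<theta>"
      using pdeg_decompose[OF a 0(3)] by auto
    then show ?case using spanned_bas_coeff 0(2) by simp
  next
    case (Suc D)
    have k: "k i < d i" for i using Suc.prems(2) by (simp add: idx_def)
    obtain a0 a where a: "\<And>c x. X c x = a0 c + (\<Sum>i\<in>UNIV. a c i * lam i (k i) x)"
      using coords[of k] k by blast
    obtain c h where c: "c \<in> R" and g: "\<And>\<theta> x. g \<theta> x = c \<theta> + (\<Sum>i\<in>UNIV. lam i (k i) x * h i \<theta> x)"
      and h: "\<And>i. pdeg R X D (h i)"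
      using pdeg_decompose[OF a Suc.prems(3)] by auto
    have step: "spanned (\<lambda>\<theta> x. bas k x * lam i (k i) x * h i \<theta> x)" for i
    proof (cases "Suc (k i) < d i")
      case True
      let ?k = "k(i := Suc (k i))"
      have "sum ?k UNIV = Suc (sum k UNIV)"
        using sum_upd[of k i "Suc (k i)"] by linarith
      moreover have k': "?k \<in> idx" using k True by (simp add: idx_def)
      ultimately have "spanned (\<lambda>\<theta> x. bas ?k x * h i \<theta> x)"
        by (intro Suc.IH[OF Suc.prems(1) k' h]) simp_all
      moreover have "bas ?k x = bas k x * lam i (k i) x" for x
        using bas_upd[of k i "k i" x] by (simp add: bas_upd)
      ultimately show ?thesis by simp
    next
      case False
      then have di: "d i = Suc (k i)" using k[of i] by simp
      let ?k = "k(i := 0)"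
      have "sum ?k UNIV + k i = sum k UNIV"
        using sum_upd[of k i 0] by linarith
      moreover have k': "?k \<in> idx" using k d_pos by (simp add: idx_def)
      moreover have "pdeg R X (k i + D) (\<lambda>\<theta> x. - q i \<theta> x * h i \<theta> x)"
        using lower[of i] di by (intro mult[OF pdeg_uminus h]) auto
      ultimately have "spanned (\<lambda>\<theta> x. bas ?k x * (- q i \<theta> x * h i \<theta> x))"
        by (intro Suc.prems(1)[of ?k "k i + D"]) (simp_all del: fun_upd_apply)
      then show ?thesis
      proof (rule spanned_cong)
        fix \<theta> x assume x: "x \<in> zeros \<theta>"
        have "- q i \<theta> x = (\<Prod>j<d i. lam i j x)"
          using x unfolding zeros_def by (simp add: add_eq_0_iff2)
        moreover have "bas k x = (\<Prod>j<k i. lam i j x) * bas ?k x"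
          using bas_upd[of k i "k i" x] bas_upd[of k i 0 x] by simp
        ultimately show "bas ?k x * (- q i \<theta> x * h i \<theta> x) = bas k x * lam i (k i) x * h i \<theta> x"
          by (simp add: di)
      qed
    qed
    have "spanned (\<lambda>\<theta> x. bas k x * c \<theta> + (\<Sum>i\<in>UNIV. bas k x * lam i (k i) x * h i \<theta> x))"
      by (intro spanned_add spanned_sum spanned_bas_coeff step c Suc.prems(2))
    then show ?case by (simp add: g ring_distribs sum_distrib_left mult.assoc)
  qed
qed

end

section \<open>Multiplication matrices\<close>

text \<open>Lagrange interpolation with separating functions in place of coordinate differences.
  \<open>Q\<close> is abstract because it serves both for polynomials in \<open>X\<close> and for
  functions of (A, B) later on.\<close>

lemma finite_interpolation:
  fixes Q :: "('v \<Rightarrow> complex) set"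
  assumes const: "\<And>a. (\<lambda>_. a) \<in> Q"
    and add: "\<And>f g. f \<in> Q \<Longrightarrow> g \<in> Q \<Longrightarrow> (\<lambda>x. f x + g x) \<in> Q"
    and mult: "\<And>f g. f \<in> Q \<Longrightarrow> g \<in> Q \<Longrightarrow> (\<lambda>x. f x * g x) \<in> Q"
    and sep: "\<And>x y. x \<noteq> y \<Longrightarrow> \<exists>g\<in>Q. g x \<noteq> g y"
    and Y: "finite Y"
  obtains g where "g \<in> Q" "\<And>y. y \<in> Y \<Longrightarrow> g y = h y"
proof -
  have prod: "(\<lambda>x. \<Prod>i\<in>S. f i x) \<in> Q" if "\<And>i. i \<in> S \<Longrightarrow> f i \<in> Q" for S :: "'v set" and f
    using that by (induction S rule: infinite_finite_induct) (auto intro: const mult)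
  have sum: "(\<lambda>x. \<Sum>i\<in>S. f i x) \<in> Q" if "\<And>i. i \<in> S \<Longrightarrow> f i \<in> Q" for S :: "'v set" and f
    using that by (induction S rule: infinite_finite_induct) (auto intro: const add)
  obtain s where s: "\<And>x y. x \<noteq> y \<Longrightarrow> s x y \<in> Q \<and> s x y x \<noteq> s x y y"
    using sep by metis
  define L where "L y x = (\<Prod>y'\<in>Y - {y}. (s y y' x + - s y y' y') * (1 / (s y y' y - s y y' y')))" for y x
  have "L y \<in> Q" for y
    unfolding L_def using s by (intro prod mult add const) auto
  moreover have "L y y' = (if y = y' then 1 else 0)" if "y \<in> Y" "y' \<in> Y" for y y'
  proof (cases "y = y'")
    case True
    have "s y y'' y \<noteq> s y y'' y''" if "y'' \<in> Y - {y}" for y''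
      using s[of y y''] that by auto
    then show ?thesis unfolding L_def True[symmetric] by (auto intro!: prod.neutral)
  next
    case False
    then show ?thesis using that Y by (auto simp: L_def)
  qed
  ultimately show ?thesis
    by (intro that[of "\<lambda>x. \<Sum>y\<in>Y. L y x * h y"] sum mult const)
       (auto simp: Y if_distrib[of "\<lambda>z. z * _"] sum.delta cong: if_cong)
qed

context product_system
begin

definition m :: nat where "m = card idx"

definition en :: "nat \<Rightarrow> 'i \<Rightarrow> nat" where
  "en = (SOME e. bij_betw e {0..<m} idx)"

lemma bij_en: "bij_betw en {0..<m} idx"
  using ex_bij_betw_nat_finite[OF finite_idx] unfolding en_def m_def by (rule someI_ex)

text \<open>The position of the basis function 1. It keeps evaluation vectors nonzero, and row
  \<open>i0\<close> of a multiplication matrix expands the function itself.\<close>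

definition i0 :: nat where "i0 = (SOME i. i < m \<and> en i = (\<lambda>_. 0))"

lemma i0: "i0 < m" "en i0 = (\<lambda>_. 0)"
proof -
  have "\<exists>i. i < m \<and> en i = (\<lambda>_. 0)"
    using bij_en zero_idx unfolding bij_betw_def by (metis atLeast0LessThan image_iff lessThan_iff)
  then show "i0 < m" "en i0 = (\<lambda>_. 0)"
    unfolding i0_def by (metis (mono_tags, lifting) someI_ex)+
qed

definition bv :: "nat \<Rightarrow> 'v \<Rightarrow> complex" where "bv k = bas (en k)"

lemma bv_i0: "bv i0 x = 1"
  by (simp add: bv_def i0 bas_0)

lemma sum_idx: "(\<Sum>l\<in>idx. f l) = (\<Sum>l<m. f (en l))"
  using sum.reindex_bij_betw[OF bij_en, of f] by (simp add: atLeast0LessThan)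

text \<open>A relation and not a function: over a fibre with fewer than \<open>m\<close> points the
  \<open>bv l\<close> are dependent, and the matrix of multiplication by \<open>g\<close> is not
  determined by its values there.\<close>

definition represents :: "('p \<Rightarrow> 'v \<Rightarrow> complex) \<Rightarrow> (nat \<Rightarrow> nat \<Rightarrow> 'p \<Rightarrow> complex) \<Rightarrow> bool" where
  "represents g C \<longleftrightarrow> (\<forall>k<m. \<forall>l<m. C k l \<in> R) \<and>
     (\<forall>\<theta>. \<forall>x\<in>zeros \<theta>. \<forall>k<m. g \<theta> x * bv k x = (\<Sum>l<m. C k l \<theta> * bv l x))"

lemma represents_exists:
  assumes "pdeg R X D g"
  obtains C where "represents g C"
proof -
  have "\<exists>c. (\<forall>l<m. c l \<in> R) \<and> (\<forall>\<theta>. \<forall>x\<in>zeros \<theta>. g \<theta> x * bv k x = (\<Sum>l<m. c l \<theta> * bv l x))"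
    if k: "k < m" for k
  proof -
    have en: "en k \<in> idx" if "k < m" for k
      using bij_en that unfolding bij_betw_def by auto
    obtain c where "\<forall>l\<in>idx. c l \<in> R" "\<forall>\<theta>. \<forall>x\<in>zeros \<theta>. bas (en k) x * g \<theta> x = (\<Sum>l\<in>idx. c l \<theta> * bas l x)"
      using spanned_bas_mult[OF en[OF k] assms] unfolding spanned_def by blast
    then show ?thesis
      by (intro exI[of _ "\<lambda>l. c (en l)"]) (auto simp: bv_def sum_idx mult.commute en)
  qed
  then obtain C where "\<forall>k<m. (\<forall>l<m. C k l \<in> R) \<and> (\<forall>\<theta>. \<forall>x\<in>zeros \<theta>. g \<theta> x * bv k x = (\<Sum>l<m. C k l \<theta> * bv l x))"
    by metis
  then show ?thesis using that[of C] unfolding represents_def by blast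
qed

definition matr :: "(nat \<Rightarrow> nat \<Rightarrow> 'p \<Rightarrow> complex) \<Rightarrow> 'p \<Rightarrow> complex mat" where
  "matr C \<theta> = Matrix.mat m m (\<lambda>(k, l). C k l \<theta>)"

definition bvec :: "'v \<Rightarrow> complex Matrix.vec" where
  "bvec x = Matrix.vec m (\<lambda>k. bv k x)"

lemma matr_carrier [simp]: "matr C \<theta> \<in> carrier_mat m m"
  by (simp add: matr_def)

lemma bvec_carrier [simp]: "bvec x \<in> carrier_vec m"
  by (simp add: bvec_def)

lemma bvec_nonzero: "bvec x \<noteq> 0\<^sub>v m"
proof
  assume "bvec x = 0\<^sub>v m"
  then have "vec_index (bvec x) i0 = 0" using i0 by simp
  then show False using i0 by (simp add: bvec_def bv_i0)
qed

lemma mat_mult_vec_eq: "M \<in> carrier_mat m m \<Longrightarrow> v \<in> carrier_vec m \<Longrightarrow> k < m \<Longrightarrow>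
    vec_index (M *\<^sub>v v) k = (\<Sum>l<m. M $$ (k, l) * vec_index v l)"
  by (auto simp: scalar_prod_def atLeast0LessThan)

lemma matr_eigenvector:
  assumes "represents g C" "x \<in> zeros \<theta>"
  shows "matr C \<theta> *\<^sub>v bvec x = g \<theta> x \<cdot>\<^sub>v bvec x"
proof (rule eq_vecI)
  fix k assume "k < dim_vec (g \<theta> x \<cdot>\<^sub>v bvec x)"
  then have k: "k < m" by (simp add: bvec_def)
  then have "vec_index (matr C \<theta> *\<^sub>v bvec x) k = (\<Sum>l<m. C k l \<theta> * bv l x)"
    by (subst mat_mult_vec_eq) (auto simp: matr_def bvec_def intro!: sum.cong)
  also have "\<dots> = g \<theta> x * bv k x" using assms k unfolding represents_def by metis
  finally show "vec_index (matr C \<theta> *\<^sub>v bvec x) k = vec_index (g \<theta> x \<cdot>\<^sub>v bvec x) k"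
    using k by (simp add: bvec_def)
qed (simp add: bvec_def matr_def)

lemma det_matr_zero:
  assumes "represents g C" "x \<in> zeros \<theta>" "g \<theta> x = 0"
  shows "Determinant.det (matr C \<theta>) = 0"
proof -
  have "matr C \<theta> *\<^sub>v bvec x = 0\<^sub>v m"
    unfolding matr_eigenvector[OF assms(1,2)] assms(3) by (auto simp: bvec_def)
  then show ?thesis
    using det_0_iff_vec_prod_zero[OF matr_carrier] bvec_nonzero bvec_carrier by blast
qed

text \<open>The row of the largest entry of the eigenvector is compared, as for Gershgorin discs.
  The bound does not involve x, which later makes the system proper.\<close>

lemma matr_bound:
  assumes "represents g C" "x \<in> zeros \<theta>"
  shows "norm (g \<theta> x) \<le> (\<Sum>k<m. \<Sum>l<m. norm (C k l \<theta>))"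
proof -
  let ?N = "(\<lambda>k. norm (bv k x)) ` {..<m}"
  have "Max ?N \<in> ?N" using i0 by (intro Max_in) auto
  then obtain k where k: "k < m" and "Max ?N = norm (bv k x)" by auto
  then have max: "norm (bv l x) \<le> norm (bv k x)" if "l < m" for l
    using Max_ge[of ?N "norm (bv l x)"] that by simp
  have pos: "norm (bv k x) > 0" using max[OF i0(1)] unfolding bv_i0 norm_one by linarith
  have "norm (g \<theta> x) * norm (bv k x) = norm (\<Sum>l<m. C k l \<theta> * bv l x)"
    using assms k unfolding represents_def by (metis norm_mult)
  also have "\<dots> \<le> (\<Sum>l<m. norm (C k l \<theta>) * norm (bv k x))"
    by (rule order.trans[OF norm_sum]) (auto intro!: sum_mono mult_left_mono max simp: norm_mult)
  also have "\<dots> = (\<Sum>l<m. norm (C k l \<theta>)) * norm (bv k x)"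
    by (simp add: sum_distrib_right)
  finally have "norm (g \<theta> x) \<le> (\<Sum>l<m. norm (C k l \<theta>))" using pos by simp
  also have "\<dots> \<le> (\<Sum>k<m. \<Sum>l<m. norm (C k l \<theta>))"
    by (rule member_le_sum[of k "{..<m}" "\<lambda>k. \<Sum>l<m. norm (C k l \<theta>)"]) (auto intro: sum_nonneg k)
  finally show ?thesis .
qed

lemma interpolate:
  assumes "finite Y"
  obtains D g where "pdeg R X D (\<lambda>_. g)" "\<And>y. y \<in> Y \<Longrightarrow> g y = h y"
proof -
  let ?Q = "{g. \<exists>D. pdeg R X D (\<lambda>_. g)}"
  obtain g where "g \<in> ?Q" "\<And>y. y \<in> Y \<Longrightarrow> g y = h y"
  proof (rule finite_interpolation[of ?Q Y h])
    show "(\<lambda>_. a) \<in> ?Q" for a using pdeg_const by blast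
  next
    fix f g assume "f \<in> ?Q" "g \<in> ?Q"
    then obtain D E where "pdeg R X D (\<lambda>_. f)" "pdeg R X E (\<lambda>_. g)" by blast
    then have "pdeg R X (D + E) (\<lambda>_. f)" "pdeg R X (D + E) (\<lambda>_. g)"
      by (auto elim: pdeg_mono)
    from pdeg.add[OF this] show "(\<lambda>x. f x + g x) \<in> ?Q" by blast
  next
    fix f g assume "f \<in> ?Q" "g \<in> ?Q"
    then show "(\<lambda>x. f x * g x) \<in> ?Q" using pdeg.mult by blast
  next
    fix x y :: 'v assume "x \<noteq> y"
    then have "(\<lambda>c. X c x) \<noteq> (\<lambda>c. X c y)" using inj_X by (auto dest: injD)
    then obtain c where "X c x \<noteq> X c y" by auto
    moreover have "X c \<in> ?Q" using pdeg.coord[OF order.refl, of R X c] by blast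
    ultimately show "\<exists>g\<in>?Q. g x \<noteq> g y" by blast
  qed (use assms in auto)
  then show ?thesis using that by blast
qed

text \<open>A polynomial with distinct values at m + 1 zeros would give its m by m multiplication
  matrix m + 1 eigenvalues.\<close>

lemma zeros_finite_card: "finite (zeros \<theta>) \<and> card (zeros \<theta>) \<le> m"
proof (rule ccontr)
  assume "\<not> ?thesis"
  then have "\<exists>Y. Y \<subseteq> zeros \<theta> \<and> finite Y \<and> card Y = Suc m"
    by (metis infinite_arbitrarily_large not_less_eq_eq obtain_subset_with_card_n)
  then obtain Y where Y: "Y \<subseteq> zeros \<theta>" "finite Y" "card Y = Suc m" by blast
  obtain h :: "'v \<Rightarrow> nat" where h: "inj_on h Y" using Y(2) finite_imp_inj_to_nat_seg by blast
  obtain D g where g: "pdeg R X D (\<lambda>_. g)" "\<And>y. y \<in> Y \<Longrightarrow> g y = of_nat (h y)"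
    using interpolate[OF Y(2), where h = "\<lambda>y. of_nat (h y)"] by blast
  obtain C where C: "represents (\<lambda>_. g) C" by (rule represents_exists[OF g(1)])
  let ?p = "char_poly (matr C \<theta>)"
  have "g ` Y \<subseteq> {z. poly ?p z = 0}"
  proof clarify
    fix y assume "y \<in> Y"
    then have "eigenvector (matr C \<theta>) (bvec y) (g y)"
      using matr_eigenvector[OF C] Y(1) bvec_nonzero
      by (auto simp: eigenvector_def matr_def bvec_def)
    then show "poly ?p (g y) = 0"
      using eigenvalue_root_char_poly[OF matr_carrier] unfolding eigenvalue_def by blast
  qed
  moreover have deg: "degree ?p = m" "monic ?p"
    using degree_monic_char_poly[OF matr_carrier] by auto
  then have "?p \<noteq> 0" by auto
  ultimately have "card (g ` Y) \<le> m"
    using card_poly_roots_bound[of ?p] poly_roots_finite[of ?p] card_mono deg(1)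
    by (metis le_trans)
  moreover have "inj_on g Y"
    using h g(2) by (auto simp: inj_on_def)
  ultimately show False using Y(3) by (simp add: card_image)
qed

lemma zeros_enumeration:
  assumes "card (zeros \<theta>) = m"
  obtains y where "bij_betw y {0..<m} (zeros \<theta>)"
  using assms ex_bij_betw_nat_finite[of "zeros \<theta>"] zeros_finite_card[of \<theta>] by metis

text \<open>Indicator functions of fibre points are interpolated by polynomials, hence are
  combinations of the \<open>bv l\<close> on the fibre by row \<open>i0\<close>. So the m basis
  functions span all functions on m points, and a kernel vector must vanish.\<close>

lemma det_evaluation_nonzero:
  assumes "bij_betw y {0..<m} (zeros \<theta>)"
  shows "Determinant.det (Matrix.mat m m (\<lambda>(l, j). bv l (y j))) \<noteq> 0" (is "Determinant.det ?B \<noteq> 0")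
proof
  assume "Determinant.det ?B = 0"
  then obtain v where v: "v \<in> carrier_vec m" "v \<noteq> 0\<^sub>v m" "?B *\<^sub>v v = 0\<^sub>v m"
    using det_0_iff_vec_prod_zero[of ?B m] by auto
  have Bv: "(\<Sum>j<m. bv l (y j) * vec_index v j) = 0" if "l < m" for l
  proof -
    have "(\<Sum>j<m. bv l (y j) * vec_index v j) = vec_index (?B *\<^sub>v v) l"
      using v(1) that by (subst mat_mult_vec_eq) auto
    then show ?thesis using v(3) that by simp
  qed
  have "vec_index v j = 0" if j: "j < m" for j
  proof -
    obtain D g where g: "pdeg R X D (\<lambda>_. g)" "\<And>x. x \<in> zeros \<theta> \<Longrightarrow> g x = (if x = y j then 1 else 0)"
      using interpolate[of "zeros \<theta>" "\<lambda>x. if x = y j then 1 else 0"] zeros_finite_card by blast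
    obtain C where C: "represents (\<lambda>_. g) C" by (rule represents_exists[OF g(1)])
    have inj: "y i = y j \<longleftrightarrow> i = j" and z: "y i \<in> zeros \<theta>" if "i < m" for i
      using assms that j unfolding bij_betw_def inj_on_def by auto
    have "vec_index v j = (\<Sum>i<m. (if i = j then 1 else 0) * vec_index v i)"
      using j by (simp add: if_distrib[of "\<lambda>z. z * _"] cong: if_cong)
    also have "\<dots> = (\<Sum>i<m. g (y i) * bv i0 (y i) * vec_index v i)"
      by (intro sum.cong) (auto simp: g(2) z inj bv_i0)
    also have "\<dots> = (\<Sum>i<m. (\<Sum>l<m. C i0 l \<theta> * bv l (y i)) * vec_index v i)"
      using C z i0(1) unfolding represents_def by (intro sum.cong) auto
    also have "\<dots> = (\<Sum>l<m. C i0 l \<theta> * (\<Sum>i<m. bv l (y i) * vec_index v i))"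
      unfolding sum_distrib_left sum_distrib_right by (subst sum.swap) (simp add: mult.assoc)
    also have "\<dots> = 0" using Bv by simp
    finally show ?thesis .
  qed
  then have "v = 0\<^sub>v m" using v(1) by auto
  with v(2) show False by simp
qed

lemma bv_independent:
  assumes card: "card (zeros \<theta>) = m" and c: "\<And>x. x \<in> zeros \<theta> \<Longrightarrow> (\<Sum>l<m. c l * bv l x) = 0" and "l < m"
  shows "c l = 0"
proof -
  obtain y where y: "bij_betw y {0..<m} (zeros \<theta>)" by (rule zeros_enumeration[OF card])
  let ?B = "Matrix.mat m m (\<lambda>(l, j). bv l (y j))"
  let ?c = "Matrix.vec m c"
  have "transpose_mat ?B *\<^sub>v ?c = 0\<^sub>v m"
  proof (rule eq_vecI)
    fix j assume "j < dim_vec (0\<^sub>v m :: complex Matrix.vec)"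
    then have j: "j < m" by simp
    then have "vec_index (transpose_mat ?B *\<^sub>v ?c) j = (\<Sum>l<m. c l * bv l (y j))"
      by (subst mat_mult_vec_eq) (auto simp: mult.commute intro!: sum.cong)
    also have "\<dots> = 0" using y j by (intro c) (auto simp: bij_betw_def)
    finally show "vec_index (transpose_mat ?B *\<^sub>v ?c) j = vec_index (0\<^sub>v m) j" using j by simp
  qed simp
  moreover have "Determinant.det (transpose_mat ?B) \<noteq> 0"
    using det_evaluation_nonzero[OF y] by (subst Determinant.det_transpose) auto
  ultimately have "?c = 0\<^sub>v m"
    using det_0_iff_vec_prod_zero[of "transpose_mat ?B" m] vec_carrier[of m c]
      transpose_carrier_mat[of ?B m m] mat_carrier by blast
  then show ?thesis using \<open>l < m\<close> by (metis index_vec index_zero_vec(1))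
qed

text \<open>The evaluation matrix of a full fibre diagonalises multiplication by \<open>g\<close>,
  so the determinant is the norm of \<open>g\<close>.\<close>

theorem det_matr:
  assumes card: "card (zeros \<theta>) = m" and C: "represents g C"
  shows "Determinant.det (matr C \<theta>) = (\<Prod>x\<in>zeros \<theta>. g \<theta> x)"
proof -
  obtain y where y: "bij_betw y {0..<m} (zeros \<theta>)" by (rule zeros_enumeration[OF card])
  let ?B = "Matrix.mat m m (\<lambda>(l, j). bv l (y j))"
  let ?d = "mat_diag m (\<lambda>j. g \<theta> (y j))"
  have B: "?B \<in> carrier_mat m m" by simp
  have "matr C \<theta> * ?B = ?B * ?d"
  proof (rule eq_matI)
    fix k j assume "k < dim_row (?B * ?d)" "j < dim_col (?B * ?d)"
    then have kj: "k < m" "j < m" by (auto simp: mat_diag_def)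
    have "(matr C \<theta> * ?B) $$ (k, j) = (\<Sum>l<m. C k l \<theta> * bv l (y j))"
      using kj by (auto simp: matr_def scalar_prod_def atLeast0LessThan intro!: sum.cong)
    also have "\<dots> = bv k (y j) * g \<theta> (y j)"
      using C kj bij_betwE[OF y] unfolding represents_def by (auto simp: mult.commute[of "bv k (y j)"])
    also have "\<dots> = (?B * ?d) $$ (k, j)"
      using kj by (subst mat_diag_mult_right[OF B]) auto
    finally show "(matr C \<theta> * ?B) $$ (k, j) = (?B * ?d) $$ (k, j)" .
  qed (auto simp: matr_def mat_diag_def)
  then have "Determinant.det (matr C \<theta>) * Determinant.det ?B = Determinant.det ?B * Determinant.det ?d"
    using det_mult[OF matr_carrier B, of C \<theta>] det_mult[OF B mat_diag_dim[of m "\<lambda>j. g \<theta> (y j)"]]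
    by (simp only:)
  then have "Determinant.det (matr C \<theta>) = Determinant.det ?d"
    using det_evaluation_nonzero[OF y] by (metis mult.commute mult_left_cancel)
  also have "\<dots> = prod_list (diag_mat ?d)"
    by (rule det_upper_triangular[where n = m]) (auto simp: upper_triangular_def mat_diag_def)
  also have "\<dots> = (\<Prod>j = 0..<m. g \<theta> (y j))"
    by (simp add: prod_list_diag_prod mat_diag_def)
  also have "\<dots> = (\<Prod>x\<in>zeros \<theta>. g \<theta> x)"
    by (rule prod.reindex_bij_betw[OF y])
  finally show ?thesis .
qed

end

section \<open>One-parameter polynomial families\<close>

lemma coeff_ring_poly: "coeff_ring (range (poly :: complex poly \<Rightarrow> _))"
proof
  show "(\<lambda>_. a) \<in> range poly" for a :: complex
    by (rule image_eqI[of _ _ "[:a:]"]) auto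
qed (force simp flip: poly_add poly_mult simp: image_iff fun_eq_iff)+

lemma idom_hom_poly: "idom_hom (\<lambda>p :: complex poly. poly p s)" ..

lemma comm_ring_hom_poly: "comm_ring_hom (\<lambda>p :: complex poly. poly p s)" ..

lemma semiring_hom_poly: "semiring_hom (\<lambda>p :: complex poly. poly p s)" ..

lemmas det_eval = comm_ring_hom.hom_det[OF comm_ring_hom_poly]
lemmas mult_eval = semiring_hom.mat_hom_mult[OF semiring_hom_poly]
lemmas pow_eval = semiring_hom.mat_hom_pow[OF semiring_hom_poly]
lemmas char_poly_eval = comm_ring_hom.char_poly_hom[OF comm_ring_hom_poly]
lemmas pderiv_eval = idom_hom.map_poly_pderiv[OF idom_hom_poly]

locale polynomial_family = product_system "range poly" X d lam q
  for X :: "'c::finite \<Rightarrow> 'v \<Rightarrow> complex" and d :: "'i::finite \<Rightarrow> nat"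
    and lam :: "'i \<Rightarrow> nat \<Rightarrow> 'v \<Rightarrow> complex" and q :: "'i \<Rightarrow> complex \<Rightarrow> 'v \<Rightarrow> complex" +
  assumes card_0: "card (zeros 0) = m"
    and card_near_0: "infinite {s. card (zeros s) = m}"
begin

abbreviation ev :: "complex \<Rightarrow> complex poly mat \<Rightarrow> complex mat" where
  "ev s \<equiv> map_mat (\<lambda>p. poly p s)"

text \<open>The entries are formal polynomials in s, so determinants and characteristic polynomials
  are formed over the polynomial ring, and one nonzero value leaves only finitely many exceptional
  s.\<close>

definition prep :: "(complex \<Rightarrow> 'v \<Rightarrow> complex) \<Rightarrow> complex poly mat \<Rightarrow> bool" where
  "prep g C \<longleftrightarrow> C \<in> carrier_mat m m \<and>
     (\<forall>s. \<forall>x\<in>zeros s. \<forall>k<m. g s x * bv k x = (\<Sum>l<m. poly (C $$ (k, l)) s * bv l x))"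

lemma prep_carrier: "prep g C \<Longrightarrow> C \<in> carrier_mat m m"
  by (simp add: prep_def)

lemma prepD: "prep g C \<Longrightarrow> x \<in> zeros s \<Longrightarrow> k < m \<Longrightarrow> g s x * bv k x = (\<Sum>l<m. poly (C $$ (k, l)) s * bv l x)"
  by (simp add: prep_def)

lemma prep_represents: "prep g C \<Longrightarrow> represents g (\<lambda>k l. poly (C $$ (k, l)))"
  by (simp add: prep_def represents_def)

lemma prep_matr: "prep g C \<Longrightarrow> matr (\<lambda>k l. poly (C $$ (k, l))) s = ev s C"
  by (intro eq_matI) (auto simp: prep_def matr_def)

lemma prep_exists:
  assumes "pdeg (range poly) X D g"
  obtains C where "prep g C"
proof -
  obtain C where C: "represents g C" by (rule represents_exists[OF assms])
  then have "\<exists>p. \<forall>k<m. \<forall>l<m. C k l = poly (p k l)"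
    unfolding represents_def by (auto simp: image_iff) metis
  then obtain p where "\<forall>k<m. \<forall>l<m. C k l = poly (p k l)" by blast
  then have "prep g (Matrix.mat m m (\<lambda>(k, l). p k l))"
    using C unfolding prep_def represents_def by simp
  then show ?thesis by (rule that)
qed

text \<open>The difference of two entries vanishes at the infinitely many s with a full fibre, by
  independence there. Hence relations between functions on the zero sets pass to their matrices and
  then hold at every s, even where points collide.\<close>

lemma prep_unique:
  assumes "prep g C" "prep g C'"
  shows "C = C'"
proof (rule eq_matI)
  fix k l assume "k < dim_row C'" "l < dim_col C'"
  then have kl: "k < m" "l < m" using prep_carrier[OF assms(2)] by auto
  let ?p = "C $$ (k, l) - C' $$ (k, l)"
  have "poly ?p s = 0" if "card (zeros s) = m" for s
  proof (rule bv_independent[OF that _ kl(2), of "\<lambda>l. poly (C $$ (k, l) - C' $$ (k, l)) s"])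
    fix x assume x: "x \<in> zeros s"
    show "(\<Sum>l<m. poly (C $$ (k, l) - C' $$ (k, l)) s * bv l x) = 0"
      using prepD[OF assms(1) x kl(1)] prepD[OF assms(2) x kl(1)]
      by (simp add: left_diff_distrib sum_subtractf)
  qed
  then have "infinite {s. poly ?p s = 0}"
    using card_near_0 by (metis (mono_tags, lifting) Collect_mono infinite_super)
  then show "C $$ (k, l) = C' $$ (k, l)"
    using poly_roots_finite[of ?p] by auto
qed (use assms in \<open>auto dest!: prep_carrier\<close>)

lemma prep_add: "prep g C \<Longrightarrow> prep h D \<Longrightarrow> prep (\<lambda>s x. g s x + h s x) (C + D)"
  unfolding prep_def by (auto simp: ring_distribs sum.distrib)

lemma prep_mult:
  assumes "prep g C" "prep h D"
  shows "prep (\<lambda>s x. g s x * h s x) (C * D)"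
  unfolding prep_def
proof (intro conjI allI ballI impI)
  fix s x k assume x: "x \<in> zeros s" and k: "k < m"
  have "g s x * h s x * bv k x = (\<Sum>l<m. poly (C $$ (k, l)) s * (h s x * bv l x))"
    using prepD[OF assms(1) x k] by (simp add: mult.assoc mult.left_commute[of _ "h s x"] flip: sum_distrib_left)
  also have "\<dots> = (\<Sum>l<m. \<Sum>j<m. poly (C $$ (k, l)) s * poly (D $$ (l, j)) s * bv j x)"
    using prepD[OF assms(2) x] by (simp add: sum_distrib_left mult.assoc)
  also have "\<dots> = (\<Sum>j<m. \<Sum>l<m. poly (C $$ (k, l)) s * poly (D $$ (l, j)) s * bv j x)"
    by (rule sum.swap)
  also have "\<dots> = (\<Sum>j<m. poly ((C * D) $$ (k, j)) s * bv j x)"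
    using prep_carrier[OF assms(1)] prep_carrier[OF assms(2)] k
    by (intro sum.cong refl) (auto simp: scalar_prod_def poly_sum sum_distrib_right atLeast0LessThan)
  finally show "g s x * h s x * bv k x = (\<Sum>l<m. poly ((C * D) $$ (k, l)) s * bv l x)" .
qed (use assms in \<open>auto dest!: prep_carrier\<close>)

lemma prep_coeff: "prep (\<lambda>s x. poly p s) (p \<cdot>\<^sub>m 1\<^sub>m m)"
  unfolding prep_def
proof (intro conjI allI ballI impI)
  fix s x k assume "k < m"
  then have "(\<Sum>l<m. poly ((p \<cdot>\<^sub>m 1\<^sub>m m) $$ (k, l)) s * bv l x) = (\<Sum>l<m. if k = l then poly p s * bv k x else 0)"
    by (intro sum.cong) auto
  also have "\<dots> = poly p s * bv k x" using \<open>k < m\<close> by (simp add: sum.delta')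
  finally show "poly p s * bv k x = (\<Sum>l<m. poly ((p \<cdot>\<^sub>m 1\<^sub>m m) $$ (k, l)) s * bv l x)" ..
qed simp

lemma prep_power: "prep u C \<Longrightarrow> prep (\<lambda>s x. u s x ^ j) (C ^\<^sub>m j)"
proof (induction j)
  case 0
  have "1 \<cdot>\<^sub>m (1\<^sub>m m :: complex poly mat) = 1\<^sub>m m" by (intro eq_matI) auto
  then show ?case using prep_coeff[of 1] prep_carrier[OF 0] by auto
next
  case (Suc j)
  then show ?case using prep_mult[OF Suc.IH[OF Suc.prems] Suc.prems] by (simp add: mult.commute)
qed

lemma prep_commute:
  assumes "prep g C" "prep h D"
  shows "C * D = D * C"
proof (rule prep_unique)
  show "prep (\<lambda>s x. g s x * h s x) (C * D)" by (rule prep_mult[OF assms])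
  show "prep (\<lambda>s x. g s x * h s x) (D * C)"
    using prep_mult[OF assms(2,1)] by (simp add: mult.commute)
qed

lemma prep_det_zero_finite:
  assumes "prep g C" "\<And>x. x \<in> zeros 0 \<Longrightarrow> g 0 x \<noteq> 0"
  shows "finite {s. Determinant.det (ev s C) = 0}"
proof -
  have eq: "Determinant.det (ev s C) = poly (Determinant.det C) s" for s
    by (rule det_eval)
  have "Determinant.det (ev 0 C) = (\<Prod>x\<in>zeros 0. g 0 x)"
    using det_matr[OF card_0 prep_represents[OF assms(1)]] prep_matr[OF assms(1)] by simp
  then have "poly (Determinant.det C) 0 \<noteq> 0"
    using assms(2) zeros_finite_card[of 0] unfolding eq by simp
  then have "Determinant.det C \<noteq> 0" by auto
  then show ?thesis using poly_roots_finite unfolding eq by blast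
qed

text \<open>The determinant for \<open>g\<close> is a polynomial in s that is nonzero at 0, being
  there the norm of \<open>g\<close>. It serves to exclude the s at which a zero is degenerate or
  has \<mu> = 0.\<close>

theorem finite_vanishing:
  assumes "pdeg (range poly) X D g" "\<And>x. x \<in> zeros 0 \<Longrightarrow> g 0 x \<noteq> 0"
  shows "finite {s. \<exists>x\<in>zeros s. g s x = 0}"
proof -
  obtain C where C: "prep g C" by (rule prep_exists[OF assms(1)])
  have "{s. \<exists>x\<in>zeros s. g s x = 0} \<subseteq> {s. Determinant.det (ev s C) = 0}"
    using det_matr_zero[OF prep_represents[OF C]] prep_matr[OF C] by auto
  then show ?thesis using prep_det_zero_finite[OF C assms(2)] finite_subset by blast
qed

section \<open>From eigenvalues back to points of the fibre\<close>

text \<open>The row of the basis element \<open>1\<close> in the powers of a multiplication matrix.  Where its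
  determinant does not vanish, an eigenvector has nonzero entry at \<open>i0\<close>, so eigenspaces are lines
  and every eigenvector is common to all multiplication matrices.\<close>
definition krylov :: "complex poly mat \<Rightarrow> complex poly mat" where
  "krylov C = Matrix.mat m m (\<lambda>(j, l). (C ^\<^sub>m j) $$ (i0, l))"

text \<open>At s = 0, a linear dependence between the rows is a nonzero polynomial of degree below m
  that vanishes at the m distinct values of \<open>u\<close>.\<close>

lemma krylov_det_nonzero:
  assumes C: "prep (\<lambda>_. u) C" and u: "inj_on u (zeros 0)"
  shows "Determinant.det (krylov C) \<noteq> 0"
proof
  let ?U = "ev 0 (krylov C)"
  have U: "?U \<in> carrier_mat m m" by (simp add: krylov_def)
  assume "Determinant.det (krylov C) = 0"
  then have "Determinant.det ?U = 0" by (simp add: det_eval)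
  then have "Determinant.det (transpose_mat ?U) = 0" using Determinant.det_transpose[OF U] by simp
  then obtain c where c: "c \<in> carrier_vec m" "c \<noteq> 0\<^sub>v m" "transpose_mat ?U *\<^sub>v c = 0\<^sub>v m"
    using det_0_iff_vec_prod_zero[of "transpose_mat ?U" m] U by auto
  have row: "(\<Sum>j<m. poly ((C ^\<^sub>m j) $$ (i0, l)) 0 * vec_index c j) = 0" if l: "l < m" for l
  proof -
    have "vec_index (transpose_mat ?U *\<^sub>v c) l = (\<Sum>j<m. poly ((C ^\<^sub>m j) $$ (i0, l)) 0 * vec_index c j)"
      using U c(1) l by (subst mat_mult_vec_eq) (auto simp: krylov_def intro!: sum.cong)
    then show ?thesis using c(3) l by simp
  qed
  define p where "p = (\<Sum>j<m. Polynomial.monom (vec_index c j) j)"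
  have coeff_p: "poly.coeff p j = (if j < m then vec_index c j else 0)" for j
    by (simp add: p_def Polynomial.coeff_sum coeff_monom)
  have "p \<noteq> 0"
  proof
    assume "p = 0"
    then have "vec_index c j = 0" if "j < m" for j using coeff_p[of j] that by simp
    then show False using c(1,2) by auto
  qed
  have "degree p < m"
    using coeff_p i0(1) \<open>p \<noteq> 0\<close> by (metis leading_coeff_0_iff not_less)
  have "poly p (u y) = 0" if y: "y \<in> zeros 0" for y
  proof -
    have "u y ^ j = (\<Sum>l<m. poly ((C ^\<^sub>m j) $$ (i0, l)) 0 * bv l y)" for j
      using prepD[OF prep_power[OF C] y i0(1)] by (simp add: bv_i0)
    then have "poly p (u y) = (\<Sum>j<m. \<Sum>l<m. vec_index c j * (poly ((C ^\<^sub>m j) $$ (i0, l)) 0 * bv l y))"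
      by (simp add: p_def poly_sum poly_monom sum_distrib_left)
    also have "\<dots> = (\<Sum>l<m. (\<Sum>j<m. poly ((C ^\<^sub>m j) $$ (i0, l)) 0 * vec_index c j) * bv l y)"
      unfolding sum_distrib_right by (subst sum.swap) (simp add: mult.commute mult.left_commute)
    also have "\<dots> = 0" using row by simp
    finally show ?thesis .
  qed
  then have "card (u ` zeros 0) \<le> card {z. poly p z = 0}"
    using \<open>p \<noteq> 0\<close> by (intro card_mono poly_roots_finite) auto
  also have "\<dots> \<le> degree p" by (rule card_poly_roots_bound[OF \<open>p \<noteq> 0\<close>])
  finally show False
    using card_image[OF u] card_0 \<open>degree p < m\<close> by simp
qed

lemma krylov_eigenvector:
  assumes C: "C \<in> carrier_mat m m" and U: "Determinant.det (ev s (krylov C)) \<noteq> 0"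
    and v: "v \<in> carrier_vec m" "ev s C *\<^sub>v v = \<tau> \<cdot>\<^sub>v v" "vec_index v i0 = 0"
  shows "v = 0\<^sub>v m"
proof -
  have C': "ev s C \<in> carrier_mat m m" using C by simp
  have pow: "(ev s C ^\<^sub>m j) *\<^sub>v v = \<tau> ^ j \<cdot>\<^sub>v v" for j
  proof (induction j)
    case 0
    then show ?case using v(1) C by simp
  next
    case (Suc j)
    have "(ev s C ^\<^sub>m Suc j) *\<^sub>v v = (ev s C ^\<^sub>m j) *\<^sub>v (\<tau> \<cdot>\<^sub>v v)"
      using assoc_mult_mat_vec[OF pow_carrier_mat[OF C'] C' v(1)] v(2) by simp
    also have "\<dots> = \<tau> \<cdot>\<^sub>v ((ev s C ^\<^sub>m j) *\<^sub>v v)"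
      by (rule mult_mat_vec[OF pow_carrier_mat[OF C'] v(1)])
    finally show ?case by (simp add: Suc smult_smult_assoc)
  qed
  have "ev s (krylov C) *\<^sub>v v = 0\<^sub>v m"
  proof (rule eq_vecI)
    fix j assume "j < dim_vec (0\<^sub>v m :: complex Matrix.vec)"
    then have j: "j < m" by simp
    have "vec_index (ev s (krylov C) *\<^sub>v v) j = (\<Sum>l<m. poly ((C ^\<^sub>m j) $$ (i0, l)) s * vec_index v l)"
      using j v(1) by (subst mat_mult_vec_eq) (auto simp: krylov_def)
    also have "\<dots> = (\<Sum>l<m. ev s (C ^\<^sub>m j) $$ (i0, l) * vec_index v l)"
      using i0(1) C by (intro sum.cong) auto
    also have "\<dots> = vec_index ((ev s C ^\<^sub>m j) *\<^sub>v v) i0"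
      unfolding pow_eval[OF C] using pow_carrier_mat[OF C'] v(1) i0(1)
      by (subst mat_mult_vec_eq) auto
    also have "\<dots> = 0" using v(1,3) i0(1) unfolding pow by simp
    finally show "vec_index (ev s (krylov C) *\<^sub>v v) j = vec_index (0\<^sub>v m) j" using j by simp
  qed (simp add: krylov_def)
  moreover have "ev s (krylov C) \<in> carrier_mat m m" by (simp add: krylov_def)
  ultimately show ?thesis
    using det_0_iff_vec_prod_zero U v(1) by blast
qed

lemma pdeg_system: "\<exists>D. pdeg (range poly) X D (\<lambda>s x. (\<Prod>j<d i. lam i j x) + q i s x)"
proof -
  have 1: "pdeg (range poly) X (\<Sum>j<d i. 1) (\<lambda>s x. \<Prod>j<d i. lam i j x)"
    by (rule pdeg_prod[of _ "\<lambda>_. 1"]) (rule lam_linear)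
  have "pdeg (range poly) X (\<Sum>j<d i. 1) (q i)"
    by (rule pdeg_mono[OF lower]) simp
  from pdeg.add[OF 1 this] show ?thesis by blast
qed

text \<open>The converse of \<open>matr_eigenvector\<close>. The eigenvector is shared by all
  multiplication matrices, and its eigenvalues for the coordinates \<open>X c\<close> are the
  coordinates of a point z, which exists by \<open>surj_X\<close>; the eigenvalue of any polynomial
  is then its value at z.\<close>

lemma eigenvector_point:
  assumes u: "pdeg (range poly) X D (\<lambda>_. u)" and C: "prep (\<lambda>_. u) C"
    and U: "Determinant.det (ev s (krylov C)) \<noteq> 0" and v: "eigenvector (ev s C) v \<tau>"
  obtains z where "z \<in> zeros s" "u z = \<tau>"
proof -
  have Cm: "C \<in> carrier_mat m m" by (rule prep_carrier[OF C])
  have vm: "v \<in> carrier_vec m" "v \<noteq> 0\<^sub>v m" "ev s C *\<^sub>v v = \<tau> \<cdot>\<^sub>v v"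
    using v Cm unfolding eigenvector_def by auto
  have v0: "vec_index v i0 \<noteq> 0" using krylov_eigenvector[OF Cm U vm(1,3)] vm(2) by blast
  have common: "\<exists>\<gamma>. ev s A *\<^sub>v v = \<gamma> \<cdot>\<^sub>v v" if A: "prep g A" for g A
  proof -
    have Am: "ev s A \<in> carrier_mat m m" and Cs: "ev s C \<in> carrier_mat m m"
      using prep_carrier[OF A] Cm by auto
    have "ev s C * ev s A = ev s A * ev s C"
      using prep_commute[OF C A] mult_eval[OF Cm prep_carrier[OF A], of s]
        mult_eval[OF prep_carrier[OF A] Cm, of s] by simp
    define w where "w = ev s A *\<^sub>v v"
    have w: "w \<in> carrier_vec m" using Am vm(1) unfolding w_def by simp
    have "ev s C *\<^sub>v w = (ev s A * ev s C) *\<^sub>v v"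
      using assoc_mult_mat_vec[OF Cs Am vm(1)] \<open>ev s C * ev s A = ev s A * ev s C\<close> by (simp add: w_def)
    also have "\<dots> = ev s A *\<^sub>v (\<tau> \<cdot>\<^sub>v v)"
      using assoc_mult_mat_vec[OF Am Cs vm(1)] vm(3) by simp
    also have "\<dots> = \<tau> \<cdot>\<^sub>v w" using mult_mat_vec[OF Am vm(1)] by (simp add: w_def)
    finally have Cw: "ev s C *\<^sub>v w = \<tau> \<cdot>\<^sub>v w" .
    \<comment> \<open>This multiple cancels the entry at \<open>i0\<close>, so
      \<open>krylov_eigenvector\<close> forces \<open>w - \<gamma> \<cdot>\<^sub>v v\<close> to
      vanish.\<close>
    define \<gamma> where "\<gamma> = vec_index w i0 / vec_index v i0"
    have \<gamma>v: "\<gamma> \<cdot>\<^sub>v v \<in> carrier_vec m" using vm(1) by simp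
    have "ev s C *\<^sub>v (w - \<gamma> \<cdot>\<^sub>v v) = \<tau> \<cdot>\<^sub>v w - \<gamma> \<cdot>\<^sub>v (\<tau> \<cdot>\<^sub>v v)"
      using mult_minus_distrib_mat_vec[OF Cs w \<gamma>v] mult_mat_vec[OF Cs vm(1)] Cw vm(3) by simp
    also have "\<dots> = \<tau> \<cdot>\<^sub>v (w - \<gamma> \<cdot>\<^sub>v v)"
      using w vm(1) by (intro eq_vecI) (auto simp: algebra_simps)
    finally have "w - \<gamma> \<cdot>\<^sub>v v = 0\<^sub>v m"
      using v0 w vm(1) i0(1) by (intro krylov_eigenvector[OF Cm U]) (auto simp: \<gamma>_def)
    then have "vec_index w k = vec_index (\<gamma> \<cdot>\<^sub>v v) k" if "k < m" for k
    proof -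
      have "vec_index (w - \<gamma> \<cdot>\<^sub>v v) k = 0" using \<open>w - \<gamma> \<cdot>\<^sub>v v = 0\<^sub>v m\<close> that by simp
      then show ?thesis using that w vm(1) by simp
    qed
    then have "w = \<gamma> \<cdot>\<^sub>v v" using w vm(1) by (intro eq_vecI) auto
    then show ?thesis unfolding w_def by blast
  qed
  have "\<exists>\<gamma> A. prep (\<lambda>_. X c) A \<and> ev s A *\<^sub>v v = \<gamma> \<cdot>\<^sub>v v" for c
    using common prep_exists[OF pdeg.coord[OF order.refl, of "range poly" X c]] by metis
  then obtain \<zeta> where \<zeta>: "\<And>c. \<exists>A. prep (\<lambda>_. X c) A \<and> ev s A *\<^sub>v v = \<zeta> c \<cdot>\<^sub>v v" by metis
  obtain z where z: "(\<lambda>c. X c z) = \<zeta>" using surj_X by (metis surjD)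
  have eval: "\<exists>A. prep g A \<and> ev s A *\<^sub>v v = g s z \<cdot>\<^sub>v v" if "pdeg (range poly) X D g" for D g
    using that
  proof (induction rule: pdeg.induct)
    case (coeff c D)
    then obtain p where p: "c = poly p" by auto
    have "ev s (p \<cdot>\<^sub>m 1\<^sub>m m) *\<^sub>v v = poly p s \<cdot>\<^sub>v v"
    proof (rule eq_vecI)
      fix k assume "k < dim_vec (poly p s \<cdot>\<^sub>v v)"
      then have k: "k < m" using vm(1) by simp
      then have "vec_index (ev s (p \<cdot>\<^sub>m 1\<^sub>m m) *\<^sub>v v) k =
          (\<Sum>l<m. ev s (p \<cdot>\<^sub>m 1\<^sub>m m) $$ (k, l) * vec_index v l)"
        using vm(1) by (intro mat_mult_vec_eq) auto
      also have "\<dots> = (\<Sum>l<m. if k = l then poly p s * vec_index v k else 0)"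
        using k by (intro sum.cong) auto
      also have "\<dots> = vec_index (poly p s \<cdot>\<^sub>v v) k" using k vm(1) by simp
      finally show "vec_index (ev s (p \<cdot>\<^sub>m 1\<^sub>m m) *\<^sub>v v) k = vec_index (poly p s \<cdot>\<^sub>v v) k" .
    qed (use vm(1) in simp)
    then show ?case unfolding p using prep_coeff by blast
  next
    case (coord D c)
    then show ?case using \<zeta>[of c] z by auto
  next
    case (add D f g)
    then obtain A B where A: "prep f A" "ev s A *\<^sub>v v = f s z \<cdot>\<^sub>v v" and B: "prep g B" "ev s B *\<^sub>v v = g s z \<cdot>\<^sub>v v"
      by blast
    have AB: "ev s A \<in> carrier_mat m m" "ev s B \<in> carrier_mat m m"
      using prep_carrier[OF A(1)] prep_carrier[OF B(1)] by auto
    have "ev s (A + B) = ev s A + ev s B"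
      using prep_carrier[OF A(1)] prep_carrier[OF B(1)] by (intro eq_matI) auto
    then have "ev s (A + B) *\<^sub>v v = (f s z + g s z) \<cdot>\<^sub>v v"
      using add_mult_distrib_mat_vec[OF AB vm(1)] A(2) B(2) by (simp add: add_smult_distrib_vec)
    then show ?case using prep_add[OF A(1) B(1)] by blast
  next
    case (mult D f E g F)
    then obtain A B where A: "prep f A" "ev s A *\<^sub>v v = f s z \<cdot>\<^sub>v v" and B: "prep g B" "ev s B *\<^sub>v v = g s z \<cdot>\<^sub>v v"
      by blast
    have AB: "ev s A \<in> carrier_mat m m" "ev s B \<in> carrier_mat m m"
      using prep_carrier[OF A(1)] prep_carrier[OF B(1)] by auto
    have "ev s (A * B) *\<^sub>v v = ev s A *\<^sub>v (g s z \<cdot>\<^sub>v v)"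
      using mult_eval[OF prep_carrier[OF A(1)] prep_carrier[OF B(1)], of s]
        assoc_mult_mat_vec[OF AB vm(1)] B(2) by simp
    also have "\<dots> = (f s z * g s z) \<cdot>\<^sub>v v"
      using mult_mat_vec[OF AB(1) vm(1)] A(2) by (simp add: smult_smult_assoc mult.commute)
    finally show ?case using prep_mult[OF A(1) B(1)] by blast
  qed
  have smult_v: "a = b" if "a \<cdot>\<^sub>v v = b \<cdot>\<^sub>v v" for a b
  proof -
    have "vec_index (a \<cdot>\<^sub>v v) i0 = vec_index (b \<cdot>\<^sub>v v) i0" using that by simp
    then show ?thesis using v0 i0(1) vm(1) by simp
  qed
  have "z \<in> zeros s"
    unfolding zeros_def
  proof clarify
    fix i
    let ?f = "\<lambda>s x. (\<Prod>j<d i. lam i j x) + q i s x"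
    obtain D where "pdeg (range poly) X D ?f" using pdeg_system by blast
    from eval[OF this] obtain A where A: "prep ?f A" "ev s A *\<^sub>v v = ?f s z \<cdot>\<^sub>v v" by blast
    \<comment> \<open>The defining equation vanishes on all zero sets, so uniqueness makes its
      matrix 0 and hence its value at z is 0.\<close>
    have "prep ?f (0\<^sub>m m m)" unfolding prep_def zeros_def by auto
    then have "A = 0\<^sub>m m m" using prep_unique[OF A(1)] by blast
    then have "ev s A *\<^sub>v v = 0 \<cdot>\<^sub>v v"
      using vm(1) by (intro eq_vecI) (auto simp: scalar_prod_def)
    with A(2) show "?f s z = 0" using smult_v by metis
  qed
  moreover have "u z = \<tau>"
    using eval[OF u] prep_unique[OF C] vm(3) smult_v by metis
  ultimately show ?thesis by (rule that)
qed

lemma pdeg_poly: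
  assumes "pdeg (range poly) X D (\<lambda>_. u)"
  shows "\<exists>E. pdeg (range poly) X E (\<lambda>s x. poly (map_poly (\<lambda>c. poly c s) P) (u x))"
proof (induction P)
  case 0
  then show ?case using pdeg_const[of 0 0] by auto
next
  case (pCons a P)
  then obtain E where E: "pdeg (range poly) X E (\<lambda>s x. poly (map_poly (\<lambda>c. poly c s) P) (u x))" by blast
  have "pdeg (range poly) X (D + E) (\<lambda>s x. poly a s + u x * poly (map_poly (\<lambda>c. poly c s) P) (u x))"
    by (intro pdeg.add pdeg.coeff pdeg.mult[OF assms E]) auto
  moreover have "map_poly (\<lambda>c. poly c s) (pCons a P) = pCons (poly a s) (map_poly (\<lambda>c. poly c s) P)" for s
    by (rule poly_eqI) (simp add: coeff_map_poly coeff_pCons split: nat.split)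
  ultimately show ?case by auto
qed

text \<open>Outside a finite set of s, every root of the characteristic polynomial of a separating
  \<open>u\<close> comes from a point of the fibre and is simple, so there are \<open>m\<close>
  points. This carries the count from s near 0 to s near 1.\<close>

theorem generic_card:
  "finite {s. card (zeros s) \<noteq> m}"
proof -
  have fin0: "finite (zeros 0)" using zeros_finite_card by blast
  then obtain h :: "'v \<Rightarrow> nat" where h: "inj_on h (zeros 0)" using finite_imp_inj_to_nat_seg by blast
  obtain D u where u: "pdeg (range poly) X D (\<lambda>_. u)" "\<And>y. y \<in> zeros 0 \<Longrightarrow> u y = of_nat (h y)"
    using interpolate[OF fin0, where h = "\<lambda>y. of_nat (h y)"] by blast
  have inj_u: "inj_on u (zeros 0)" using h u(2) by (auto simp: inj_on_def)
  obtain C where C: "prep (\<lambda>_. u) C" by (rule prep_exists[OF u(1)])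
  define P where "P s = char_poly (ev s C)" for s
  have P: "P s = map_poly (\<lambda>c. poly c s) (char_poly C)" for s
    unfolding P_def by (rule char_poly_eval[OF prep_carrier[OF C]])
  have degP: "degree (P s) = m" "P s \<noteq> 0" for s
    using degree_monic_char_poly[of "ev s C" m] prep_carrier[OF C] unfolding P_def by auto
  have u_root: "poly (P s) (u y) = 0" if "y \<in> zeros s" for s y
  proof -
    have "eigenvector (ev s C) (bvec y) (u y)"
      using matr_eigenvector[OF prep_represents[OF C] that] bvec_nonzero prep_matr[OF C, of s] prep_carrier[OF C]
      by (auto simp: eigenvector_def)
    then show ?thesis
      using eigenvalue_root_char_poly[of "ev s C" m] prep_carrier[OF C] unfolding eigenvalue_def P_def by auto
  qed
  \<comment> \<open>A substitute for the discriminant: simplicity of the roots becomes nonvanishing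
    of a polynomial function on the zero set, to which \<open>finite_vanishing\<close>
    applies.\<close>
  define g where "g s x = poly (pderiv (P s)) (u x)" for s x
  have g_eq: "g s x = poly (map_poly (\<lambda>c. poly c s) (pderiv (char_poly C))) (u x)" for s x
    unfolding g_def P pderiv_eval ..
  obtain E where "pdeg (range poly) X E g"
    using pdeg_poly[OF u(1)] unfolding g_eq[abs_def] by blast
  moreover have "g 0 x \<noteq> 0" if "x \<in> zeros 0" for x
  proof -
    have "m = card (u ` zeros 0)" using card_image[OF inj_u] card_0 by simp
    also have "\<dots> \<le> card {z. poly (P 0) z = 0}"
      using degP(2) u_root by (intro card_mono poly_roots_finite) auto
    finally have "card {z. poly (P 0) z = 0} = degree (P 0)"
      using card_poly_roots_bound[OF degP(2), of 0] degP(1) by simp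
    then have "rsquarefree (P 0)" using rsquarefree_card_degree[OF degP(2)] by blast
    then show ?thesis using u_root[OF that] unfolding g_def by (auto simp: rsquarefree_roots)
  qed
  ultimately have fin1: "finite {s. \<exists>x\<in>zeros s. g s x = 0}" by (rule finite_vanishing)
  have "finite {s. poly (Determinant.det (krylov C)) s = 0}"
    by (rule poly_roots_finite[OF krylov_det_nonzero[OF C inj_u]])
  then have fin2: "finite {s. Determinant.det (ev s (krylov C)) = 0}" by (simp add: det_eval)
  have "card (zeros s) = m" if s: "\<forall>x\<in>zeros s. g s x \<noteq> 0" "Determinant.det (ev s (krylov C)) \<noteq> 0" for s
  proof -
    have root: "\<exists>z\<in>zeros s. u z = \<tau>" if "poly (P s) \<tau> = 0" for \<tau>
    proof -
      have "ev s C \<in> carrier_mat m m" using prep_carrier[OF C] by simp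
      from eigenvalue_root_char_poly[OF this, of \<tau>] that
      obtain v where "eigenvector (ev s C) v \<tau>"
        unfolding P_def eigenvalue_def by auto
      then show ?thesis using eigenvector_point[OF u(1) C s(2)] by blast
    qed
    have "rsquarefree (P s)"
      unfolding rsquarefree_roots using root s(1) unfolding g_def by blast
    then have "m = card {z. poly (P s) z = 0}" using rsquarefree_card_degree[OF degP(2)] degP(1) by simp
    also have "\<dots> \<le> card (u ` zeros s)"
      using root zeros_finite_card by (intro card_mono) auto
    also have "\<dots> \<le> card (zeros s)" using zeros_finite_card by (intro card_image_le) auto
    finally show ?thesis using zeros_finite_card by (simp add: le_antisym)
  qed
  then have "{s. card (zeros s) \<noteq> m} \<subseteq> {s. \<exists>x\<in>zeros s. g s x = 0} \<union> {s. Determinant.det (ev s (krylov C)) = 0}"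
    by blast
  then show ?thesis using fin1 fin2 finite_subset by blast
qed

end

section \<open>Persistence of simple zeros\<close>

lemma finite_separation:
  fixes S :: "'a::metric_space set"
  assumes "finite S"
  obtains r where "r > 0" "\<And>x y. x \<in> S \<Longrightarrow> y \<in> S \<Longrightarrow> x \<noteq> y \<Longrightarrow> 2 * r \<le> dist x y"
proof -
  define E where "E = insert 1 ((\<lambda>(x, y). dist x y / 2) ` {(x, y) \<in> S \<times> S. x \<noteq> y})"
  have "finite {(x, y) \<in> S \<times> S. x \<noteq> y}"
    using assms by (auto intro: finite_subset[of _ "S \<times> S"])
  then have fin: "finite E" by (simp add: E_def)
  have "Min E > 0" using fin by (subst Min_gr_iff) (auto simp: E_def)
  moreover have "2 * Min E \<le> dist x y" if "x \<in> S" "y \<in> S" "x \<noteq> y" for x y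
  proof -
    have "dist x y / 2 \<in> E" using that unfolding E_def by force
    then show ?thesis using Min_le[OF fin, of "dist x y / 2"] by simp
  qed
  ultimately show ?thesis by (rule that)
qed

lemma pdeg_continuous:
  fixes X :: "'c \<Rightarrow> 'v::topological_space \<Rightarrow> complex" and R :: "('p::topological_space \<Rightarrow> complex) set"
  assumes X: "\<And>c. continuous_on UNIV (X c)" and R: "\<And>c. c \<in> R \<Longrightarrow> continuous_on UNIV c"
  shows "pdeg R X D f \<Longrightarrow> continuous_on UNIV (\<lambda>t. f (fst t) (snd t))"
proof (induction rule: pdeg.induct)
  case (coeff c D)
  show ?case by (rule continuous_on_compose2[OF R[OF coeff]]) (auto intro: continuous_intros)
next
  case (coord D c)
  show ?case by (rule continuous_on_compose2[OF X]) (auto intro: continuous_intros)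
qed (auto intro: continuous_intros)

text \<open>At s = 0 the equations are pure products. \<open>solve\<close> inverts the chosen
  coordinates; its continuity is stated for families over pairs (s, x), the form needed for the
  fixed point map.\<close>

locale perturbed_products = product_system "range poly" X d lam q
  for X :: "'c::finite \<Rightarrow> 'v::euclidean_space \<Rightarrow> complex" and d :: "'i::finite \<Rightarrow> nat"
    and lam :: "'i \<Rightarrow> nat \<Rightarrow> 'v \<Rightarrow> complex" and q :: "'i \<Rightarrow> complex \<Rightarrow> 'v \<Rightarrow> complex" +
  assumes cont_X: "continuous_on UNIV (X c)"
    and q_0: "q i 0 x = 0"
    and solve: "(\<And>i. k i < d i) \<Longrightarrow> \<exists>\<Lambda>. (\<forall>y i. lam i (k i) (\<Lambda> y) = y i) \<and>
        (\<forall>x. \<Lambda> (\<lambda>i. lam i (k i) x) = x) \<and>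
        (\<forall>(S :: (complex \<times> 'v) set) f. (\<forall>i. continuous_on S (f i)) \<longrightarrow> continuous_on S (\<lambda>t. \<Lambda> (\<lambda>i. f i t)))"
    and simple: "(\<And>i. k i < d i) \<Longrightarrow> (\<And>i. lam i (k i) x = 0) \<Longrightarrow> j < d i \<Longrightarrow> j \<noteq> k i \<Longrightarrow> lam i j x \<noteq> 0"
begin

lemma continuous_pdeg:
  "pdeg (range poly) X D f \<Longrightarrow> continuous_on UNIV (\<lambda>t. f (fst t) (snd t))"
  by (rule pdeg_continuous[OF cont_X, of "range poly"]) (auto intro: continuous_intros)

text \<open>The zero persists by Brouwer's theorem: near a simple zero of the product the equation can be
  solved for the vanishing factor, which turns it into a fixed point problem.\<close>
lemma persistent_zero:
  assumes k: "\<And>i. k i < d i" and z: "\<And>i. lam i (k i) z = 0"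
  obtains r0 where "r0 > 0"
    "\<And>r. 0 < r \<Longrightarrow> r \<le> r0 \<Longrightarrow> \<exists>\<rho>>0. \<forall>s. norm s < \<rho> \<longrightarrow> (\<exists>x\<in>cball z r. x \<in> zeros s)"
proof -
  define P where "P i x = (\<Prod>j\<in>{..<d i} - {k i}. lam i j x)" for i x
  have lam_cont: "continuous_on UNIV (lam i j)" for i j
  proof -
    have "continuous_on UNIV (\<lambda>x. (0::complex, x))" by (intro continuous_intros)
    from continuous_on_compose2[OF continuous_pdeg[OF lam_linear] this] show ?thesis by simp
  qed
  have P_cont: "continuous_on UNIV (P i)" for i
    unfolding P_def by (intro continuous_intros lam_cont)
  have prod: "(\<Prod>j<d i. lam i j x) = lam i (k i) x * P i x" for i x
    unfolding P_def using k[of i] by (subst prod.remove[of _ "k i"]) auto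
  have "P i z \<noteq> 0" for i
    unfolding P_def using simple[OF k z] by auto
  then have "\<forall>\<^sub>F x in nhds z. P i x \<noteq> 0" for i
    using P_cont[of i] by (intro tendsto_imp_eventually_ne[of "P i" "P i z"])
      (simp_all add: continuous_on_def flip: tendsto_at_iff_tendsto_nhds)
  then have "\<forall>\<^sub>F x in nhds z. \<forall>i. P i x \<noteq> 0" by (intro eventually_all_finite)
  then obtain e where e: "e > 0" "\<And>x i. dist x z < e \<Longrightarrow> P i x \<noteq> 0"
    unfolding eventually_nhds_metric by blast
  show ?thesis
  proof (rule that[of "e / 2"])
    fix r :: real assume r: "0 < r" "r \<le> e / 2"
    have P0: "P i x \<noteq> 0" if "x \<in> cball z r" for i x
      using e(2)[of x i] r e(1) that by (auto simp: dist_commute)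
    obtain \<Lambda> where \<Lambda>: "\<And>y i. lam i (k i) (\<Lambda> y) = y i" "\<And>x. \<Lambda> (\<lambda>i. lam i (k i) x) = x"
      "\<And>(S :: (complex \<times> 'v) set) f. (\<And>i. continuous_on S (f i)) \<Longrightarrow> continuous_on S (\<lambda>t. \<Lambda> (\<lambda>i. f i t))"
      using solve[OF k] by blast
    \<comment> \<open>A fixed point x of \<open>T (s, _)\<close> satisfies
      \<open>lam i (k i) x * P i x = - q i s x\<close>, which are the equations at s.\<close>
    define T where "T t = \<Lambda> (\<lambda>i. - q i (fst t) (snd t) / P i (snd t))" for t
    let ?K = "cball (0::complex) 1 \<times> cball z r"
    have contT: "continuous_on ?K T"
      unfolding T_def
      by (intro \<Lambda>(3) continuous_intros continuous_on_subset[OF continuous_pdeg[OF lower]]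
            continuous_on_compose2[OF P_cont]) (auto simp: P0)
    have "compact ?K" by (intro compact_Times compact_cball)
    then have "uniformly_continuous_on ?K T"
      using contT compact_uniformly_continuous by blast
    then obtain \<delta> where \<delta>: "\<delta> > 0" "\<And>t t'. t \<in> ?K \<Longrightarrow> t' \<in> ?K \<Longrightarrow> dist t' t < \<delta> \<Longrightarrow> dist (T t') (T t) < r"
      unfolding uniformly_continuous_on_def using r(1) by metis
    \<comment> \<open>The map is constant at s = 0, so by uniform continuity it sends the ball into
      itself for small s.\<close>
    have T0: "T (0, x) = z" for x
      unfolding T_def using \<Lambda>(2)[of z] z by (simp add: q_0)
    have "\<exists>x\<in>cball z r. x \<in> zeros s" if s: "norm s < min 1 \<delta>" for s
    proof -
      have "continuous_on (cball z r) (\<lambda>x. T (s, x))"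
        by (rule continuous_on_compose2[OF contT]) (use s in \<open>auto intro!: continuous_intros\<close>)
      moreover have "(\<lambda>x. T (s, x)) \<in> cball z r \<rightarrow> cball z r"
      proof
        fix x assume x: "x \<in> cball z r"
        have "dist (T (s, x)) (T (0, x)) < r"
          using s x by (intro \<delta>(2)) (auto simp: dist_Pair_Pair)
        then show "T (s, x) \<in> cball z r" by (simp add: T0 dist_commute)
      qed
      ultimately obtain x where x: "x \<in> cball z r" "T (s, x) = x"
        using brouwer[of "cball z r" "\<lambda>x. T (s, x)"] r(1) by auto
      have "lam i (k i) x = - q i s x / P i x" for i
        using \<Lambda>(1)[of i "\<lambda>i. - q i s x / P i x"] x(2) by (simp add: T_def)
      then have "x \<in> zeros s"
        unfolding zeros_def prod using P0[OF x(1)] by simp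
      with x(1) show ?thesis by blast
    qed
    then show "\<exists>\<rho>>0. \<forall>s. norm s < \<rho> \<longrightarrow> (\<exists>x\<in>cball z r. x \<in> zeros s)"
      using \<delta>(1) by (intro exI[of _ "min 1 \<delta>"]) auto
  qed (use e(1) in simp)
qed

text \<open>By \<open>simple\<close>, different choices of factors have different zeros. These
  persist in disjoint balls, which gives at least \<open>m\<close> points; the matrices allow no
  more.\<close>

lemma card_zeros_near_0: "\<exists>\<rho>>0. \<forall>s. norm s < \<rho> \<longrightarrow> card (zeros s) = m"
proof -
  have "\<exists>x. \<forall>i. lam i (k i) x = 0" if "k \<in> idx" for k
  proof -
    have "\<And>i. k i < d i" using that by (simp add: idx_def)
    from solve[OF this] obtain \<Lambda> where "\<forall>y i. lam i (k i) (\<Lambda> y) = y i" by blast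
    then show ?thesis by (intro exI[of _ "\<Lambda> (\<lambda>_. 0)"]) simp
  qed
  then obtain z where z: "\<And>k i. k \<in> idx \<Longrightarrow> lam i (k i) (z k) = 0" by metis
  have inj: "k = k'" if "k \<in> idx" "k' \<in> idx" "z k = z k'" for k k'
  proof (rule ext, rule ccontr)
    fix i assume "k i \<noteq> k' i"
    then show False
      using simple[of k "z k" "k' i" i] z[OF that(1)] z[OF that(2), of i] that unfolding idx_def by simp
  qed
  have "\<forall>k\<in>idx. \<exists>r0>0. \<forall>r. 0 < r \<longrightarrow> r \<le> r0 \<longrightarrow> (\<exists>\<rho>>0. \<forall>s. norm s < \<rho> \<longrightarrow> (\<exists>x\<in>cball (z k) r. x \<in> zeros s))"
  proof
    fix k assume k: "k \<in> idx"
    then have "\<And>i. k i < d i" by (simp add: idx_def)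
    from persistent_zero[OF this z[OF k]] obtain r0 where "r0 > 0"
      "\<And>r. 0 < r \<Longrightarrow> r \<le> r0 \<Longrightarrow> \<exists>\<rho>>0. \<forall>s. norm s < \<rho> \<longrightarrow> (\<exists>x\<in>cball (z k) r. x \<in> zeros s)"
      by blast
    then show "\<exists>r0>0. \<forall>r. 0 < r \<longrightarrow> r \<le> r0 \<longrightarrow> (\<exists>\<rho>>0. \<forall>s. norm s < \<rho> \<longrightarrow> (\<exists>x\<in>cball (z k) r. x \<in> zeros s))"
      by metis
  qed
  from bchoice[OF this] obtain r0 where r0: "\<And>k. k \<in> idx \<Longrightarrow> r0 k > 0"
    "\<And>k r. k \<in> idx \<Longrightarrow> 0 < r \<Longrightarrow> r \<le> r0 k \<Longrightarrow> \<exists>\<rho>>0. \<forall>s. norm s < \<rho> \<longrightarrow> (\<exists>x\<in>cball (z k) r. x \<in> zeros s)"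
    by blast
  have "finite (z ` idx)" using finite_idx by simp
  then obtain r1 where r1: "r1 > 0" "\<And>x y. x \<in> z ` idx \<Longrightarrow> y \<in> z ` idx \<Longrightarrow> x \<noteq> y \<Longrightarrow> 2 * r1 \<le> dist x y"
    by (rule finite_separation) blast
  define r where "r = Min (insert (r1 / 2) (r0 ` idx))"
  have "r > 0" unfolding r_def using finite_idx r1(1) r0(1) by (subst Min_gr_iff) auto
  have "finite (insert (r1 / 2) (r0 ` idx))" using finite_idx by simp
  from Min_le[OF this] have r_le: "r \<le> r1 / 2" "\<And>k. k \<in> idx \<Longrightarrow> r \<le> r0 k"
    unfolding r_def by blast+
  have r_dist: "4 * r \<le> dist (z k) (z k')" if "k \<in> idx" "k' \<in> idx" "k \<noteq> k'" for k k'
    using r1(2)[of "z k" "z k'"] inj that r_le(1) by force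
  have "\<forall>k\<in>idx. \<exists>\<rho>>0. \<forall>s. norm s < \<rho> \<longrightarrow> (\<exists>x\<in>cball (z k) r. x \<in> zeros s)"
    using r0(2) r_le(2) \<open>r > 0\<close> by blast
  from bchoice[OF this] obtain \<rho>0 where \<rho>0: "\<And>k. k \<in> idx \<Longrightarrow> \<rho>0 k > 0"
    "\<And>k s. k \<in> idx \<Longrightarrow> norm s < \<rho>0 k \<Longrightarrow> \<exists>x\<in>cball (z k) r. x \<in> zeros s"
    by blast
  define \<rho> where "\<rho> = Min (\<rho>0 ` idx)"
  have "\<rho> > 0" unfolding \<rho>_def using finite_idx zero_idx \<rho>0(1) by (subst Min_gr_iff) auto
  moreover have "card (zeros s) = m" if s: "norm s < \<rho>" for s
  proof -
    have "norm s < \<rho>0 k" if "k \<in> idx" for k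
      using s that finite_idx unfolding \<rho>_def by (metis Min_le finite_imageI image_eqI order.strict_trans2)
    then have "\<forall>k\<in>idx. \<exists>x. x \<in> cball (z k) r \<and> x \<in> zeros s" using \<rho>0(2) by blast
    from bchoice[OF this]
    obtain y where y: "\<And>k. k \<in> idx \<Longrightarrow> y k \<in> cball (z k) r" "\<And>k. k \<in> idx \<Longrightarrow> y k \<in> zeros s"
      by blast
    have "inj_on y idx"
    proof (rule inj_onI, rule ccontr)
      fix k k' assume k: "k \<in> idx" "k' \<in> idx" "y k = y k'" "k \<noteq> k'"
      have "dist (z k) (z k') \<le> dist (z k) (y k) + dist (z k') (y k)"
        by (metis dist_triangle2)
      also have "\<dots> \<le> r + r" using y(1)[OF k(1)] y(1)[OF k(2)] k(3) by auto
      finally show False using r_dist[OF k(1,2,4)] \<open>r > 0\<close> by simp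
    qed
    then have "m \<le> card (zeros s)"
      unfolding m_def using y(2) zeros_finite_card[of s] by (intro card_inj_on_le[of y]) auto
    then show ?thesis using zeros_finite_card[of s] by simp
  qed
  ultimately show ?thesis by blast
qed

sublocale polynomial_family X d lam q
proof
  obtain \<rho> where \<rho>: "\<rho> > 0" "\<And>s. norm s < \<rho> \<Longrightarrow> card (zeros s) = m"
    using card_zeros_near_0 by blast
  show "card (zeros 0) = m" using \<rho> by simp
  have "infinite (ball (0::complex) \<rho>)" using \<rho>(1) uncountable_ball countable_finite by blast
  moreover have "ball 0 \<rho> \<subseteq> {s. card (zeros s) = m}" using \<rho>(2) by auto
  ultimately show "infinite {s. card (zeros s) = m}" using infinite_super by blast
qed

end

section \<open>Multiplicities of finite proper maps\<close>

lemma zeros_near_isolated_zero: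
  fixes f :: "'a::euclidean_space \<Rightarrow> 'b::real_normed_vector"
  assumes cont: "continuous_on UNIV f" and iso: "{z \<in> cball x r. f z = 0} = {x}" and "\<rho> > 0"
  obtains \<delta> where "\<delta> > 0" "\<And>w. w \<in> ball 0 \<delta> \<Longrightarrow> {z \<in> cball x r. f z = w} \<subseteq> ball x \<rho>"
proof -
  let ?K = "cball x r - ball x \<rho>"
  have "compact ?K" by (intro compact_diff compact_cball open_ball)
  moreover have cont': "continuous_on ?K (\<lambda>z. norm (f z))"
    by (intro continuous_intros continuous_on_subset[OF cont]) auto
  ultimately have "\<exists>\<delta>>0. \<forall>z\<in>?K. \<delta> \<le> norm (f z)"
  proof (cases "?K = {}")
    case False
    then obtain z where z: "z \<in> ?K" "\<And>y. y \<in> ?K \<Longrightarrow> norm (f z) \<le> norm (f y)"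
      using continuous_attains_inf[OF \<open>compact ?K\<close> False cont'] by blast
    have "f z \<noteq> 0"
    proof
      assume "f z = 0"
      then have "z = x" using z(1) iso by blast
      then show False using z(1) \<open>\<rho> > 0\<close> by simp
    qed
    then show ?thesis using z(2) by (intro exI[of _ "norm (f z)"]) simp
  qed (auto intro: exI[of _ 1])
  then obtain \<delta> where \<delta>: "\<delta> > 0" "\<And>z. z \<in> ?K \<Longrightarrow> \<delta> \<le> norm (f z)" by blast
  show ?thesis
  proof (rule that[OF \<delta>(1)], rule subsetI, rule ccontr)
    fix w z assume "w \<in> ball 0 \<delta>" "z \<in> {z \<in> cball x r. f z = w}" "z \<notin> ball x \<rho>"
    then show False using \<delta>(2)[of z] by auto
  qed
qed

text \<open>The count is independent of the radii: for small w the fibre points in either ball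
  already lie in the smaller one. By density some w near 0 attains one count, which the bound for
  the other then dominates, and vice versa.\<close>

lemma zero_mult_eqI:
  fixes f :: "'a::euclidean_space \<Rightarrow> 'b::real_normed_vector"
  assumes cont: "continuous_on UNIV f" and r: "r > 0" and \<delta>: "\<delta> > 0"
    and iso: "{z \<in> cball x r. f z = 0} = {x}"
    and le: "\<forall>w\<in>ball 0 \<delta>. finite {z \<in> ball x r. f z = w} \<and> card {z \<in> ball x r. f z = w} \<le> n"
    and dense: "ball 0 \<delta> \<subseteq> closure {w \<in> ball 0 \<delta>. card {z \<in> ball x r. f z = w} = n}"
  shows "zero_mult f x = n"
  unfolding zero_mult_def
proof (rule the_equality)
  show "\<exists>r>0. \<exists>\<delta>>0. {z \<in> cball x r. f z = 0} = {x} \<and>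
       (\<forall>w\<in>ball 0 \<delta>. finite {z \<in> ball x r. f z = w} \<and> card {z \<in> ball x r. f z = w} \<le> n) \<and>
       ball 0 \<delta> \<subseteq> closure {w \<in> ball 0 \<delta>. card {z \<in> ball x r. f z = w} = n}"
    using assms by blast
next
  fix n'
  assume "\<exists>r>0. \<exists>\<delta>>0. {z \<in> cball x r. f z = 0} = {x} \<and>
       (\<forall>w\<in>ball 0 \<delta>. finite {z \<in> ball x r. f z = w} \<and> card {z \<in> ball x r. f z = w} \<le> n') \<and>
       ball 0 \<delta> \<subseteq> closure {w \<in> ball 0 \<delta>. card {z \<in> ball x r. f z = w} = n'}"
  then obtain r' \<delta>' where r': "r' > 0" and \<delta>': "\<delta>' > 0" and iso': "{z \<in> cball x r'. f z = 0} = {x}"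
    and le': "\<forall>w\<in>ball 0 \<delta>'. finite {z \<in> ball x r'. f z = w} \<and> card {z \<in> ball x r'. f z = w} \<le> n'"
    and dense': "ball 0 \<delta>' \<subseteq> closure {w \<in> ball 0 \<delta>'. card {z \<in> ball x r'. f z = w} = n'}"
    by blast
  let ?\<rho> = "min r r'"
  have "?\<rho> > 0" using r r' by simp
  from zeros_near_isolated_zero[OF cont iso \<open>?\<rho> > 0\<close>] obtain a where a: "a > 0"
    "\<And>w. w \<in> ball 0 a \<Longrightarrow> {z \<in> cball x r. f z = w} \<subseteq> ball x ?\<rho>" by blast
  from zeros_near_isolated_zero[OF cont iso' \<open>?\<rho> > 0\<close>] obtain a' where a': "a' > 0"
    "\<And>w. w \<in> ball 0 a' \<Longrightarrow> {z \<in> cball x r'. f z = w} \<subseteq> ball x ?\<rho>" by blast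
  have same: "{z \<in> ball x r. f z = w} = {z \<in> ball x r'. f z = w}" if "w \<in> ball 0 (min a a')" for w
  proof -
    have "z \<in> ball x ?\<rho>" if "f z = w" "z \<in> ball x r \<or> z \<in> ball x r'" for z
      using a(2)[of w] a'(2)[of w] \<open>w \<in> ball 0 (min a a')\<close> that by (elim disjE) (auto simp: subset_iff)
    then show ?thesis by (intro Collect_cong) (metis mem_ball min_less_iff_conj)
  qed
  define e where "e = min (min a a') (min \<delta> \<delta>')"
  have e: "e > 0" using a(1) a'(1) \<delta> \<delta>' by (simp add: e_def)
  have "0 \<in> closure {w \<in> ball 0 \<delta>. card {z \<in> ball x r. f z = w} = n}" using dense \<delta> by auto
  then obtain w where w: "card {z \<in> ball x r. f z = w} = n" "dist w 0 < e"
    using e unfolding closure_approachable by blast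
  have "0 \<in> closure {w \<in> ball 0 \<delta>'. card {z \<in> ball x r'. f z = w} = n'}" using dense' \<delta>' by auto
  then obtain w' where w': "card {z \<in> ball x r'. f z = w'} = n'" "dist w' 0 < e"
    using e unfolding closure_approachable by blast
  have near: "w \<in> ball 0 (min a a')" "w \<in> ball 0 \<delta>'" "w' \<in> ball 0 (min a a')" "w' \<in> ball 0 \<delta>"
    using w(2) w'(2) by (auto simp: e_def)
  have "card {z \<in> ball x r'. f z = w} \<le> n'" using bspec[OF le' near(2)] by (rule conjunct2)
  then have "n \<le> n'" unfolding same[OF near(1), symmetric] w(1) .
  moreover have "card {z \<in> ball x r. f z = w'} \<le> n" using bspec[OF le near(4)] by (rule conjunct2)
  then have "n' \<le> n" unfolding same[OF near(3)] w'(1) .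
  ultimately show "n' = n" by simp
qed

text \<open>\<open>G\<close> is the set of generic values. The function \<nu> in
  \<open>norm_fun\<close> is the continuous extension of the norm of \<open>g\<close>; away from
  \<open>G\<close> only its vanishing is recorded.\<close>

locale finite_proper_map =
  fixes f :: "'a::euclidean_space \<Rightarrow> 'b::real_normed_vector" and G :: "'b set" and M :: nat
    and Q :: "('a \<Rightarrow> complex) set"
  assumes cont: "continuous_on UNIV f"
    and proper: "bounded {x. norm (f x) \<le> B}"
    and fin: "finite {x. f x = w}"
    and dense: "closure G = UNIV"
    and card_G: "w \<in> G \<Longrightarrow> card {x. f x = w} = M"
    and interp: "finite Y \<Longrightarrow> \<exists>g\<in>Q. \<forall>y\<in>Y. g y = h y"
    and cont_Q: "g \<in> Q \<Longrightarrow> continuous_on UNIV g"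
    and norm_fun: "g \<in> Q \<Longrightarrow> \<exists>\<nu>. continuous_on UNIV \<nu> \<and> (\<forall>w\<in>G. \<nu> w = (\<Prod>x\<in>{x. f x = w}. g x)) \<and>
          (\<forall>x. g x = 0 \<longrightarrow> \<nu> (f x) = (0::complex))"
begin

text \<open>By properness the candidates outside the balls form a compact set, on which f stays away
  from w0.\<close>

lemma fibres_near:
  assumes "\<rho> > 0"
  obtains \<delta> where "\<delta> > 0" "\<And>w. w \<in> ball w0 \<delta> \<Longrightarrow> {x. f x = w} \<subseteq> (\<Union>x\<in>{x. f x = w0}. ball x \<rho>)"
proof -
  let ?U = "\<Union>x\<in>{x. f x = w0}. ball x \<rho>"
  let ?K = "{x. norm (f x) \<le> norm w0 + 1} - ?U"
  have "closed {x. norm (f x) \<le> norm w0 + 1}"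
    by (intro closed_Collect_le continuous_intros cont)
  then have "compact {x. norm (f x) \<le> norm w0 + 1}"
    using proper compact_eq_bounded_closed by blast
  then have "compact ?K" by (rule compact_diff) auto
  have cont': "continuous_on ?K (\<lambda>z. dist (f z) w0)"
    by (intro continuous_intros continuous_on_subset[OF cont]) auto
  have "\<exists>\<delta>>0. \<forall>z\<in>?K. \<delta> \<le> dist (f z) w0"
  proof (cases "?K = {}")
    case False
    then obtain z where z: "z \<in> ?K" "\<And>y. y \<in> ?K \<Longrightarrow> dist (f z) w0 \<le> dist (f y) w0"
      using continuous_attains_inf[OF \<open>compact ?K\<close> False cont'] by blast
    have "f z \<noteq> w0" using z(1) assms by auto
    then show ?thesis using z(2) by (intro exI[of _ "dist (f z) w0"]) simp
  qed (auto intro: exI[of _ 1])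
  then obtain \<delta> where \<delta>: "\<delta> > 0" "\<And>z. z \<in> ?K \<Longrightarrow> \<delta> \<le> dist (f z) w0" by blast
  show ?thesis
  proof (rule that[of "min 1 \<delta>"])
    fix w assume w: "w \<in> ball w0 (min 1 \<delta>)"
    have "norm w \<le> norm w0 + 1"
      using w norm_triangle_ineq2[of w w0] by (auto simp: dist_norm norm_minus_commute)
    then show "{x. f x = w} \<subseteq> ?U"
      using \<delta>(2) w by (force simp: dist_commute)
  qed (use \<delta>(1) in simp)
qed

lemma G_near: "e > 0 \<Longrightarrow> \<exists>w\<in>G. dist w w0 < e"
  using dense closure_approachable[of w0 G] by auto

lemma Q_near:
  assumes "g \<in> Q" "finite Y" "e > 0"
  obtains \<rho> where "\<rho> > 0" "\<And>x y. y \<in> Y \<Longrightarrow> x \<in> ball y \<rho> \<Longrightarrow> norm (g x - g y) < e"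
proof -
  have "\<forall>y\<in>Y. \<exists>\<rho>>0. \<forall>x. dist x y < \<rho> \<longrightarrow> dist (g x) (g y) < e"
    using cont_Q[OF assms(1)] assms(3) unfolding continuous_on_iff by blast
  from bchoice[OF this] obtain \<rho> where \<rho>: "\<And>y. y \<in> Y \<Longrightarrow> \<rho> y > 0"
    "\<And>x y. y \<in> Y \<Longrightarrow> dist x y < \<rho> y \<Longrightarrow> dist (g x) (g y) < e" by blast
  define \<rho>0 where "\<rho>0 = Min (insert 1 (\<rho> ` Y))"
  have "\<rho>0 > 0" unfolding \<rho>0_def using assms(2) \<rho>(1) by (subst Min_gr_iff) auto
  moreover have "\<rho>0 \<le> \<rho> y" if "y \<in> Y" for y
    unfolding \<rho>0_def using assms(2) that by (intro Min_le) auto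
  ultimately show ?thesis
    using \<rho>(2) by (intro that[of \<rho>0]) (force simp: dist_norm norm_minus_commute)+
qed

text \<open>For \<open>g\<close> vanishing at \<open>y\<close> only, the norm function of \<open>g\<close> vanishes at \<open>w\<close>; without points of the fibre
  near \<open>y\<close> it would be bounded away from \<open>0\<close> near \<open>w\<close>.\<close>
lemma fibre_lower_semicontinuous:
  assumes Y: "Y \<subseteq> {x. f x = w} \<inter> U" and U: "open U" and e: "e > 0"
  shows "\<exists>w'\<in>G. dist w' w < e \<and> card Y \<le> card ({x. f x = w'} \<inter> U)"
proof -
  let ?S = "{x. f x = w}"
  have finY: "finite Y" using fin[of w] Y finite_subset by blast
  obtain r where r: "r > 0" "\<And>x y. x \<in> ?S \<Longrightarrow> y \<in> ?S \<Longrightarrow> x \<noteq> y \<Longrightarrow> 2 * r \<le> dist x y"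
    by (rule finite_separation[OF fin[of w]]) blast
  have "\<exists>\<delta>>0. \<forall>w'\<in>G. dist w' w < \<delta> \<longrightarrow> (\<exists>x. f x = w' \<and> dist x y < r \<and> x \<in> U)" if y: "y \<in> Y" for y
  proof -
    obtain g where g: "g \<in> Q" "\<forall>x\<in>?S. g x = (if x = y then 0 else 1)"
      using interp[OF fin[of w], of "\<lambda>x. if x = y then 0 else 1"] by blast
    obtain \<rho> where \<rho>: "\<rho> > 0" "\<And>x z. z \<in> ?S \<Longrightarrow> x \<in> ball z \<rho> \<Longrightarrow> norm (g x - g z) < 1 / 2"
      using Q_near[OF g(1) fin[of w], of "1 / 2"] by auto
    obtain \<rho>' where \<rho>': "\<rho>' > 0" "ball y \<rho>' \<subseteq> U"
      using U Y y open_contains_ball by blast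
    let ?\<rho> = "min r (min \<rho> \<rho>')"
    have "?\<rho> > 0" using r(1) \<rho>(1) \<rho>'(1) by simp
    from fibres_near[OF this, of w] obtain \<delta> where \<delta>: "\<delta> > 0"
      "\<And>w'. w' \<in> ball w \<delta> \<Longrightarrow> {x. f x = w'} \<subseteq> (\<Union>x\<in>?S. ball x ?\<rho>)" by blast
    obtain \<nu> where \<nu>: "continuous_on UNIV \<nu>" "\<And>w. w \<in> G \<Longrightarrow> \<nu> w = (\<Prod>x\<in>{x. f x = w}. g x)"
      "\<And>x. g x = 0 \<Longrightarrow> \<nu> (f x) = 0"
      using norm_fun[OF g(1)] by blast
    have "\<nu> w = 0" using \<nu>(3)[of y] g(2) y Y by auto
    \<comment> \<open>If all M points of a generic fibre had |g| at least 1/2, the norm of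
      \<open>g\<close> would be at least this number.\<close>
    moreover have "(1 / 2 :: real) ^ M > 0" by simp
    ultimately obtain \<delta>' where \<delta>': "\<delta>' > 0" "\<And>w'. dist w' w < \<delta>' \<Longrightarrow> norm (\<nu> w') < (1 / 2) ^ M"
      using \<nu>(1) unfolding continuous_on_iff dist_norm[where 'a=complex] by (metis UNIV_I diff_zero)
    have "\<exists>x. f x = w' \<and> dist x y < r \<and> x \<in> U" if w': "w' \<in> G" "dist w' w < min \<delta> \<delta>'" for w'
    proof (rule ccontr)
      assume not: "\<not> ?thesis"
      have "norm (g x) \<ge> 1 / 2" if x: "f x = w'" for x
      proof -
        obtain z where z: "z \<in> ?S" "x \<in> ball z ?\<rho>"
          using \<delta>(2)[of w'] w'(2) x by (auto simp: dist_commute)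
        have "z \<noteq> y"
        proof
          assume "z = y"
          then have "dist x y < r" "x \<in> U" using z(2) \<rho>'(2) by (auto simp: dist_commute)
          with not x show False by blast
        qed
        then have "norm (g x - 1) < 1 / 2" using \<rho>(2)[OF z(1), of x] z g(2) by auto
        then show ?thesis using norm_triangle_ineq2[of 1 "1 - g x"] by (simp add: norm_minus_commute)
      qed
      then have "(\<Prod>x\<in>{x. f x = w'}. 1 / 2) \<le> (\<Prod>x\<in>{x. f x = w'}. norm (g x))"
        by (intro prod_mono) auto
      then have "(1 / 2) ^ M \<le> norm (\<nu> w')"
        by (simp add: \<nu>(2)[OF w'(1)] prod_norm card_G[OF w'(1)])
      then show False using \<delta>'(2)[of w'] w'(2) by simp
    qed
    then show ?thesis using \<delta>(1) \<delta>'(1) by (intro exI[of _ "min \<delta> \<delta>'"]) simp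
  qed
  then have "\<forall>y\<in>Y. \<exists>\<delta>>0. \<forall>w'\<in>G. dist w' w < \<delta> \<longrightarrow> (\<exists>x. f x = w' \<and> dist x y < r \<and> x \<in> U)" by blast
  from bchoice[OF this] obtain \<delta> where \<delta>: "\<And>y. y \<in> Y \<Longrightarrow> \<delta> y > 0"
    "\<And>y w'. y \<in> Y \<Longrightarrow> w' \<in> G \<Longrightarrow> dist w' w < \<delta> y \<Longrightarrow> \<exists>x. f x = w' \<and> dist x y < r \<and> x \<in> U" by blast
  define \<delta>0 where "\<delta>0 = Min (insert e (\<delta> ` Y))"
  have "\<delta>0 > 0" unfolding \<delta>0_def using finY e \<delta>(1) by (subst Min_gr_iff) auto
  then obtain w' where w': "w' \<in> G" "dist w' w < \<delta>0" using G_near by blast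
  have "\<delta>0 \<le> e" "\<And>y. y \<in> Y \<Longrightarrow> \<delta>0 \<le> \<delta> y" unfolding \<delta>0_def using finY by (auto intro: Min_le)
  then have "dist w' w < e" "\<And>y. y \<in> Y \<Longrightarrow> dist w' w < \<delta> y" using w'(2) by force+
  then have "\<forall>y\<in>Y. \<exists>x. f x = w' \<and> dist x y < r \<and> x \<in> U" using \<delta>(2) w'(1) by blast
  from bchoice[OF this] obtain x where x: "\<And>y. y \<in> Y \<Longrightarrow> f (x y) = w' \<and> dist (x y) y < r \<and> x y \<in> U" by blast
  have "inj_on x Y"
  proof (rule inj_onI, rule ccontr)
    fix y z assume yz: "y \<in> Y" "z \<in> Y" "x y = x z" "y \<noteq> z"
    have "dist y z \<le> dist (x y) y + dist (x y) z" by (rule dist_triangle3)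
    also have "\<dots> < r + r" using x[OF yz(1)] x[OF yz(2)] yz(3) by simp
    finally show False using r(2)[of y z] yz Y by auto
  qed
  then have "card Y \<le> card ({x. f x = w'} \<inter> U)"
    using x fin by (intro card_inj_on_le[of x]) auto
  with w'(1) \<open>dist w' w < e\<close> show ?thesis by blast
qed

text \<open>If \<open>g\<close> is \<open>2\<close> at \<open>x\<close> and \<open>1\<close> at the other zeros, its norm function is close to \<open>2 ^ n\<close> when \<open>n\<close> fibre points
  are near \<open>x\<close>, so by continuity \<open>n\<close> cannot jump.\<close>
lemma local_count:
  assumes x: "f x = 0" and r: "r > 0" "\<And>z. f z = 0 \<Longrightarrow> z \<noteq> x \<Longrightarrow> 2 * r \<le> dist x z"
  obtains \<delta> n where "\<delta> > 0" "\<And>w. w \<in> G \<Longrightarrow> w \<in> ball 0 \<delta> \<Longrightarrow> card {z \<in> ball x r. f z = w} = n"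
proof -
  let ?S = "{x. f x = 0}"
  obtain g where g: "g \<in> Q" "\<forall>z\<in>?S. g z = (if z = x then 2 else 1)"
    using interp[OF fin[of 0], of "\<lambda>z. if z = x then 2 else 1"] by blast
  \<comment> \<open>Changing each of M factors by a ratio of at most c changes the product by at
    most 6/5. The exponent \<open>Suc M\<close> keeps the root meaningful for M = 0. The bound e
    below keeps |g| within ratio c of its values 1 and 2.\<close>
  define c where "c = root (Suc M) (6 / 5)"
  have c: "c > 1" "c ^ Suc M = 6 / 5"
    unfolding c_def by (simp_all add: real_root_pow_pos2 del: power_Suc)
  have c_le: "c ^ M \<le> 6 / 5" using power_increasing[of M "Suc M" c] c(1) unfolding c(2) by simp
  define e where "e = min (c - 1) (1 - 1 / c)"
  have e: "e > 0" "e \<le> c - 1" "e \<le> 1 - 1 / c" using c(1) by (auto simp: e_def)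
  obtain \<rho> where \<rho>: "\<rho> > 0" "\<And>y z. z \<in> ?S \<Longrightarrow> y \<in> ball z \<rho> \<Longrightarrow> norm (g y - g z) < e"
    using Q_near[OF g(1) fin[of 0] e(1)] by auto
  have "min r \<rho> > 0" using r(1) \<rho>(1) by simp
  from fibres_near[OF this, of 0] obtain \<delta> where \<delta>: "\<delta> > 0"
    "\<And>w'. w' \<in> ball 0 \<delta> \<Longrightarrow> {x. f x = w'} \<subseteq> (\<Union>x\<in>?S. ball x (min r \<rho>))" by blast
  obtain \<nu> where \<nu>: "continuous_on UNIV \<nu>" "\<And>w. w \<in> G \<Longrightarrow> \<nu> w = (\<Prod>x\<in>{x. f x = w}. g x)"
    using norm_fun[OF g(1)] by blast
  obtain \<delta>' where \<delta>': "\<delta>' > 0" "\<And>w. dist w 0 < \<delta>' \<Longrightarrow> dist (\<nu> w) (\<nu> 0) < 1 / 6"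
    using \<nu>(1) unfolding continuous_on_iff by (metis UNIV_I zero_less_divide_1_iff zero_less_numeral)
  let ?N = "\<lambda>w. card {z \<in> ball x r. f z = w}"
  have bounds: "2 ^ ?N w * (5 / 6) \<le> norm (\<nu> w) \<and> norm (\<nu> w) \<le> 2 ^ ?N w * (6 / 5)"
    if w: "w \<in> G" "w \<in> ball 0 \<delta>" for w
  proof -
    let ?A = "{z \<in> ball x r. f z = w}" and ?B = "{z. f z = w} - ball x r"
    have AB: "{z. f z = w} = ?A \<union> ?B" "?A \<inter> ?B = {}" by auto
    have finA: "finite ?A" by (rule finite_subset[OF _ fin[of w]]) auto
    have finB: "finite ?B" using fin[of w] by simp
    have cardM: "card ?A + card ?B = M"
      using card_G[OF w(1)] card_Un_disjoint[OF finA finB AB(2)] AB(1) by simp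
    have near: "norm (g y) \<le> norm (g z) + (c - 1) \<and> norm (g z) - (1 - 1 / c) \<le> norm (g y)"
      if "z \<in> ?S" "y \<in> ball z \<rho>" for y z
    proof -
      have "\<bar>norm (g y) - norm (g z)\<bar> < e"
        using \<rho>(2)[OF that] norm_triangle_ineq3[of "g y" "g z"] by linarith
      then show ?thesis using e by linarith
    qed
    have A: "2 * (1 / c) \<le> norm (g y) \<and> norm (g y) \<le> 2 * c" if y: "y \<in> ?A" for y
    proof -
      obtain z where z: "z \<in> ?S" "y \<in> ball z (min r \<rho>)" using \<delta>(2)[OF w(2)] y by auto
      have "z = x"
      proof (rule ccontr)
        assume "z \<noteq> x"
        then have "2 * r \<le> dist x z" using r(2) z(1) by auto
        moreover have "dist x z \<le> dist x y + dist z y" by (metis dist_triangle dist_commute)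
        moreover have "dist z y < r" "dist x y < r" using z(2) y by auto
        ultimately show False by simp
      qed
      then have "norm (g z) = 2" using g(2) z(1) by simp
      then show ?thesis using near[of z y] z c(1) by (auto simp: field_simps)
    qed
    have B: "1 / c \<le> norm (g y) \<and> norm (g y) \<le> c" if y: "y \<in> ?B" for y
    proof -
      obtain z where z: "z \<in> ?S" "y \<in> ball z (min r \<rho>)" using \<delta>(2)[OF w(2)] y by auto
      have "z \<noteq> x" using z y by auto
      then have "norm (g z) = 1" using g(2) z(1) by simp
      then show ?thesis using near[of z y] z by auto
    qed
    have "\<nu> w = prod g (?A \<union> ?B)"
      using \<nu>(2)[OF w(1)] by (simp only: AB(1)[symmetric])
    then have \<nu>w: "norm (\<nu> w) = (\<Prod>y\<in>?A. norm (g y)) * (\<Prod>y\<in>?B. norm (g y))"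
      unfolding prod.union_disjoint[OF finA finB AB(2)] by (simp only: norm_mult prod_norm)
    have P: "2 ^ ?N w * a ^ M = (\<Prod>y\<in>?A. 2 * a) * (\<Prod>y\<in>?B. a)" for a :: real
      unfolding cardM[symmetric] by (simp add: power_mult_distrib power_add)
    have "2 ^ ?N w * (1 / c) ^ M \<le> norm (\<nu> w)"
      unfolding \<nu>w P using A B c(1) by (intro mult_mono prod_mono prod_nonneg) auto
    moreover have "norm (\<nu> w) \<le> 2 ^ ?N w * c ^ M"
      unfolding \<nu>w P using A B c(1) by (intro mult_mono prod_mono prod_nonneg) auto
    moreover have "5 / 6 \<le> (1 / c) ^ M" using c_le c(1) by (simp add: power_one_over field_simps)
    ultimately show ?thesis
      using c_le by (meson mult_left_mono order.trans zero_le_numeral zero_le_power)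
  qed
  have le: "?N w' \<le> ?N w" if "w \<in> G" "w \<in> ball 0 (min \<delta> \<delta>')" "w' \<in> G" "w' \<in> ball 0 (min \<delta> \<delta>')" for w w'
  proof (rule ccontr)
    assume "\<not> ?thesis"
    \<comment> \<open>With N = \<open>?N w\<close>, a larger count would give
      \<open>5/3 * 2^N < 6/5 * 2^N + 1/3\<close>, impossible since 5/3 - 6/5 = 7/15 exceeds
      1/3.\<close>
    then have "(2::real) ^ Suc (?N w) \<le> 2 ^ ?N w'" by (intro power_increasing) auto
    moreover have "norm (\<nu> w') < norm (\<nu> w) + 1 / 3"
      using \<delta>'(2)[of w] \<delta>'(2)[of w'] that norm_triangle_ineq2[of "\<nu> w'" "\<nu> w"]
        dist_triangle2[of "\<nu> w'" "\<nu> w" "\<nu> 0"] by (auto simp: dist_norm)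
    moreover have "(1::real) \<le> 2 ^ ?N w" by simp
    moreover have "w \<in> ball 0 \<delta>" "w' \<in> ball 0 \<delta>" using that by auto
    then have "2 ^ ?N w' * (5 / 6) \<le> norm (\<nu> w')" "norm (\<nu> w) \<le> 2 ^ ?N w * (6 / 5)"
      using bounds that(1,3) by blast+
    ultimately show False unfolding power_Suc by linarith
  qed
  obtain w0 where w0: "w0 \<in> G" "dist w0 0 < min \<delta> \<delta>'" using G_near[of "min \<delta> \<delta>'" 0] \<delta>(1) \<delta>'(1) by auto
  show ?thesis
    by (rule that[of "min \<delta> \<delta>'" "?N w0"])
       (use \<delta>(1) \<delta>'(1) w0 le in \<open>auto intro!: le_antisym simp: dist_commute\<close>)
qed

text \<open>A generic fibre near 0 splits among disjoint balls around the zeros, and the share of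
  each ball is the multiplicity of its centre.\<close>

theorem sum_zero_mult: "(\<Sum>x\<in>{x. f x = 0}. zero_mult f x) = M"
proof -
  let ?S = "{x. f x = 0}"
  obtain r where r: "r > 0" "\<And>x y. x \<in> ?S \<Longrightarrow> y \<in> ?S \<Longrightarrow> x \<noteq> y \<Longrightarrow> 2 * r \<le> dist x y"
    by (rule finite_separation[OF fin[of 0]]) blast
  have "\<forall>x\<in>?S. \<exists>\<delta>>0. \<forall>w\<in>G \<inter> ball 0 \<delta>. card {z \<in> ball x r. f z = w} = zero_mult f x"
  proof
    fix x assume x: "x \<in> ?S"
    then have fx: "f x = 0" by simp
    have r2: "2 * r \<le> dist x z" if "f z = 0" "z \<noteq> x" for z using r(2)[OF x, of z] that by auto
    obtain \<delta> n where \<delta>: "\<delta> > 0" and n: "\<And>w. w \<in> G \<Longrightarrow> w \<in> ball 0 \<delta> \<Longrightarrow> card {z \<in> ball x r. f z = w} = n"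
      using local_count[OF fx r(1) r2] by blast
    have "zero_mult f x = n"
    proof (rule zero_mult_eqI[OF cont r(1) \<delta>])
      show "{z \<in> cball x r. f z = 0} = {x}"
        using r(2)[OF x] fx r(1) by fastforce
      show "\<forall>w\<in>ball 0 \<delta>. finite {z \<in> ball x r. f z = w} \<and> card {z \<in> ball x r. f z = w} \<le> n"
      proof
        fix w :: 'b assume w: "w \<in> ball 0 \<delta>"
        then have "\<delta> - norm w > 0" by simp
        have "{z \<in> ball x r. f z = w} \<subseteq> {x. f x = w} \<inter> ball x r" by auto
        \<comment> \<open>The bound at arbitrary w is inherited from a generic w': at least as many
          points lie in the same ball over w', and w' is still within \<delta> of 0.\<close>
        from fibre_lower_semicontinuous[OF this open_ball \<open>\<delta> - norm w > 0\<close>]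
        obtain w' where w': "w' \<in> G" "dist w' w < \<delta> - norm w"
          "card {z \<in> ball x r. f z = w} \<le> card ({z. f z = w'} \<inter> ball x r)"
          by blast
        have "w' \<in> ball 0 \<delta>"
          using w'(2) norm_triangle_ineq2[of w' w] by (simp add: dist_norm)
        from n[OF w'(1) this] have "card ({z. f z = w'} \<inter> ball x r) = n"
          by (simp add: Int_def conj_commute)
        then show "finite {z \<in> ball x r. f z = w} \<and> card {z \<in> ball x r. f z = w} \<le> n"
          using w'(3) finite_subset[OF _ fin[of w], of "{z \<in> ball x r. f z = w}"] by auto
      qed
      show "ball 0 \<delta> \<subseteq> closure {w \<in> ball 0 \<delta>. card {z \<in> ball x r. f z = w} = n}"
      proof -
        have "ball 0 \<delta> \<subseteq> closure (ball 0 \<delta> \<inter> G)"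
          using open_Int_closure_subset[OF open_ball, of 0 \<delta> G] dense by simp
        also have "\<dots> \<subseteq> closure {w \<in> ball 0 \<delta>. card {z \<in> ball x r. f z = w} = n}"
          using n by (intro closure_mono) auto
        finally show ?thesis .
      qed
    qed
    then show "\<exists>\<delta>>0. \<forall>w\<in>G \<inter> ball 0 \<delta>. card {z \<in> ball x r. f z = w} = zero_mult f x"
      using \<delta> n by auto
  qed
  from bchoice[OF this] obtain \<delta> where \<delta>: "\<And>x. x \<in> ?S \<Longrightarrow> \<delta> x > 0"
    "\<And>x w. x \<in> ?S \<Longrightarrow> w \<in> G \<Longrightarrow> w \<in> ball 0 (\<delta> x) \<Longrightarrow> card {z \<in> ball x r. f z = w} = zero_mult f x"
    by blast
  obtain \<delta>' where \<delta>': "\<delta>' > 0" "\<And>w. w \<in> ball 0 \<delta>' \<Longrightarrow> {x. f x = w} \<subseteq> (\<Union>x\<in>?S. ball x r)"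
    using fibres_near[OF r(1), of 0] by blast
  define \<delta>0 where "\<delta>0 = Min (insert \<delta>' (\<delta> ` ?S))"
  have "\<delta>0 > 0" unfolding \<delta>0_def using fin[of 0] \<delta>'(1) \<delta>(1) by (subst Min_gr_iff) auto
  then obtain w where w: "w \<in> G" "dist w 0 < \<delta>0" using G_near by blast
  have "\<delta>0 \<le> \<delta>'" "\<And>x. x \<in> ?S \<Longrightarrow> \<delta>0 \<le> \<delta> x"
    unfolding \<delta>0_def using fin[of 0] by (auto intro: Min_le)
  then have w': "w \<in> ball 0 \<delta>'" "\<And>x. x \<in> ?S \<Longrightarrow> w \<in> ball 0 (\<delta> x)" using w(2) by force+
  have "{x. f x = w} = (\<Union>x\<in>?S. {z \<in> ball x r. f z = w})"
    using \<delta>'(2)[OF w'(1)] by (intro equalityI subsetI) (auto simp: subset_iff)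
  then have "M = card (\<Union>x\<in>?S. {z \<in> ball x r. f z = w})"
    using card_G[OF w(1)] by (simp only:)
  also have "\<dots> = (\<Sum>x\<in>?S. card {z \<in> ball x r. f z = w})"
  proof (rule card_UN_disjoint[OF fin[of 0]])
    show "\<forall>x\<in>?S. finite {z \<in> ball x r. f z = w}"
      by (intro ballI finite_subset[OF _ fin[of w]]) auto
    show "\<forall>x\<in>?S. \<forall>y\<in>?S. x \<noteq> y \<longrightarrow> {z \<in> ball x r. f z = w} \<inter> {z \<in> ball y r. f z = w} = {}"
    proof (intro ballI impI equals0I)
      fix x y z assume xy: "x \<in> ?S" "y \<in> ?S" "x \<noteq> y" "z \<in> {z \<in> ball x r. f z = w} \<inter> {z \<in> ball y r. f z = w}"
      have "dist x y \<le> dist x z + dist y z" by (rule dist_triangle2)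
      then show False using r(2)[OF xy(1-3)] xy(4) by auto
    qed
  qed
  also have "\<dots> = (\<Sum>x\<in>?S. zero_mult f x)" using \<delta>(2) w(1) w'(2) by (intro sum.cong) auto
  finally show ?thesis ..
qed

end

section \<open>The Riccati recursion\<close>

abbreviation ecoef :: "nat \<Rightarrow> complex \<Rightarrow> complex \<Rightarrow> (nat \<Rightarrow> complex) \<Rightarrow> nat \<Rightarrow> complex" where
  "ecoef l a b L k \<equiv> etl l a b L k ! k"

lemma length_etl: "length (etl l a b L k) = Suc k"
  by (induction k) (simp_all add: Let_def)

lemma etl_nth: "t \<le> k \<Longrightarrow> etl l a b L k ! t = ecoef l a b L t"
proof (induction k)
  case (Suc k)
  then show ?case by (cases "t = Suc k") (simp_all add: Let_def nth_append length_etl)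
qed simp

lemma ecoef_Suc: "ecoef l a b L (Suc k) =
    (- (\<Sum>t\<le>k. ecoef l a b L t * ecoef l a b L (k - t)) + (if k = 0 then b else 0) + L k) / of_nat (l - Suc k)"
proof -
  have "etl l a b L (Suc k) ! Suc k =
    (- (\<Sum>t\<le>k. etl l a b L k ! t * etl l a b L k ! (k - t)) + (if k = 0 then b else 0) + L k) / of_nat (l - Suc k)"
    by (simp add: Let_def nth_append length_etl)
  also have "(\<Sum>t\<le>k. etl l a b L k ! t * etl l a b L k ! (k - t)) = (\<Sum>t\<le>k. ecoef l a b L t * ecoef l a b L (k - t))"
    by (intro sum.cong refl) (simp add: etl_nth[where k = k] del: etl.simps)
  finally show ?thesis .
qed

lemma Fpoly_ecoef: "Fpoly l a b L =
    - (\<Sum>t\<le>l - 1. ecoef l a b L t * ecoef l a b L (l - 1 - t)) + (if l - 1 = 0 then b else 0) + L (l - 1)"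
proof -
  have "(\<Sum>t\<le>l - 1. etl l a b L (l - 1) ! t * etl l a b L (l - 1) ! (l - 1 - t)) =
      (\<Sum>t\<le>l - 1. ecoef l a b L t * ecoef l a b L (l - 1 - t))"
    by (intro sum.cong refl) (simp add: etl_nth[where k = "l - Suc 0"] del: etl.simps)
  then show ?thesis unfolding Fpoly_def Let_def by simp
qed

text \<open>Weighted homogeneity: with weight 1 for a, 2 for b and k + 2 for \<open>L k\<close>, the
  k-th coefficient has weight k + 1.\<close>

lemma ecoef_scale:
  "ecoef l (s * a) (s\<^sup>2 * b) (\<lambda>k. s ^ (k + 2) * L k) k = s ^ (k + 1) * ecoef l a b L k"
proof (induction k rule: less_induct)
  case (less k)
  show ?case
  proof (cases k)
    case (Suc j)
    let ?e = "ecoef l (s * a) (s\<^sup>2 * b) (\<lambda>k. s ^ (k + 2) * L k)"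
    have "(\<Sum>t\<le>j. ?e t * ?e (j - t)) = (\<Sum>t\<le>j. s ^ (j + 2) * (ecoef l a b L t * ecoef l a b L (j - t)))"
    proof (intro sum.cong refl)
      fix t assume t: "t \<in> {..j}"
      have "s ^ (t + 1) * s ^ (j - t + 1) = s ^ (j + 2)"
        using t by (simp flip: power_add power_Suc)
      then show "?e t * ?e (j - t) = s ^ (j + 2) * (ecoef l a b L t * ecoef l a b L (j - t))"
        using less[of t] less[of "j - t"] t Suc by (simp del: etl.simps power_Suc add: mult_ac)
    qed
    then have "?e (Suc j) = (- (s ^ (j + 2) * (\<Sum>t\<le>j. ecoef l a b L t * ecoef l a b L (j - t))) +
        (if j = 0 then s\<^sup>2 * b else 0) + s ^ (j + 2) * L j) / of_nat (l - Suc j)"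
      unfolding ecoef_Suc by (simp only: sum_distrib_left)
    also have "\<dots> = s ^ (j + 2) * ecoef l a b L (Suc j)"
      unfolding ecoef_Suc by (cases "j = 0") (simp_all add: algebra_simps power2_eq_square add_divide_distrib diff_divide_distrib)
    finally show ?thesis unfolding Suc by simp
  qed simp
qed

lemma Fpoly_scale:
  assumes "l \<ge> 1"
  shows "Fpoly l (s * a) (s\<^sup>2 * b) (\<lambda>k. s ^ (k + 2) * L k) = s ^ (l + 1) * Fpoly l a b L"
proof -
  obtain j where l: "l = Suc j" using assms by (cases l) auto
  have "(\<Sum>t\<le>j. s ^ (t + 1) * ecoef l a b L t * (s ^ (j - t + 1) * ecoef l a b L (j - t))) =
      (\<Sum>t\<le>j. s ^ (j + 2) * (ecoef l a b L t * ecoef l a b L (j - t)))"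
  proof (intro sum.cong refl)
    fix t assume t: "t \<in> {..j}"
    have "s ^ (t + 1) * s ^ (j - t + 1) = s ^ (j + 2)"
      using t by (simp flip: power_add power_Suc)
    then show "s ^ (t + 1) * ecoef l a b L t * (s ^ (j - t + 1) * ecoef l a b L (j - t)) =
        s ^ (j + 2) * (ecoef l a b L t * ecoef l a b L (j - t))"
      by (metis mult.assoc mult.left_commute)
  qed
  also have "\<dots> = s ^ (j + 2) * (\<Sum>t\<le>j. ecoef l a b L t * ecoef l a b L (j - t))"
    by (simp add: sum_distrib_left)
  finally have sum: "(\<Sum>t\<le>j. s ^ (t + 1) * ecoef l a b L t * (s ^ (j - t + 1) * ecoef l a b L (j - t))) = \<dots>" .
  have j: "l - 1 = j" using l by simp
  show ?thesis
    unfolding Fpoly_ecoef ecoef_scale j sum unfolding l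
    by (cases "j = 0") (simp_all add: algebra_simps power2_eq_square)
qed

text \<open>Without the lower order terms the recursion is the Riccati equation of the Whittaker equation
  \<open>w'' = (\<eta>(\<eta>+1)/z\<^sup>2 + a/z + \<mu>\<^sup>2) w\<close> with \<open>\<eta> = l/2\<close>.  The substitution \<open>w = z\<^bsup>-\<eta>\<^esup> exp(\<mu>z) \<phi>\<close> turns it into
  \<open>z\<phi>'' + (2\<mu>z - l)\<phi>' - (l\<mu> + a)\<phi> = 0\<close>, whose power series solution has the two-term recurrence of
  \<open>whit\<close>; the obstruction at order \<open>l\<close> is a product of linear forms.\<close>

primrec whit :: "nat \<Rightarrow> complex \<Rightarrow> complex \<Rightarrow> nat \<Rightarrow> complex" where
  "whit l a \<mu> 0 = 1"
| "whit l a \<mu> (Suc n) = (a + (of_nat l - 2 * of_nat n) * \<mu>) * whit l a \<mu> n /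
     (of_nat (Suc n) * (of_nat n - of_nat l))"

definition kappa :: "nat \<Rightarrow> complex" where
  "kappa l = (\<Prod>n<l. 1 / (of_nat (Suc n) * (of_nat n - of_nat l)))"

lemma kappa_nonzero: "kappa l \<noteq> 0"
  unfolding kappa_def by (auto simp del: of_nat_Suc)

lemma whit_prod: "whit l a \<mu> n =
    (\<Prod>j<n. 1 / (of_nat (Suc j) * (of_nat j - of_nat l))) * (\<Prod>j<n. a + (of_nat l - 2 * of_nat j) * \<mu>)"
  by (induction n) (simp_all del: of_nat_Suc)

text \<open>The recurrence stops at n = l, where the factor n - l vanishes. The series truncated
  there solves the equation up to one term at order l, the obstruction.\<close>

lemma fps_whit_ode:
  fixes a \<mu> :: complex and l :: nat
  defines "\<Phi> \<equiv> Abs_fps (\<lambda>n. if n \<le> l then whit l a \<mu> n else 0)"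
  shows "fps_X * fps_deriv (fps_deriv \<Phi>) + fps_const (2 * \<mu>) * (fps_X * fps_deriv \<Phi>) - fps_const (of_nat l) * fps_deriv \<Phi>
    - fps_const (of_nat l * \<mu> + a) * \<Phi> = fps_const (- (a - of_nat l * \<mu>) * whit l a \<mu> l) * fps_X ^ l"
    (is "?lhs = ?rhs")
proof (rule fps_ext)
  fix n
  let ?c = "\<lambda>n. if n \<le> l then whit l a \<mu> n else 0"
  have X: "fps_nth (fps_X * f) n = (if n = 0 then 0 else fps_nth f (n - 1))" for f :: "complex fps"
    by (rule fps_X_mult_nth)
  have "fps_nth ?lhs n = of_nat n * of_nat (Suc n) * ?c (Suc n) + 2 * \<mu> * of_nat n * ?c n
      - of_nat l * of_nat (Suc n) * ?c (Suc n) - (of_nat l * \<mu> + a) * ?c n"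
    unfolding \<Phi>_def
    by (cases n) (simp_all add: X algebra_simps)
  also have "\<dots> = of_nat (Suc n) * (of_nat n - of_nat l) * ?c (Suc n) - (a + (of_nat l - 2 * of_nat n) * \<mu>) * ?c n"
    by (simp add: algebra_simps)
  also have "\<dots> = (if n = l then - (a - of_nat l * \<mu>) * whit l a \<mu> l else 0)"
  proof (cases "n < l")
    case True
    then have "(of_nat n - of_nat l :: complex) \<noteq> 0" by simp
    moreover have "(of_nat (Suc n) :: complex) \<noteq> 0" by (simp del: of_nat_Suc)
    ultimately show ?thesis using True by (simp del: of_nat_Suc)
  qed (auto simp: algebra_simps)
  also have "\<dots> = fps_nth ?rhs n" by simp
  finally show "fps_nth ?lhs n = fps_nth ?rhs n" .
qed

text \<open>For w as above, w'/w = - l/(2z) - E with \<open>E = - (\<mu> + \<Phi>'/\<Phi>)\<close>,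
  and the Riccati equation times z is \<open>?R = 0\<close> up to the residual term. Comparing
  coefficients below order l gives the recursion for \<open>etl\<close>; at order l the coefficient
  of the next unknown vanishes, and what remains is minus \<open>Fpoly\<close>.\<close>

theorem Fpoly_top:
  assumes l: "l \<ge> 1"
  shows "Fpoly l a (\<mu>\<^sup>2) (\<lambda>_. 0) = kappa l * (\<Prod>j<l + 1. a + (of_nat l - 2 * of_nat j) * \<mu>)"
proof -
  define \<Phi> where "\<Phi> = Abs_fps (\<lambda>n. if n \<le> l then whit l a \<mu> n else 0)"
  define r where "r = - (a - of_nat l * \<mu>) * whit l a \<mu> l"
  define Y where "Y = fps_deriv \<Phi> * inverse \<Phi>"
  define E where "E = - (fps_const \<mu> + Y)"
  have \<Phi>0: "fps_nth \<Phi> 0 = 1" by (simp add: \<Phi>_def)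
  have inv: "inverse \<Phi> * \<Phi> = 1" by (rule inverse_mult_eq_1) (simp add: \<Phi>0)
  have Y\<Phi>: "Y * \<Phi> = fps_deriv \<Phi>" unfolding Y_def by (simp add: mult.assoc inv)
  have "fps_deriv (Y * \<Phi>) = Y * fps_deriv \<Phi> + fps_deriv Y * \<Phi>" by simp
  then have Y'\<Phi>: "fps_deriv Y * \<Phi> = fps_deriv (fps_deriv \<Phi>) - Y * fps_deriv \<Phi>"
    unfolding Y\<Phi> by simp
  have riccati: "(- (x * - y') + x * (- (u + y) * - (u + y)) - u * u * x + v * - (u + y) - w) * p =
      x * (y' * p) + (u + u) * (x * (y * p)) + x * (y * (y * p)) - v * (y * p) - (v * u + w) * p"
    for x y y' u v w p :: "complex fps"
    by (simp add: algebra_simps)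
  have E': "fps_deriv E = - fps_deriv Y" by (simp add: E_def)
  let ?R = "- (fps_X * fps_deriv E) + fps_X * (E * E) - fps_const (\<mu>\<^sup>2) * fps_X + fps_const (of_nat l) * E - fps_const a"
  have sq: "fps_const (\<mu>\<^sup>2) = fps_const \<mu> * fps_const \<mu>" by (simp add: power2_eq_square)
  have lm: "fps_const (of_nat l * \<mu> + a) = fps_const (of_nat l) * fps_const \<mu> + fps_const a" by simp
  have two: "fps_const (2 * \<mu>) = fps_const \<mu> + fps_const \<mu>" by simp
  have "?R * \<Phi> = fps_X * (fps_deriv Y * \<Phi>) + (fps_const \<mu> + fps_const \<mu>) * (fps_X * (Y * \<Phi>)) + fps_X * (Y * (Y * \<Phi>))
      - fps_const (of_nat l) * (Y * \<Phi>) - (fps_const (of_nat l) * fps_const \<mu> + fps_const a) * \<Phi>"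
    unfolding E' sq unfolding E_def by (rule riccati)
  also have "\<dots> = fps_const r * fps_X ^ l"
    unfolding Y'\<Phi> Y\<Phi> r_def fps_whit_ode[of l a \<mu>, folded \<Phi>_def, symmetric] lm two
    by (simp only: algebra_simps)
  finally have R\<Phi>: "?R * \<Phi> = fps_const r * fps_X ^ l" .
  have "\<Phi> * inverse \<Phi> = 1" using inv by (simp only: mult.commute)
  then have "?R = (?R * \<Phi>) * inverse \<Phi>" by (simp only: mult.assoc mult_1_right)
  then have R: "?R = fps_const r * (fps_X ^ l * inverse \<Phi>)" unfolding R\<Phi> by (simp only: mult.assoc)
  have nth_rhs: "fps_nth (fps_const r * (fps_X ^ l * inverse \<Phi>)) k = (if k = l then r else 0)" if "k \<le> l" for k
    using that \<Phi>0 by (auto simp: fps_X_power_mult_nth)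
  have "fps_nth ?R 0 = 0" unfolding R using nth_rhs[of 0] l by simp
  then have E0: "of_nat l * fps_nth E 0 = a" by simp
  have nth_Suc: "(of_nat l - of_nat (Suc k)) * fps_nth E (Suc k) + (\<Sum>t\<le>k. fps_nth E t * fps_nth E (k - t))
      - (if k = 0 then \<mu>\<^sup>2 else 0) = (if Suc k = l then r else 0)" if "Suc k \<le> l" for k
  proof -
    have "fps_nth ?R (Suc k) = - (of_nat (Suc k) * fps_nth E (Suc k)) + (\<Sum>t\<le>k. fps_nth E t * fps_nth E (k - t))
        - (if k = 0 then \<mu>\<^sup>2 else 0) + of_nat l * fps_nth E (Suc k)"
      by (simp add: fps_mult_nth[of E E] atLeast0AtMost del: of_nat_Suc)
    moreover have "fps_nth ?R (Suc k) = (if Suc k = l then r else 0)" unfolding R using nth_rhs[OF that] .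
    moreover have "(c - s) * e + S - m = z" if "z' = - (s * e) + S - m + c * e" "z' = z" for c s e S m z z' :: complex
      using that by (simp add: algebra_simps)
    ultimately show ?thesis by blast
  qed
  have E: "ecoef l a (\<mu>\<^sup>2) (\<lambda>_. 0) k = fps_nth E k" if "k < l" for k
    using that
  proof (induction k rule: less_induct)
    case (less k)
    show ?case
    proof (cases k)
      case 0
      then show ?thesis using E0 l by (simp add: field_simps)
    next
      case (Suc j)
      have "(\<Sum>t\<le>j. ecoef l a (\<mu>\<^sup>2) (\<lambda>_. 0) t * ecoef l a (\<mu>\<^sup>2) (\<lambda>_. 0) (j - t)) = (\<Sum>t\<le>j. fps_nth E t * fps_nth E (j - t))"
        using less Suc by (intro sum.cong) auto
      moreover have "(of_nat (l - Suc j) :: complex) = of_nat l - of_nat (Suc j)"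
        using less.prems Suc by (simp only: of_nat_diff less_imp_le)
      moreover have "(of_nat (l - Suc j) :: complex) \<noteq> 0"
        unfolding of_nat_eq_0_iff using less.prems Suc by linarith
      moreover have "(of_nat l - of_nat (Suc j)) * fps_nth E (Suc j) + (\<Sum>t\<le>j. fps_nth E t * fps_nth E (j - t))
          - (if j = 0 then \<mu>\<^sup>2 else 0) = 0"
        using nth_Suc[of j] less.prems Suc by simp
      moreover have "(- S + m + 0) / D = e" if "D \<noteq> 0" "D * e + S - m = 0" for D e S m :: complex
      proof -
        have "m = D * e + S" using that(2) by simp
        then have "- S + m + 0 = e * D" by (simp add: mult.commute)
        then show ?thesis using that(1) by (metis nonzero_mult_div_cancel_right)
      qed
      ultimately show ?thesis
        unfolding Suc ecoef_Suc by (simp only:)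
    qed
  qed
  obtain j where j: "l = Suc j" using l by (cases l) auto
  have "(\<Sum>t\<le>l - 1. ecoef l a (\<mu>\<^sup>2) (\<lambda>_. 0) t * ecoef l a (\<mu>\<^sup>2) (\<lambda>_. 0) (l - 1 - t)) = (\<Sum>t\<le>j. fps_nth E t * fps_nth E (j - t))"
    using E j by (intro sum.cong) auto
  then have "Fpoly l a (\<mu>\<^sup>2) (\<lambda>_. 0) = - r"
    unfolding Fpoly_ecoef using nth_Suc[of j] j by (simp add: algebra_simps)
  also have "\<dots> = kappa l * (\<Prod>j<l + 1. a + (of_nat l - 2 * of_nat j) * \<mu>)"
    unfolding r_def whit_prod kappa_def by (simp add: algebra_simps)
  finally show ?thesis .
qed

section \<open>Continuity and degree bounds for the recursion\<close>

lemma continuous_Fpoly: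
  assumes a: "continuous_on S a" and b: "continuous_on S b" and L: "\<And>k. continuous_on S (L k)"
  shows "continuous_on S (\<lambda>x. Fpoly l (a x) (b x) (\<lambda>k. L k x))"
proof -
  have "continuous_on S (\<lambda>x. ecoef l (a x) (b x) (\<lambda>k. L k x) k)" for k
  proof (induction k rule: less_induct)
    case (less k)
    show ?case
    proof (cases k)
      case 0
      have "continuous_on S (\<lambda>x. a x / of_nat l)"
        using continuous_on_mult_right[OF a, of "1 / of_nat l"] by simp
      then show ?thesis using 0 by simp
    next
      case (Suc j)
      have "continuous_on S (\<lambda>x. ecoef l (a x) (b x) (\<lambda>k. L k x) t)" if "t \<le> j" for t
        using less[of t] that Suc by simp
      moreover have "continuous_on S (\<lambda>x. if j = 0 then b x else 0)"
        using b by (cases "j = 0") auto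
      ultimately have "continuous_on S (\<lambda>x. (- (\<Sum>t\<le>j. ecoef l (a x) (b x) (\<lambda>k. L k x) t * ecoef l (a x) (b x) (\<lambda>k. L k x) (j - t)) +
          (if j = 0 then b x else 0) + L j x) * (1 / of_nat (l - Suc j)))"
        by (intro continuous_intros L) auto
      then show ?thesis unfolding Suc ecoef_Suc by simp
    qed
  qed
  moreover have "continuous_on S (\<lambda>x. if l - 1 = 0 then b x else 0)"
    using b by (cases "l - 1 = 0") auto
  ultimately show ?thesis unfolding Fpoly_ecoef by (intro continuous_intros L)
qed

context coeff_ring
begin

text \<open>\<open>L k\<close> has degree 1 but enters an equation of degree k + 2, so it affects
  only lower order terms. Differences of products are split as (x - x') y + x' (y - y').\<close>

lemma pdeg_ecoef:
  assumes a: "pdeg R X 1 a" and b: "pdeg R X 2 b" and L: "\<And>k. pdeg R X 1 (L k)"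
  shows "pdeg R X (Suc k) (\<lambda>\<theta> x. ecoef l (a \<theta> x) (b \<theta> x) (\<lambda>_. 0) k) \<and>
    pdeg R X k (\<lambda>\<theta> x. ecoef l (a \<theta> x) (b \<theta> x) (\<lambda>k. L k \<theta> x) k - ecoef l (a \<theta> x) (b \<theta> x) (\<lambda>_. 0) k)"
proof (induction k rule: less_induct)
  case (less k)
  show ?case
  proof (cases k)
    case 0
    have "pdeg R X (Suc 0) (\<lambda>\<theta> x. a \<theta> x / of_nat l)" using pdeg_divide[OF a] by simp
    moreover have "pdeg R X 0 (\<lambda>\<theta> x. 0)" by (rule pdeg_const)
    ultimately show ?thesis using 0 by simp
  next
    case (Suc j)
    let ?full = "\<lambda>k \<theta> x. ecoef l (a \<theta> x) (b \<theta> x) (\<lambda>k. L k \<theta> x) k"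
    let ?top = "\<lambda>k \<theta> x. ecoef l (a \<theta> x) (b \<theta> x) (\<lambda>_. 0) k"
    have e0: "pdeg R X (Suc t) (?top t)" and diff: "pdeg R X t (\<lambda>\<theta> x. ?full t \<theta> x - ?top t \<theta> x)" if "t \<le> j" for t
      using less[of t] that Suc by auto
    have e: "pdeg R X (Suc t) (?full t)" if "t \<le> j" for t
      using add[OF e0[OF that] pdeg_mono[OF diff[OF that], of "Suc t"]] by simp
    have 1: "pdeg R X (Suc (Suc j)) (\<lambda>\<theta> x. \<Sum>t\<le>j. ?top t \<theta> x * ?top (j - t) \<theta> x)"
      by (intro pdeg_sum mult[OF e0 e0]) auto
    have 2: "pdeg R X (Suc j) (\<lambda>\<theta> x. \<Sum>t\<le>j. (?full t \<theta> x - ?top t \<theta> x) * ?full (j - t) \<theta> x + ?top t \<theta> x * (?full (j - t) \<theta> x - ?top (j - t) \<theta> x))"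
      by (intro pdeg_sum add mult[OF diff e] mult[OF e0 diff]) auto
    have b': "pdeg R X (Suc (Suc j)) (\<lambda>\<theta> x. if j = 0 then b \<theta> x else 0)"
      using pdeg_mono[OF b, of "Suc (Suc j)"] pdeg_const by (cases "j = 0") simp_all
    have L': "pdeg R X (Suc j) (L j)" by (rule pdeg_mono[OF L]) simp
    have "pdeg R X (Suc (Suc j)) (?top (Suc j))"
      unfolding ecoef_Suc by (intro pdeg_divide add pdeg_uminus 1 b' pdeg_const)
    moreover have "?full (Suc j) \<theta> x - ?top (Suc j) \<theta> x = (L j \<theta> x -
        (\<Sum>t\<le>j. (?full t \<theta> x - ?top t \<theta> x) * ?full (j - t) \<theta> x + ?top t \<theta> x * (?full (j - t) \<theta> x - ?top (j - t) \<theta> x))) / of_nat (l - Suc j)"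
      for \<theta> x
      unfolding ecoef_Suc diff_divide_distrib[symmetric]
      by (rule arg_cong[of _ _ "\<lambda>z. z / _"]) (simp add: algebra_simps sum_subtractf sum.distrib del: etl.simps)
    then have "pdeg R X (Suc j) (\<lambda>\<theta> x. ?full (Suc j) \<theta> x - ?top (Suc j) \<theta> x)"
      using pdeg_divide[OF pdeg_diff[OF L' 2]] by simp
    ultimately show ?thesis unfolding Suc by blast
  qed
qed

lemma pdeg_Fpoly_lower:
  assumes a: "pdeg R X 1 a" and b: "pdeg R X 2 b" and L: "\<And>k. pdeg R X 1 (L k)" and l: "l \<ge> 1"
  shows "pdeg R X l (\<lambda>\<theta> x. Fpoly l (a \<theta> x) (b \<theta> x) (\<lambda>k. L k \<theta> x) - Fpoly l (a \<theta> x) (b \<theta> x) (\<lambda>_. 0))"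
proof -
  obtain j where j: "l = Suc j" using l by (cases l) auto
  let ?full = "\<lambda>k \<theta> x. ecoef l (a \<theta> x) (b \<theta> x) (\<lambda>k. L k \<theta> x) k"
  let ?top = "\<lambda>k \<theta> x. ecoef l (a \<theta> x) (b \<theta> x) (\<lambda>_. 0) k"
  have e0: "pdeg R X (Suc t) (?top t)" and diff: "pdeg R X t (\<lambda>\<theta> x. ?full t \<theta> x - ?top t \<theta> x)" for t
    using pdeg_ecoef[OF a b L] by auto
  have e: "pdeg R X (Suc t) (?full t)" for t
    using add[OF e0 pdeg_mono[OF diff[of t], of "Suc t"]] by simp
  have 2: "pdeg R X (Suc j) (\<lambda>\<theta> x. \<Sum>t\<le>j. (?full t \<theta> x - ?top t \<theta> x) * ?full (j - t) \<theta> x + ?top t \<theta> x * (?full (j - t) \<theta> x - ?top (j - t) \<theta> x))"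
    by (intro pdeg_sum add mult[OF diff e] mult[OF e0 diff]) auto
  have L': "pdeg R X (Suc j) (L j)" by (rule pdeg_mono[OF L]) simp
  have j': "l - 1 = j" using j by simp
  have "Fpoly l (a \<theta> x) (b \<theta> x) (\<lambda>k. L k \<theta> x) - Fpoly l (a \<theta> x) (b \<theta> x) (\<lambda>_. 0) = L j \<theta> x -
      (\<Sum>t\<le>j. (?full t \<theta> x - ?top t \<theta> x) * ?full (j - t) \<theta> x + ?top t \<theta> x * (?full (j - t) \<theta> x - ?top (j - t) \<theta> x))" for \<theta> x
    unfolding Fpoly_ecoef j' by (simp add: algebra_simps sum_subtractf sum.distrib del: etl.simps)
  then show ?thesis using pdeg_diff[OF L' 2] j by simp
qed

end

section \<open>The Lame system\<close>

lemma sum_option: "(\<Sum>i\<in>UNIV. f i) = f None + (\<Sum>i\<in>UNIV. f (Some i))"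
  for f :: "'n::finite option \<Rightarrow> 'b::comm_monoid_add"
  unfolding UNIV_option_conv by (simp add: sum.reindex)

lemma prod_option: "(\<Prod>i\<in>UNIV. f i) = f None * (\<Prod>i\<in>UNIV. f (Some i))"
  for f :: "'n::finite option \<Rightarrow> 'b::comm_monoid_mult"
  unfolding UNIV_option_conv by (simp add: prod.reindex)

text \<open>The system is studied in the unknowns \<open>(A, \<mu>)\<close> with \<open>B = \<mu>\<^sup>2\<close>; the index \<open>None\<close> stands for
  \<open>\<mu>\<close> among the unknowns and for \<open>F\<^sub>0\<close> among the equations.\<close>

definition lame_coord :: "'n option \<Rightarrow> (complex^'n) \<times> complex \<Rightarrow> complex" where
  "lame_coord c v = (case c of None \<Rightarrow> snd v | Some i \<Rightarrow> vec_nth (fst v) i)"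

definition lame_deg :: "('n \<Rightarrow> nat) \<Rightarrow> 'n option \<Rightarrow> nat" where
  "lame_deg ls c = (case c of None \<Rightarrow> 1 | Some i \<Rightarrow> ls i + 1)"

text \<open>The - 1 moves the common zeros of the chosen factors away from the origin, where they
  would all coincide. \<open>lame_lower\<close> compensates, so that the equation reads
  \<open>F_0 = w0\<close>.\<close>

definition lame_form :: "('n::finite \<Rightarrow> nat) \<Rightarrow> 'n option \<Rightarrow> nat \<Rightarrow> (complex^'n) \<times> complex \<Rightarrow> complex" where
  "lame_form ls c j v = (case c of None \<Rightarrow> (\<Sum>i\<in>UNIV. vec_nth (fst v) i) - 1
     | Some i \<Rightarrow> vec_nth (fst v) i + (of_nat (ls i) - 2 * of_nat j) * snd v)"

definition lame_lower :: "('n \<Rightarrow> nat) \<Rightarrow> ('n \<Rightarrow> nat \<Rightarrow> 'p \<Rightarrow> (complex^'n) \<times> complex \<Rightarrow> complex) \<Rightarrow> ('p \<Rightarrow> complex) \<Rightarrow>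
    ('n \<Rightarrow> 'p \<Rightarrow> complex) \<Rightarrow> 'n option \<Rightarrow> 'p \<Rightarrow> (complex^'n) \<times> complex \<Rightarrow> complex" where
  "lame_lower ls L w0 w c \<theta> v = (case c of None \<Rightarrow> 1 - w0 \<theta>
     | Some i \<Rightarrow> (Fpoly (ls i) (vec_nth (fst v) i) ((snd v)\<^sup>2) (\<lambda>k. L i k \<theta> v)
         - Fpoly (ls i) (vec_nth (fst v) i) ((snd v)\<^sup>2) (\<lambda>_. 0) - w i \<theta>) / kappa (ls i))"

lemma lame_equation:
  assumes "ls i \<ge> 1"
  shows "(\<Prod>j<lame_deg ls (Some i). lame_form ls (Some i) j v) + lame_lower ls L w0 w (Some i) \<theta> v = 0 \<longleftrightarrow>
    Fpoly (ls i) (vec_nth (fst v) i) ((snd v)\<^sup>2) (\<lambda>k. L i k \<theta> v) = w i \<theta>"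
proof -
  have "(\<Prod>j<lame_deg ls (Some i). lame_form ls (Some i) j v) =
      Fpoly (ls i) (vec_nth (fst v) i) ((snd v)\<^sup>2) (\<lambda>_. 0) / kappa (ls i)"
    unfolding Fpoly_top[OF assms] lame_deg_def lame_form_def using kappa_nonzero[of "ls i"] by simp
  moreover have "F0 / \<kappa> + (F - F0 - z) / \<kappa> = 0 \<longleftrightarrow> F = z" if "\<kappa> \<noteq> 0" for F0 F z \<kappa> :: complex
    using that by (simp flip: add_divide_distrib)
  ultimately show ?thesis
    using kappa_nonzero[of "ls i"] by (simp add: lame_lower_def)
qed

lemma lame_equation_0:
  "(\<Prod>j<lame_deg ls None. lame_form ls None j v) + lame_lower ls L w0 w None \<theta> v = 0 \<longleftrightarrow>
    (\<Sum>i\<in>UNIV. vec_nth (fst v) i) = w0 \<theta>"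
  by (simp add: lame_deg_def lame_form_def lame_lower_def)

section \<open>Affine coordinates from one factor per equation\<close>

locale lame_degrees =
  fixes ls :: "'n::finite \<Rightarrow> nat"
  assumes l_pos: "\<And>i. ls i \<ge> 1" and l_odd: "odd (\<Sum>i\<in>UNIV. ls i)"
begin

definition weight :: "('n option \<Rightarrow> nat) \<Rightarrow> 'n \<Rightarrow> complex" where
  "weight k i = of_nat (ls i) - 2 * of_nat (k (Some i))"

text \<open>The sum is an odd integer. This is the determinant of the chosen linear forms up to
  sign, so oddness is what excludes zeros at infinity.\<close>

lemma weight_sum_nonzero: "(\<Sum>i\<in>UNIV. weight k i) \<noteq> 0"
proof
  assume "(\<Sum>i\<in>UNIV. weight k i) = 0"
  then have "of_nat (\<Sum>i\<in>UNIV. ls i) = (of_nat (2 * (\<Sum>i\<in>UNIV. k (Some i))) :: complex)"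
    by (simp add: weight_def sum_subtractf sum_distrib_left)
  then have "(\<Sum>i\<in>UNIV. ls i) = 2 * (\<Sum>i\<in>UNIV. k (Some i))"
    by (simp only: of_nat_eq_iff)
  then show False using l_odd by simp
qed

text \<open>Adding the forms of all \<open>Some i\<close> and subtracting that of
  \<open>None\<close> eliminates A and leaves \<mu>.\<close>

definition solve :: "('n option \<Rightarrow> nat) \<Rightarrow> ('n option \<Rightarrow> complex) \<Rightarrow> (complex^'n) \<times> complex" where
  "solve k y = (let \<mu> = ((\<Sum>i\<in>UNIV. y (Some i)) - y None - 1) / (\<Sum>i\<in>UNIV. weight k i)
     in (\<chi> i. y (Some i) - weight k i * \<mu>, \<mu>))"

lemma lame_form_k: "lame_form ls (Some i) (k (Some i)) v = vec_nth (fst v) i + weight k i * snd v"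
  by (simp add: lame_form_def weight_def)

lemma lame_form_0: "lame_form ls None j v = (\<Sum>i\<in>UNIV. vec_nth (fst v) i) - 1"
  by (simp add: lame_form_def)

lemma lame_form_solve: "lame_form ls c (k c) (solve k y) = y c"
proof (cases c)
  case None
  define \<mu> where "\<mu> = ((\<Sum>i\<in>UNIV. y (Some i)) - y None - 1) / (\<Sum>i\<in>UNIV. weight k i)"
  have "(\<Sum>i\<in>UNIV. y (Some i) - weight k i * \<mu>) = (\<Sum>i\<in>UNIV. y (Some i)) - (\<Sum>i\<in>UNIV. weight k i) * \<mu>"
    by (simp only: sum_subtractf sum_distrib_right)
  also have "(\<Sum>i\<in>UNIV. weight k i) * \<mu> = (\<Sum>i\<in>UNIV. y (Some i)) - y None - 1"
    using weight_sum_nonzero[of k] by (simp add: \<mu>_def)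
  finally show ?thesis
    unfolding None lame_form_0 solve_def Let_def \<mu>_def[symmetric] by simp
next
  case (Some i)
  show ?thesis unfolding Some lame_form_k solve_def Let_def by simp
qed

lemma solve_lame_form: "solve k (\<lambda>c. lame_form ls c (k c) v) = v"
proof -
  have "((\<Sum>i\<in>UNIV. vec_nth (fst v) i + weight k i * snd v) - ((\<Sum>i\<in>UNIV. vec_nth (fst v) i) - 1) - 1) /
      (\<Sum>i\<in>UNIV. weight k i) = snd v"
    using weight_sum_nonzero[of k] by (simp add: sum.distrib flip: sum_distrib_right)
  then show ?thesis
    unfolding solve_def Let_def lame_form_k lame_form_0 by (simp add: prod_eq_iff Finite_Cartesian_Product.vec_eq_iff)
qed

lemma solve_affine: "\<exists>a0 a. \<forall>c y. lame_coord c (solve k y) = a0 c + (\<Sum>i\<in>UNIV. a c i * y i)"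
proof -
  let ?S = "\<Sum>i\<in>UNIV. weight k i"
  let ?const = "\<lambda>c. case c of None \<Rightarrow> - 1 / ?S | Some i \<Rightarrow> weight k i / ?S"
  let ?b = "\<lambda>j. case j of None \<Rightarrow> - 1 / ?S | Some _ \<Rightarrow> 1 / ?S"
  let ?lin = "\<lambda>c j. case c of None \<Rightarrow> ?b j | Some i \<Rightarrow> (if j = Some i then 1 else 0) - weight k i * ?b j"
  have \<mu>: "((\<Sum>i\<in>UNIV. y (Some i)) - y None - 1) / ?S = - 1 / ?S + (\<Sum>j\<in>UNIV. ?b j * y j)" for y :: "'n option \<Rightarrow> complex"
    unfolding sum_option[of "\<lambda>j. ?b j * y j"] option.case
    by (simp add: diff_divide_distrib sum_divide_distrib)
  have "lame_coord c (solve k y) = ?const c + (\<Sum>i\<in>UNIV. ?lin c i * y i)" for c y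
  proof (cases c)
    case None
    then show ?thesis using \<mu>[of y] by (simp add: lame_coord_def solve_def Let_def)
  next
    case (Some i)
    have "(\<Sum>j\<in>UNIV. ((if j = Some i then 1 else 0) - weight k i * ?b j) * y j) =
        (\<Sum>j\<in>UNIV. (if j = Some i then 1 else 0) * y j) - weight k i * (\<Sum>j\<in>UNIV. ?b j * y j)"
      by (simp only: left_diff_distrib sum_subtractf sum_distrib_left mult.assoc)
    also have "(\<Sum>j\<in>UNIV. (if j = Some i then 1 else 0) * y j) = y (Some i)"
      by (simp add: if_distrib[of "\<lambda>z. z * _"] cong: if_cong)
    finally have "(\<Sum>j\<in>UNIV. ?lin c j * y j) = y (Some i) - weight k i * (\<Sum>j\<in>UNIV. ?b j * y j)"
      unfolding Some option.case .
    moreover have "lame_coord c (solve k y) = y (Some i) - weight k i * (- 1 / ?S + (\<Sum>j\<in>UNIV. ?b j * y j))"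
      unfolding \<mu>[symmetric] Some by (simp add: lame_coord_def solve_def Let_def)
    moreover have "y (Some i) - weight k i * (- 1 / ?S + T) = weight k i / ?S + (y (Some i) - weight k i * T)" for T
      by (simp add: algebra_simps)
    moreover have "?const c = weight k i / ?S" unfolding Some by simp
    ultimately show ?thesis by (simp only:)
  qed
  then show ?thesis by (intro exI[of _ ?const] exI[of _ ?lin]) blast
qed

lemma solve_continuous:
  assumes "\<And>i. continuous_on S (f i)"
  shows "continuous_on S (\<lambda>t. solve k (\<lambda>i. f i t))"
  unfolding solve_def Let_def
  by (intro continuous_intros assms) (use weight_sum_nonzero in auto)

text \<open>Here \<mu> is -1 over the sum of the weights. Since two factors of one equation differ
  by a nonzero multiple of \<mu>, the zeros at s = 0 are simple.\<close>

lemma common_zero_nonzero: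
  assumes "\<And>c. lame_form ls c (k c) v = 0"
  shows "snd v \<noteq> 0"
proof -
  have "solve k (\<lambda>_. 0) = v" using solve_lame_form[of k v] assms by simp
  then have "snd v = - 1 / (\<Sum>i\<in>UNIV. weight k i)" unfolding solve_def Let_def by auto
  then show ?thesis using weight_sum_nonzero[of k] by simp
qed

lemma common_zero_simple:
  assumes "\<And>c. lame_form ls c (k c) v = 0" "j < lame_deg ls c" "k c < lame_deg ls c" "j \<noteq> k c"
  shows "lame_form ls c j v \<noteq> 0"
proof (cases c)
  case None
  then show ?thesis using assms by (simp add: lame_deg_def)
next
  case (Some i)
  have "lame_form ls c j v = lame_form ls c (k c) v + 2 * (of_nat (k c) - of_nat j) * snd v"
    by (simp add: Some lame_form_def algebra_simps)
  then show ?thesis using assms(1)[of c] assms(4) common_zero_nonzero[OF assms(1)] by simp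
qed

lemma product_system_lame:
  assumes R: "coeff_ring R" and L: "\<And>i k. pdeg R lame_coord 1 (L i k)" and w0: "w0 \<in> R" and w: "\<And>i. w i \<in> R"
  shows "product_system R lame_coord (lame_deg ls) (lame_form ls) (lame_lower ls L w0 w)"
proof -
  interpret coeff_ring R "lame_coord :: 'n option \<Rightarrow> _" by (rule R)
  have coord: "pdeg R lame_coord 1 (\<lambda>\<theta> v. vec_nth (fst v) i)" for i
    using pdeg.coord[of 1 R lame_coord "Some i"] by (simp add: lame_coord_def)
  have mu: "pdeg R lame_coord 1 (\<lambda>\<theta> v. snd v)"
    using pdeg.coord[of 1 R lame_coord None] by (simp add: lame_coord_def)
  have mu2: "pdeg R lame_coord 2 (\<lambda>\<theta> v. (snd v)\<^sup>2)"
    unfolding power2_eq_square by (rule pdeg.mult[OF mu mu]) simp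
  show ?thesis
  proof
    show "0 < lame_deg ls i" for i by (auto simp: lame_deg_def split: option.split)
  next
    fix k :: "'n option \<Rightarrow> nat"
    obtain a0 a where "\<And>c y. lame_coord c (solve k y) = a0 c + (\<Sum>i\<in>UNIV. a c i * y i)"
      using solve_affine by blast
    then show "\<exists>a0 a. \<forall>c x. lame_coord c x = a0 c + (\<Sum>i\<in>UNIV. a c i * lame_form ls i (k i) x)"
      using solve_lame_form by metis
  next
    fix c
    show "pdeg R lame_coord (lame_deg ls c - 1) (lame_lower ls L w0 w c)"
    proof (cases c)
      case None
      then show ?thesis unfolding lame_lower_def None option.case
        by (intro pdeg_diff pdeg_const coeff w0)
    next
      case (Some i)
      have "pdeg R lame_coord (ls i) (lame_lower ls L w0 w (Some i))"
        unfolding lame_lower_def option.case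
        by (intro pdeg_divide pdeg_diff[OF pdeg_Fpoly_lower[OF coord mu2 L l_pos] coeff[OF w]])
      then show ?thesis by (simp add: Some lame_deg_def)
    qed
  next
    fix c j
    show "pdeg R lame_coord 1 (\<lambda>\<theta>. lame_form ls c j)"
    proof (cases c)
      case None
      show ?thesis unfolding None lame_form_def option.case
        by (intro pdeg_diff pdeg_sum coord pdeg_const)
    next
      case (Some i)
      show ?thesis unfolding Some lame_form_def option.case
        by (intro add pdeg_cmult coord mu)
    qed
  next
    show "inj (\<lambda>x (c :: 'n option). lame_coord c x)"
    proof (rule injI)
      fix x y :: "(complex^'n) \<times> complex" assume "(\<lambda>c. lame_coord c x) = (\<lambda>c. lame_coord c y)"
      then have eq: "lame_coord c x = lame_coord c y" for c by (rule fun_cong)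
      have "snd x = snd y" using eq[of None] by (simp add: lame_coord_def)
      moreover have "vec_nth (fst x) i = vec_nth (fst y) i" for i
        using eq[of "Some i"] by (simp add: lame_coord_def)
      ultimately show "x = y" by (simp add: prod_eq_iff Finite_Cartesian_Product.vec_eq_iff)
    qed
    show "surj (\<lambda>x (c :: 'n option). lame_coord c x)"
    proof (rule surjI)
      show "(\<lambda>c. lame_coord c ((\<chi> i. y (Some i), y None))) = y" for y :: "'n option \<Rightarrow> complex"
        by (auto simp: lame_coord_def fun_eq_iff split: option.split)
    qed
  qed
qed

end

locale lame = lame_degrees ls for ls :: "'n::finite \<Rightarrow> nat" +
  fixes \<alpha> :: "'n \<Rightarrow> nat \<Rightarrow> complex" and \<beta> :: "'n \<Rightarrow> nat \<Rightarrow> 'n \<Rightarrow> complex"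
begin

definition L :: "'n \<Rightarrow> nat \<Rightarrow> complex^'n \<Rightarrow> complex" where
  "L i k A = \<alpha> i k + (\<Sum>j\<in>UNIV. \<beta> i k j * vec_nth A j)"

definition sys :: "(complex^'n) \<times> complex \<Rightarrow> complex \<times> (complex^'n)" where
  "sys x = ((\<Sum>i\<in>UNIV. vec_nth (fst x) i), \<chi> i. Fpoly (ls i) (vec_nth (fst x) i) (snd x) (\<lambda>k. L i k (fst x)))"

definition lift :: "(complex^'n) \<times> complex \<Rightarrow> (complex^'n) \<times> complex" where
  "lift v = (fst v, (snd v)\<^sup>2)"

lemma continuous_sys: "continuous_on UNIV sys"
  unfolding sys_def L_def by (intro continuous_intros continuous_Fpoly)

abbreviation RC :: "(complex \<times> (complex^'n) \<Rightarrow> complex) set" where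
  "RC \<equiv> {c. continuous_on UNIV c}"

lemma coeff_ring_RC: "coeff_ring RC"
  by standard (auto intro: continuous_intros)

sublocale W: product_system RC lame_coord "lame_deg ls" "lame_form ls"
  "lame_lower ls (\<lambda>i k _ v. L i k (fst v)) fst (\<lambda>i w. vec_nth (snd w) i)"
proof (rule product_system_lame[OF coeff_ring_RC])
  interpret coeff_ring RC "lame_coord :: 'n option \<Rightarrow> _" by (rule coeff_ring_RC)
  have coord: "pdeg RC lame_coord 1 (\<lambda>\<theta> v. vec_nth (fst v) i)" for i :: 'n
    using pdeg.coord[of 1 RC lame_coord "Some i"] by (simp add: lame_coord_def)
  show "pdeg RC lame_coord 1 (\<lambda>_ v. L i k (fst v))" for i k
    unfolding L_def by (intro add pdeg_const pdeg_sum pdeg_cmult coord)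
qed (intro CollectI continuous_intros)+

lemma W_zeros: "v \<in> W.zeros w \<longleftrightarrow> sys (lift v) = w"
proof -
  have "v \<in> W.zeros w \<longleftrightarrow> (\<Sum>i\<in>UNIV. vec_nth (fst v) i) = fst w \<and>
      (\<forall>i. Fpoly (ls i) (vec_nth (fst v) i) ((snd v)\<^sup>2) (\<lambda>k. L i k (fst v)) = vec_nth (snd w) i)"
    unfolding W.zeros_def mem_Collect_eq split_option_all lame_equation_0 lame_equation[of ls, OF l_pos] ..
  then show ?thesis by (auto simp: sys_def lift_def prod_eq_iff Finite_Cartesian_Product.vec_eq_iff)
qed

lemma W_m: "W.m = (\<Prod>i\<in>UNIV. ls i + 1)"
  unfolding W.m_def W.card_idx prod_option by (simp add: lame_deg_def)

text \<open>The weighted homogenisation by \<open>s\<close>, with weight 1 for the \<open>A\<^sub>i\<close> and 2 for \<open>B\<close>, joins the given system at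
  \<open>s = 1\<close> to its leading forms at \<open>s = 0\<close>.\<close>
definition homog :: "'n \<Rightarrow> nat \<Rightarrow> complex \<Rightarrow> (complex^'n) \<times> complex \<Rightarrow> complex" where
  "homog i k s v = s ^ (k + 2) * \<alpha> i k + s ^ (k + 1) * (\<Sum>j\<in>UNIV. \<beta> i k j * vec_nth (fst v) j)"

definition scale :: "complex \<Rightarrow> (complex^'n) \<times> complex \<Rightarrow> (complex^'n) \<times> complex" where
  "scale s v = (\<chi> i. s * vec_nth (fst v) i, s * snd v)"

lemma homog_scale: "homog i k s (scale s v) = s ^ (k + 2) * L i k (fst v)"
  by (simp add: homog_def scale_def L_def sum_distrib_left algebra_simps)

lemma scale_inverse: "s \<noteq> 0 \<Longrightarrow> scale s (scale (1 / s) v) = v"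
  by (simp add: scale_def prod_eq_iff Finite_Cartesian_Product.vec_eq_iff)

lemma inj_scale: "s \<noteq> 0 \<Longrightarrow> inj (scale s)"
  by (rule injI) (auto simp: scale_def prod_eq_iff Finite_Cartesian_Product.vec_eq_iff)

text \<open>The condition \<mu> \<noteq> 0 makes \<open>lift\<close> exactly two-to-one on the
  fibre.\<close>

definition good :: "(complex \<times> (complex^'n)) set" where
  "good = {w. card (W.zeros w) = W.m \<and> (\<forall>v\<in>W.zeros w. snd v \<noteq> 0)}"

text \<open>The path \<open>?w0\<close>, \<open>?wi\<close> runs from the leading forms with
  \<open>F_0 = 1\<close> at s = 0 to the fibre over w at s = 1. All but finitely many s are good,
  and undoing the scaling at s near 1 yields a good value near w.\<close>

lemma good_near:
  assumes e: "e > 0"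
  shows "\<exists>w'\<in>good. dist w' w < e"
proof -
  let ?w0 = "\<lambda>s. 1 + s * (fst w - 1)"
  let ?wi = "\<lambda>i s. s ^ (ls i + 1) * vec_nth (snd w) i"
  have const_poly: "(\<lambda>s. a) \<in> range poly" for a :: complex
    by (rule image_eqI[of _ _ "[:a:]"]) auto
  have id_poly: "(\<lambda>s :: complex. s) \<in> range poly"
    by (rule image_eqI[of _ _ "[:0, 1:]"]) auto
  interpret cr: coeff_ring "range (poly :: complex poly \<Rightarrow> _)" "lame_coord :: 'n option \<Rightarrow> _"
    by (rule coeff_ring_poly)
  have powI: "(\<lambda>s :: complex. s ^ n) \<in> range poly" for n
  proof (induction n)
    case (Suc n)
    then show ?case using cr.mult_R[OF id_poly Suc] by simp
  qed (use const_poly[of 1] in simp)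
  have coord: "pdeg (range poly) lame_coord 1 (\<lambda>(\<theta> :: complex) v. vec_nth (fst v) i)" for i :: 'n
    using pdeg.coord[of 1 "range poly" lame_coord "Some i"] by (simp add: lame_coord_def)
  have hom: "pdeg (range poly) lame_coord 1 (homog i k)" for i k
  proof -
    have const: "pdeg (range poly) lame_coord 1 (\<lambda>s (v :: (complex^'n) \<times> complex). s ^ (k + 2) * \<alpha> i k)"
      by (rule pdeg.coeff[OF cr.mult_R[OF powI const_poly]])
    have "pdeg (range poly) lame_coord 1 (\<lambda>(s :: complex) v. \<Sum>j\<in>UNIV. \<beta> i k j * vec_nth (fst v) j)"
      by (intro cr.pdeg_sum cr.pdeg_cmult coord)
    then have "pdeg (range poly) lame_coord 1 (\<lambda>s v. s ^ (k + 1) * (\<Sum>j\<in>UNIV. \<beta> i k j * vec_nth (fst v) j))"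
      by (rule pdeg.mult[OF pdeg.coeff[OF powI, where D = 0]]) simp
    from pdeg.add[OF const this] show ?thesis unfolding homog_def[abs_def] .
  qed
  have w0: "?w0 \<in> range poly" by (intro cr.add_R cr.mult_R const_poly id_poly)
  have wi: "?wi i \<in> range poly" for i by (intro cr.mult_R const_poly id_poly powI)
  interpret S: product_system "range poly" lame_coord "lame_deg ls" "lame_form ls" "lame_lower ls homog ?w0 ?wi"
    by (rule product_system_lame[OF coeff_ring_poly hom w0 wi])
  have lower_0: "lame_lower ls homog ?w0 ?wi i 0 x = 0" for i x
    by (cases i) (simp_all add: lame_lower_def homog_def)
  interpret S: perturbed_products lame_coord "lame_deg ls" "lame_form ls" "lame_lower ls homog ?w0 ?wi"
  proof
    show "continuous_on UNIV (lame_coord c)" for c :: "'n option"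
    proof (cases c)
      case None
      show ?thesis unfolding None lame_coord_def option.case by (intro continuous_intros)
    next
      case (Some i)
      show ?thesis unfolding Some lame_coord_def option.case by (intro continuous_intros)
    qed
    show "lame_lower ls homog ?w0 ?wi i 0 x = 0" for i x by (rule lower_0)
    show "\<exists>\<Lambda>. (\<forall>y i. lame_form ls i (k i) (\<Lambda> y) = y i) \<and> (\<forall>x. \<Lambda> (\<lambda>i. lame_form ls i (k i) x) = x) \<and>
        (\<forall>(S :: (complex \<times> (complex^'n) \<times> complex) set) f. (\<forall>i. continuous_on S (f i)) \<longrightarrow> continuous_on S (\<lambda>t. \<Lambda> (\<lambda>i. f i t)))" for k
      by (intro exI[of _ "solve k"] conjI allI impI lame_form_solve solve_lame_form solve_continuous) auto
  next
    fix k :: "'n option \<Rightarrow> nat" and x j i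
    assume "\<And>i. k i < lame_deg ls i" "\<And>i. lame_form ls i (k i) x = 0" "j < lame_deg ls i" "j \<noteq> k i"
    then show "lame_form ls i j x \<noteq> 0" by (intro common_zero_simple) auto
  qed
  have m: "S.m = W.m" unfolding S.m_def W.m_def S.card_idx W.card_idx ..
  have zeros_0: "lame_coord None x \<noteq> 0" if "x \<in> S.zeros 0" for x
  proof -
    have "\<forall>c. \<exists>j. lame_form ls c j x = 0"
      using that unfolding S.zeros_def lower_0 by auto
    then obtain k where "\<And>c. lame_form ls c (k c) x = 0" by metis
    from common_zero_nonzero[OF this] show ?thesis by (simp add: lame_coord_def)
  qed
  define bad where "bad = {s. card (S.zeros s) \<noteq> S.m} \<union> {s. \<exists>x\<in>S.zeros s. lame_coord None x = 0}"
  have "finite bad"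
    unfolding bad_def using S.generic_card S.finite_vanishing[OF pdeg.coord[OF order.refl] zeros_0] by simp
  have "infinite (ball (0::complex) (min e 1))"
    using e uncountable_ball[of "min e 1" "0::complex"] countable_finite by auto
  moreover have "inj_on (\<lambda>t. 1 / (1 + t)) (ball (0::complex) (min e 1))"
    by (rule inj_onI) (metis add_left_cancel div_by_1 divide_divide_eq_right mult_1 one_divide_eq_0_iff)
  ultimately have "infinite ((\<lambda>t. 1 / (1 + t)) ` ball (0::complex) (min e 1))"
    using finite_imageD by blast
  then obtain t where t: "t \<in> ball (0::complex) (min e 1)" "1 / (1 + t) \<notin> bad"
    using \<open>finite bad\<close> finite_subset by (metis image_subsetI)
  \<comment> \<open>Then \<open>?w0 s / s\<close> is \<open>fst w + t\<close>: after rescaling only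
    the first component of w has moved, by t.\<close>
  define s where "s = 1 / (1 + t)"
  have "1 + t \<noteq> 0"
  proof
    assume "1 + t = 0"
    then have "t = - 1" by (simp add: add_eq_0_iff)
    then show False using t(1) by simp
  qed
  then have s: "s \<noteq> 0" "1 / s = 1 + t" by (simp_all add: s_def)
  define w' where "w' = (?w0 s / s, snd w)"
  have "fst w' = fst w + t"
    using s by (simp add: w'_def add_divide_distrib)
  then have "dist w' w = norm t" by (simp add: dist_prod_def w'_def dist_norm)
  then have near: "dist w' w < e" using t(1) by simp
  have scale: "scale s v \<in> S.zeros s \<longleftrightarrow> v \<in> W.zeros w'" for v
  proof -
    have "scale s v \<in> S.zeros s \<longleftrightarrow> (\<Sum>i\<in>UNIV. s * vec_nth (fst v) i) = ?w0 s \<and>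
        (\<forall>i. Fpoly (ls i) (s * vec_nth (fst v) i) (s\<^sup>2 * (snd v)\<^sup>2) (\<lambda>k. s ^ (k + 2) * L i k (fst v)) = ?wi i s)"
      unfolding S.zeros_def mem_Collect_eq split_option_all lame_equation_0 lame_equation[of ls, OF l_pos] homog_scale
      by (simp add: scale_def power_mult_distrib)
    also have "\<dots> \<longleftrightarrow> (\<Sum>i\<in>UNIV. vec_nth (fst v) i) = fst w' \<and>
        (\<forall>i. Fpoly (ls i) (vec_nth (fst v) i) ((snd v)\<^sup>2) (\<lambda>k. L i k (fst v)) = vec_nth (snd w') i)"
      unfolding Fpoly_scale[OF l_pos] using s(1)
      by (simp add: w'_def field_simps flip: sum_distrib_left)
    also have "\<dots> \<longleftrightarrow> v \<in> W.zeros w'"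
      unfolding W_zeros by (simp add: sys_def lift_def prod_eq_iff Finite_Cartesian_Product.vec_eq_iff)
    finally show ?thesis .
  qed
  have "S.zeros s = scale s ` W.zeros w'"
  proof (intro equalityI subsetI)
    fix v assume "v \<in> S.zeros s"
    then have "scale (1 / s) v \<in> W.zeros w'" using scale[of "scale (1 / s) v"] scale_inverse[OF s(1)] by simp
    then show "v \<in> scale s ` W.zeros w'" using scale_inverse[OF s(1)] by (metis imageI)
  qed (use scale in auto)
  then have "card (W.zeros w') = card (S.zeros s)"
    using inj_scale[OF s(1)] by (simp add: card_image inj_on_subset)
  also have "\<dots> = W.m" using t(2) m by (simp add: bad_def s_def)
  finally have "card (W.zeros w') = W.m" .
  moreover have "snd v \<noteq> 0" if "v \<in> W.zeros w'" for v
  proof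
    assume "snd v = 0"
    then have "lame_coord None (scale s v) = 0" by (simp add: lame_coord_def scale_def)
    then show False using scale[of v] that t(2) by (auto simp: bad_def s_def)
  qed
  ultimately show ?thesis using near unfolding good_def by blast
qed

section \<open>From fibres in (A, \<mu>) to fibres in (A, B)\<close>

lemma lift_csqrt: "lift (fst x, csqrt (snd x)) = x"
  by (simp add: lift_def)

lemma lift_csqrt': "lift (fst x, - csqrt (snd x)) = x"
  by (simp add: lift_def)

lemma fibre_lift: "{x. sys x = w} = lift ` W.zeros w"
proof (intro equalityI subsetI)
  fix x assume "x \<in> {x. sys x = w}"
  then have "(fst x, csqrt (snd x)) \<in> W.zeros w" by (simp only: W_zeros lift_csqrt mem_Collect_eq)
  then show "x \<in> lift ` W.zeros w" by (intro image_eqI[where f = lift]) (simp_all add: lift_csqrt)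
next
  fix x assume "x \<in> lift ` W.zeros w"
  then show "x \<in> {x. sys x = w}" using W_zeros by blast
qed

lemma fibre_finite: "finite {x. sys x = w}"
  unfolding fibre_lift using W.zeros_finite_card by blast

lemma lift_pair:
  assumes "sys x = w"
  shows "{v \<in> W.zeros w. lift v = x} = {(fst x, csqrt (snd x)), (fst x, - csqrt (snd x))}"
proof -
  have "(snd v)\<^sup>2 = snd x \<longleftrightarrow> snd v = csqrt (snd x) \<or> snd v = - csqrt (snd x)" for v :: "(complex^'n) \<times> complex"
    by (metis power2_csqrt power2_eq_iff)
  then have eq: "lift v = x \<longleftrightarrow> v = (fst x, csqrt (snd x)) \<or> v = (fst x, - csqrt (snd x))" for v
    by (auto simp: lift_def prod_eq_iff)
  have "v \<in> W.zeros w" if "lift v = x" for v unfolding W_zeros that by (rule assms)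
  then show ?thesis using eq by blast
qed

lemma prod_lift:
  fixes h :: "(complex^'n) \<times> complex \<Rightarrow> 'b::comm_monoid_mult"
  assumes "w \<in> good"
  shows "(\<Prod>v\<in>W.zeros w. h (lift v)) = (\<Prod>x\<in>{x. sys x = w}. h x ^ 2)"
proof -
  have "(\<Prod>v\<in>W.zeros w. h (lift v)) = (\<Prod>x\<in>{x. sys x = w}. \<Prod>v\<in>{v \<in> W.zeros w. lift v = x}. h (lift v))"
    using W.zeros_finite_card[of w] fibre_finite[of w] fibre_lift[of w] by (subst prod.group) auto
  also have "\<dots> = (\<Prod>x\<in>{x. sys x = w}. h x ^ 2)"
  proof (intro prod.cong refl)
    fix x assume "x \<in> {x. sys x = w}"
    then have x: "sys x = w" by simp
    have "(fst x, csqrt (snd x)) \<in> W.zeros w" using lift_pair[OF x] by blast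
    then have "csqrt (snd x) \<noteq> 0" using assms unfolding good_def by fastforce
    then have "csqrt (snd x) \<noteq> - csqrt (snd x)" by simp
    then show "(\<Prod>v\<in>{v \<in> W.zeros w. lift v = x}. h (lift v)) = h x ^ 2"
      unfolding lift_pair[OF x] by (simp add: lift_csqrt lift_csqrt' power2_eq_square)
  qed
  finally show ?thesis .
qed

lemma card_good:
  assumes "w \<in> good"
  shows "2 * card {x. sys x = w} = W.m"
proof -
  \<comment> \<open>The product formula for the constant 2 counts points in the exponent.\<close>
  have "(2::nat) ^ card (W.zeros w) = 2 ^ (2 * card {x. sys x = w})"
    using prod_lift[OF assms, of "\<lambda>_. 2 :: nat"] by (simp add: power_mult)
  then have "card (W.zeros w) = 2 * card {x. sys x = w}" by simp
  then show ?thesis using assms by (simp add: good_def)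
qed

lemma continuous_det_matr:
  assumes "W.represents g C"
  shows "continuous_on UNIV (\<lambda>w. Determinant.det (W.matr C w))"
proof -
  have "Determinant.det (W.matr C w) = (\<Sum>p\<in>{p. p permutes {0..<W.m}}. signof p * (\<Prod>i = 0..<W.m. C i (p i) w))" for w
    unfolding det_def'[OF W.matr_carrier]
    by (intro sum.cong arg_cong2[of _ _ _ _ "(*)"] prod.cong refl) (auto simp: W.matr_def permutes_in_image)
  moreover have "continuous_on UNIV (C i (p i))" if "p permutes {0..<W.m}" "i \<in> {0..<W.m}" for p i
    using assms that permutes_in_image[of p] unfolding W.represents_def by force
  then have "continuous_on UNIV (\<lambda>w. \<Sum>p\<in>{p. p permutes {0..<W.m}}. signof p * (\<Prod>i = 0..<W.m. C i (p i) w))"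
    by (intro continuous_intros) auto
  ultimately show ?thesis by simp
qed

text \<open>On the zero sets each coordinate is an eigenvalue of a matrix that depends continuously
  on w, hence is bounded over a compact ball of values.\<close>

lemma proper_sys: "bounded {x. norm (sys x) \<le> B}"
proof -
  have "\<forall>c :: 'n option. \<exists>K. \<forall>w\<in>cball 0 B. \<forall>v\<in>W.zeros w. norm (lame_coord c v) \<le> K"
  proof
    fix c :: "'n option"
    obtain C where C: "W.represents (\<lambda>_. lame_coord c) C"
      by (rule W.represents_exists[OF pdeg.coord[OF order.refl]])
    have "continuous_on (cball 0 B) (\<lambda>w. \<Sum>k<W.m. \<Sum>l<W.m. norm (C k l w))"
      using C unfolding W.represents_def
      by (intro continuous_intros) (auto intro: continuous_on_subset)
    then have "compact ((\<lambda>w. \<Sum>k<W.m. \<Sum>l<W.m. norm (C k l w)) ` cball 0 B)"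
      by (rule compact_continuous_image) simp
    from compact_imp_bounded[OF this] obtain K where
      K: "\<forall>w\<in>cball 0 B. norm (\<Sum>k<W.m. \<Sum>l<W.m. norm (C k l w)) \<le> K"
      unfolding bounded_iff by blast
    have "norm (lame_coord c v) \<le> K" if "w \<in> cball 0 B" "v \<in> W.zeros w" for w v
      using W.matr_bound[OF C that(2)] bspec[OF K that(1)] unfolding real_norm_def by linarith
    then show "\<exists>K. \<forall>w\<in>cball 0 B. \<forall>v\<in>W.zeros w. norm (lame_coord c v) \<le> K" by blast
  qed
  from choice[OF this] obtain K where
    "\<forall>c :: 'n option. \<forall>w\<in>cball 0 B. \<forall>v\<in>W.zeros w. norm (lame_coord c v) \<le> K c" by blast
  then have K: "norm (lame_coord c v) \<le> K c" if "norm w \<le> B" "v \<in> W.zeros w" for c :: "'n option" and w v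
    using that by simp
  have "norm x \<le> (\<Sum>i\<in>UNIV. K (Some i)) + (K None)\<^sup>2" if x: "norm (sys x) \<le> B" for x
  proof -
    let ?v = "(fst x, csqrt (snd x))"
    have v: "?v \<in> W.zeros (sys x)" by (simp add: W_zeros lift_csqrt)
    have "norm (vec_nth (fst x) i) \<le> K (Some i)" for i
      using K[OF x v, of "Some i"] by (simp add: lame_coord_def)
    then have "norm (fst x) \<le> (\<Sum>i\<in>UNIV. K (Some i))"
      unfolding norm_vec_def by (intro order.trans[OF L2_set_le_sum] sum_mono) auto
    moreover have "norm (csqrt (snd x)) \<le> K None"
      using K[OF x v, of None] by (simp only: lame_coord_def option.case snd_conv)
    then have "(norm (csqrt (snd x)))\<^sup>2 \<le> (K None)\<^sup>2" by (rule power_mono) simp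
    then have "norm (snd x) \<le> (K None)\<^sup>2" by (simp only: norm_power[symmetric] power2_csqrt)
    moreover have "norm x \<le> norm (fst x) + norm (snd x)"
      using norm_Pair_le[of "fst x" "snd x"] by simp
    ultimately show ?thesis by linarith
  qed
  then show ?thesis unfolding bounded_iff by blast
qed

definition lifted_polys :: "((complex^'n) \<times> complex \<Rightarrow> complex) set" where
  "lifted_polys = {h. continuous_on UNIV h \<and> (\<exists>D. pdeg RC lame_coord D (\<lambda>_ v. h (lift v)))}"

lemma lifted_polys_interpolate:
  assumes "finite Y"
  shows "\<exists>h\<in>lifted_polys. \<forall>y\<in>Y. h y = f y"
proof -
  have coord: "(\<lambda>x. vec_nth (fst x) i) \<in> lifted_polys" for i
  proof -
    have "pdeg RC lame_coord 1 (\<lambda>_ v. vec_nth (fst (lift v)) i)"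
      using pdeg.coord[of 1 RC lame_coord "Some i"] by (simp add: lame_coord_def lift_def)
    moreover have "continuous_on UNIV (\<lambda>x :: (complex^'n) \<times> complex. vec_nth (fst x) i)"
      by (intro continuous_intros)
    ultimately show ?thesis unfolding lifted_polys_def by blast
  qed
  have last: "snd \<in> lifted_polys"
  proof -
    have "pdeg RC lame_coord 2 (\<lambda>_ v. lame_coord None v * lame_coord None (v :: (complex^'n) \<times> complex))"
      by (rule pdeg.mult[OF pdeg.coord[OF order.refl] pdeg.coord[OF order.refl]]) simp
    then have "pdeg RC lame_coord 2 (\<lambda>_ (v :: (complex^'n) \<times> complex). snd (lift v))"
      by (simp add: lame_coord_def lift_def power2_eq_square)
    moreover have "continuous_on UNIV (snd :: (complex^'n) \<times> complex \<Rightarrow> complex)"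
      by (intro continuous_intros)
    ultimately show ?thesis unfolding lifted_polys_def by blast
  qed
  obtain h where "h \<in> lifted_polys" "\<And>y. y \<in> Y \<Longrightarrow> h y = f y"
  proof (rule finite_interpolation[of lifted_polys Y f])
    show "(\<lambda>_. a) \<in> lifted_polys" for a
      unfolding lifted_polys_def using W.pdeg_const by auto
  next
    fix f g assume "f \<in> lifted_polys" "g \<in> lifted_polys"
    then obtain D E where fg: "continuous_on UNIV f" "continuous_on UNIV g"
      "pdeg RC lame_coord D (\<lambda>_ v. f (lift v))" "pdeg RC lame_coord E (\<lambda>_ v. g (lift v))"
      unfolding lifted_polys_def by blast
    have "pdeg RC lame_coord (D + E) (\<lambda>_ v. f (lift v) + g (lift v))"
      by (intro pdeg.add pdeg_mono[OF fg(3)] pdeg_mono[OF fg(4)]) auto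
    then show "(\<lambda>x. f x + g x) \<in> lifted_polys"
      using continuous_on_add[OF fg(1,2)] unfolding lifted_polys_def by blast
    have "pdeg RC lame_coord (D + E) (\<lambda>_ v. f (lift v) * g (lift v))"
      by (intro pdeg.mult[OF fg(3,4)]) auto
    then show "(\<lambda>x. f x * g x) \<in> lifted_polys"
      using continuous_on_mult[OF fg(1,2)] unfolding lifted_polys_def by blast
  next
    fix x y :: "(complex^'n) \<times> complex" assume "x \<noteq> y"
    then consider "snd x \<noteq> snd y" | i where "vec_nth (fst x) i \<noteq> vec_nth (fst y) i"
      by (auto simp: prod_eq_iff Finite_Cartesian_Product.vec_eq_iff)
    then show "\<exists>g\<in>lifted_polys. g x \<noteq> g y"
    proof cases
      case 1
      then show ?thesis by (rule bexI[OF _ last])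
    next
      case (2 i)
      then show ?thesis by (rule bexI[OF _ coord])
    qed
  qed (use assms in auto)
  then show ?thesis by blast
qed

text \<open>The determinant for h multiplies over the doubled fibre, so it is the norm of h^2 and
  not of h. Squares still interpolate arbitrary values, since complex numbers have square
  roots.\<close>

sublocale fpm: finite_proper_map sys good "W.m div 2" "{\<lambda>x. h x ^ 2 | h. h \<in> lifted_polys}"
proof
  show "continuous_on UNIV sys" by (rule continuous_sys)
  show "bounded {x. norm (sys x) \<le> B}" for B by (rule proper_sys)
  show "finite {x. sys x = w}" for w by (rule fibre_finite)
  show "closure good = UNIV" using good_near by (auto simp: closure_approachable)
  show "card {x. sys x = w} = W.m div 2" if "w \<in> good" for w using card_good[OF that] by simp
next
  fix Y :: "((complex^'n) \<times> complex) set" and f :: "(complex^'n) \<times> complex \<Rightarrow> complex" assume "finite Y"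
  from lifted_polys_interpolate[OF this, of "\<lambda>x. csqrt (f x)"]
  obtain h where "h \<in> lifted_polys" "\<forall>y\<in>Y. h y = csqrt (f y)" by blast
  then show "\<exists>g\<in>{\<lambda>x. h x ^ 2 | h. h \<in> lifted_polys}. \<forall>y\<in>Y. g y = f y"
    by (intro bexI[of _ "\<lambda>x. h x ^ 2"]) auto
next
  fix g assume "g \<in> {\<lambda>x. h x ^ 2 | h. h \<in> lifted_polys}"
  then obtain h D where g: "g = (\<lambda>x. h x ^ 2)" and h: "continuous_on UNIV h" "pdeg RC lame_coord D (\<lambda>_ v. h (lift v))"
    unfolding lifted_polys_def by blast
  show "continuous_on UNIV g" unfolding g by (intro continuous_intros h(1))
  obtain C where C: "W.represents (\<lambda>_ v. h (lift v)) C" by (rule W.represents_exists[OF h(2)])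
  have "Determinant.det (W.matr C w) = (\<Prod>x\<in>{x. sys x = w}. g x)" if "w \<in> good" for w
    using W.det_matr[OF _ C] prod_lift[OF that, of h] that unfolding g good_def by auto
  moreover have "Determinant.det (W.matr C (sys x)) = 0" if "g x = 0" for x
  proof (rule W.det_matr_zero[OF C])
    show "(fst x, csqrt (snd x)) \<in> W.zeros (sys x)" by (simp add: W_zeros lift_csqrt)
    show "h (lift (fst x, csqrt (snd x))) = 0" using that by (simp add: lift_csqrt g)
  qed
  ultimately show "\<exists>\<nu>. continuous_on UNIV \<nu> \<and> (\<forall>w\<in>good. \<nu> w = (\<Prod>x\<in>{x. sys x = w}. g x)) \<and>
      (\<forall>x. g x = 0 \<longrightarrow> \<nu> (sys x) = 0)"
    using continuous_det_matr[OF C] by (intro exI[of _ "\<lambda>w. Determinant.det (W.matr C w)"]) blast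
qed

theorem count_zeros:
  "finite {x. sys x = 0}"
  "2 * (\<Sum>x\<in>{x. sys x = 0}. zero_mult sys x) = (\<Prod>i\<in>UNIV. ls i + 1)"
proof -
  show "finite {x. sys x = 0}" by (rule fibre_finite)
  have "\<exists>w'\<in>good. dist w' 0 < 1" by (rule good_near) simp
  then obtain w where w: "w \<in> good" by (elim bexE)
  \<comment> \<open>One good value shows that \<open>W.m\<close> is even, so the division is
    exact.\<close>
  have "2 * (W.m div 2) = W.m" unfolding card_good[OF w, symmetric] by simp
  then show "2 * (\<Sum>x\<in>{x. sys x = 0}. zero_mult sys x) = (\<Prod>i\<in>UNIV. ls i + 1)"
    unfolding fpm.sum_zero_mult W_m[symmetric] .
qed

end

theorem theorem3p5:
  fixes \<omega>1 \<omega>2 :: complex and p :: "'n::finite \<Rightarrow> complex" and ls :: "'n \<Rightarrow> nat"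
  assumes lattice_nondeg: "Im (\<omega>2 / \<omega>1) \<noteq> 0"
    and distinct: "\<And>i j. i \<noteq> j \<Longrightarrow> p i - p j \<notin> lattice \<omega>1 \<omega>2"
    and l_pos: "\<And>i. ls i \<ge> 1"
    and l_odd: "odd (\<Sum>i\<in>UNIV. ls i)"
  shows "finite {AB. lame_system \<omega>1 \<omega>2 p ls AB = 0} \<and>
         real (\<Sum>AB\<in>{AB. lame_system \<omega>1 \<omega>2 p ls AB = 0}. zero_mult (lame_system \<omega>1 \<omega>2 p ls) AB)
           = (\<Prod>i\<in>UNIV. real (ls i) + 1) / 2"
proof -
  interpret lame ls "\<lambda>i k. \<Sum>j\<in>UNIV. eta (ls j) * (eta (ls j) + 1) * cwp \<omega>1 \<omega>2 p i j k"
    "\<lambda>i k j. czeta \<omega>1 \<omega>2 p i j k"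
    by standard (use l_pos l_odd in auto)
  have L: "L i k A = Lcoef \<omega>1 \<omega>2 p ls i k A" for i k A
    unfolding L_def Lcoef_def by (simp add: sum.distrib mult.commute)
  have sys: "sys = lame_system \<omega>1 \<omega>2 p ls"
    by (rule ext) (simp only: sys_def lame_system_def Let_def L)
  have "2 * real (\<Sum>AB\<in>{AB. sys AB = 0}. zero_mult sys AB) = real (\<Prod>i\<in>UNIV. ls i + 1)"
    unfolding count_zeros(2)[symmetric] of_nat_mult of_nat_numeral ..
  also have "\<dots> = (\<Prod>i\<in>UNIV. real (ls i) + 1)"
    by (simp only: of_nat_prod of_nat_add of_nat_1)
  finally have "real (\<Sum>AB\<in>{AB. sys AB = 0}. zero_mult sys AB) = (\<Prod>i\<in>UNIV. real (ls i) + 1) / 2"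
    by linarith
  with count_zeros(1) show ?thesis unfolding sys by (rule conjI)
qed

end
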